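(* In the setting described in the context (spaces $V\hookrightarrow H\hookrightarrow V'$, $\alpha\in[0,1[$, damping $\gamma$, operator $A$, nonlinearity $f=\nabla F$, convex function $\Phi$ with $\arg\min\Phi\neq\emptyset$, and source $g\in L^1(\mathbb{R}^+,H)$), assume that $$\int_0^{+\infty}(1+t)^{\alpha}|g(t)|\,dt<\infty\quad\text{and}\quad \int_0^{+\infty}(1+t)^{3\alpha}|g(t)|^2\,dt<\infty .$$ Let $u\in W^{2,1}_{loc}(\mathbb{R}^+,H)\cap W^{1,1}_{loc}(\mathbb{R}^+,V)$ be a solution of $$u''(t)+\gamma(t)u'(t)+Au(t)+f(u(t))=g(t),\quad t\ge 0.$$ Then $u\in L^\infty(\mathbb{R}^+,H)$, and therefore $u(t)$ converges weakly in $V$ as $t\to+\infty$ toward some element of $\arg\min\Phi$, and the energy function $$\mathcal{E}(t):=\tfrac12|u'(t)|^2+\Phi(u(t))-\Phi^*$$ satisfies $\mathcal{E}(t)=o(t^{-2\alpha})$ as $t\to+\infty$.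
   Context: Setting. $\mathbb{R}^+=[0,+\infty)$. $H$ is a real Hilbert space with inner product $\langle\cdot,\cdot\rangle$ and norm $|\cdot|$. $V$ is another Hilbert space, with norm $\|\cdot\|_V$, continuously and densely embedded in $H$; $V'$ is the dual of $V$. Identifying $H$ with its dual, $V\hookrightarrow H\hookrightarrow V'$, and $\langle v,w\rangle_{V',V}=\langle v,w\rangle$ for all $(v,w)\in H\times V$. Damping: $\alpha\in[0,1[$, and $\gamma\in W^{1,1}_{loc}(\mathbb{R}^+,\mathbb{R}^+)$ is such that there exist $K>0$ and $t_0\ge0$ with $\gamma(t)\ge \frac{K}{(1+t)^\alpha}$ for all $t\ge t_0$, and $\big((1+t)^\alpha\gamma(t)\big)'\le 0$ for a.e. $t\ge t_0$. Operator: $A:V\to V'$ is linear and continuous; the bilinear form $a(v,w)=\langle Av,w\rangle_{V',V}$ on $V\times V$ is symmetric, positive ($a(v,v)\ge0$ for all $v\in V$), and there exist $\lambda\ge0$, $\mu>0$ with $a(v,v)+\lambda|v|^2\ge\mu\|v\|_V^2$ for all $v\in V$. Nonlinearity: $f:V\to V'$ is continuous and there is a $C^1$ convex function $F:V\to\mathbb{R}$ with $F'(u)(v)=\langle f(u),v\rangle_{V',V}$ for all $u,v\in V$. Potential: $\Phi:V\to\mathbb{R}$, $\Phi(v)=\frac12 a(v,v)+F(v)$; it is a $C^1$ convex function with $\nabla\Phi(v)=Av+f(v)$. The set $\arg\min\Phi=\{v\in V:\Phi(v)=\min_V\Phi\}=\{v\in V: Av+f(v)=0\}$ is assumed nonempty,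 and $\Phi^*:=\min_V\Phi$. Source: $g\in L^1(\mathbb{R}^+,H)$. The equation is understood to hold for almost every $t\ge0$. *)

theory Defs
  imports "HOL-Analysis.Analysis" "HOL-Library.Landau_Symbols"
begin

section \<open>Bochner integration without separability\<close>

text \<open>
  The constant \<^const>\<open>has_bochner_integral\<close> is restricted to second countable spaces, which would
  force the Hilbert spaces to be separable.  The following is the same definition for Lebesgue
  measure on the line, without that sort constraint.
\<close>

definition has_bochner :: "(real \<Rightarrow> 'a) \<Rightarrow> 'a::real_normed_vector \<Rightarrow> bool" where
  "has_bochner f x \<longleftrightarrow> f \<in> borel_measurable lebesgue \<and>
     (\<exists>s. (\<forall>i::nat. Bochner_Integration.simple_bochner_integrable lebesgue (s i)) \<and>
          (\<lambda>i. \<integral>\<^sup>+t. ennreal (norm (f t - s i t)) \<partial>lebesgue) \<longlonglongrightarrow> 0 \<and>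
          (\<lambda>i. Bochner_Integration.simple_bochner_integral lebesgue (s i)) \<longlonglongrightarrow> x)"

lemma has_bochner_eq_has_bochner_integral:
  fixes f :: "real \<Rightarrow> 'a::{real_normed_vector, second_countable_topology}"
  shows "has_bochner f x \<longleftrightarrow> has_bochner_integral lebesgue f x"
  unfolding has_bochner_def has_bochner_integral.simps by blast

definition L1_on :: "real set \<Rightarrow> (real \<Rightarrow> 'a::real_normed_vector) \<Rightarrow> bool" where
  "L1_on S f \<longleftrightarrow> (\<exists>x. has_bochner (\<lambda>t. indicator S t *\<^sub>R f t) x)"

text \<open>Local integrability on the closed half-line: the endpoint 0 is included.\<close>

definition L1_loc :: "(real \<Rightarrow> 'a::real_normed_vector) \<Rightarrow> bool" where
  "L1_loc f \<longleftrightarrow> (\<forall>T>0. L1_on {0..T} f)"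

definition strongly_measurable_on :: "real set \<Rightarrow> (real \<Rightarrow> 'a::real_normed_vector) \<Rightarrow> bool" where
  "strongly_measurable_on S f \<longleftrightarrow>
     (\<exists>s. (\<forall>i::nat. simple_function lebesgue (s i)) \<and>
          (AE t in lebesgue. (\<lambda>i. s i t) \<longlonglongrightarrow> indicator S t *\<^sub>R f t))"

definition Linfty_on :: "real set \<Rightarrow> (real \<Rightarrow> 'a::real_normed_vector) \<Rightarrow> bool" where
  "Linfty_on S f \<longleftrightarrow> strongly_measurable_on S f \<and>
     (\<exists>C. AE t in lebesgue. t \<in> S \<longrightarrow> norm (f t) \<le> C)"

section \<open>Sobolev spaces on the half-line\<close>

text \<open>\<open>C\<^sup>\<infinity>\<close> functions with compact support in the open half-line.\<close>

definition test_function :: "(real \<Rightarrow> real) \<Rightarrow> bool" where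
  "test_function \<phi> \<longleftrightarrow>
     (\<forall>n t. ((deriv ^^ n) \<phi>) differentiable (at t)) \<and>
     (\<exists>a b. 0 < a \<and> (\<forall>t. t \<notin> {a..b} \<longrightarrow> \<phi> t = 0))"

text \<open>\<open>w\<close> is the derivative of \<open>u\<close> in the sense of vector-valued distributions, both functions
  being locally integrable: \<open>\<integral> \<phi>' u = - \<integral> \<phi> w\<close>.  The values of \<open>u\<close> and \<open>w\<close> on the negative
  half-line are irrelevant, because \<open>\<phi>\<close> vanishes there.\<close>

definition weak_deriv :: "(real \<Rightarrow> 'a::real_normed_vector) \<Rightarrow> (real \<Rightarrow> 'a) \<Rightarrow> bool" where
  "weak_deriv u w \<longleftrightarrow> L1_loc u \<and> L1_loc w \<and>
     (\<forall>\<phi>. test_function \<phi> \<longrightarrow>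
        (\<exists>x. has_bochner (\<lambda>t. deriv \<phi> t *\<^sub>R u t) x \<and> has_bochner (\<lambda>t. \<phi> t *\<^sub>R w t) (- x)))"

text \<open>The elements of \<open>W\<^sup>1\<^sup>,\<^sup>1\<^sub>l\<^sub>o\<^sub>c\<close> are given by their continuous representatives; this is
  what gives a meaning to pointwise values.\<close>

definition W11_loc :: "(real \<Rightarrow> 'a::real_normed_vector) \<Rightarrow> bool" where
  "W11_loc u \<longleftrightarrow> continuous_on {0..} u \<and> (\<exists>w. weak_deriv u w)"

section \<open>The dual space, the potential and the energy\<close>

text \<open>The dual \<open>V'\<close> is \<^typ>\<open>'v \<Rightarrow>\<^sub>L real\<close> with the operator norm.  With \<open>j\<close> the embedding of \<open>V\<close>
  into \<open>H\<close>, a vector \<open>h\<close> of \<open>H\<close> is identified with the functional \<open>v \<mapsto> \<langle>h, j v\<rangle>\<close>.\<close>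

definition to_dual ::
    "('v::real_normed_vector \<Rightarrow>\<^sub>L 'h::real_inner) \<Rightarrow> 'h \<Rightarrow> ('v \<Rightarrow>\<^sub>L real)" where
  "to_dual j h = blinfun_inner_right h o\<^sub>L j"

definition potential ::
    "('v::real_normed_vector \<Rightarrow>\<^sub>L ('v \<Rightarrow>\<^sub>L real)) \<Rightarrow> ('v \<Rightarrow> real) \<Rightarrow> 'v \<Rightarrow> real" where
  "potential A F v = 1/2 * A v v + F v"

definition argmin_set :: "('v \<Rightarrow> real) \<Rightarrow> 'v set" where
  "argmin_set \<Phi> = {v. is_arg_min \<Phi> (\<lambda>_. True) v}"

text \<open>The infimum below is the minimum of \<open>\<Phi>\<close> as soon as \<open>\<Phi>\<close> has a minimizer.\<close>

definition energy ::
    "('v \<Rightarrow> real) \<Rightarrow> (real \<Rightarrow> 'v) \<Rightarrow> (real \<Rightarrow> 'h::real_normed_vector) \<Rightarrow> real \<Rightarrow> real" where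
  "energy \<Phi> u u' t = 1/2 * (norm (u' t))\<^sup>2 + \<Phi> (u t) - (INF v. \<Phi> v)"

definition weakly_tendsto ::
    "('b \<Rightarrow> 'v::real_normed_vector) \<Rightarrow> 'v \<Rightarrow> 'b filter \<Rightarrow> bool" where
  "weakly_tendsto u v G \<longleftrightarrow> (\<forall>l :: 'v \<Rightarrow>\<^sub>L real. ((\<lambda>t. l (u t)) \<longlongrightarrow> l v) G)"

end

theory Submission
  imports Defs
begin

text \<open>
  Put \<open>P(t) = (1 + t)\<^sup>\<alpha>\<close> and \<open>c = P \<gamma>\<close>, let \<open>v\<close> be a minimizer and let \<open>e\<close> be the energy.  Along the
  trajectory consider \<open>X = P\<^sup>2 e\<close> and \<open>W = P \<langle>u - v, u'\<rangle> + (c - P') |u - v|\<^sup>2 / 2\<close>.  Convexity of the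
  potential gives
  \<open>W' \<le> 3/2 P |u'|\<^sup>2 - P e + P |g| |u - v| - P'' |u - v|\<^sup>2 / 2\<close>, while the energy identity gives
  \<open>X' \<le> 2 P P' e - K/2 P |u'|\<^sup>2 + P\<^sup>3 |g|\<^sup>2 / (2 K)\<close>.
  Since \<open>\<alpha> < 1\<close>, \<open>P'\<close> tends to 0, so for large times \<open>L = W + (8/K) X\<close> dominates \<open>|u - v|\<^sup>2\<close> and \<open>X\<close>,
  and \<open>L' + P e / 2\<close> is at most \<open>P |g| |u - v| + 4/K\<^sup>2 P\<^sup>3 |g|\<^sup>2 - P'' |u - v|\<^sup>2 / 2\<close>.  Integrating up to a time
  where \<open>|u - v|\<close> is maximal shows that \<open>u - v\<close> is bounded, since \<open>-P''\<close> has a small integral; then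
  \<open>X\<close> is bounded and \<open>P e\<close> is integrable.  Then \<open>X\<close> and \<open>W\<close> converge, having derivatives bounded above by
  integrable functions; the limit of \<open>X\<close> is 0 because \<open>1 / P\<close> is not integrable, and the convergence
  of \<open>W\<close> and \<open>c\<close> yields that of \<open>|u - v|\<close>.  Opial's argument then gives weak convergence.
\<close>

text \<open>The equation holds in \<open>V'\<close> and can only be tested against vectors of
  \<open>V\<close>, while the energy identity needs the test vector \<open>u'\<close>, given only in
  \<open>H\<close>. The derivative \<open>w\<close> of \<open>u\<close> in \<open>V\<close> resolves
  this: \<open>j w = u'\<close> almost everywhere, by uniqueness of weak derivatives. Neither
  Hilbert space is assumed separable, so vector-valued integrals are composed with bounded
  functionals at once, and all calculus is done with integrals of real functions. The coefficient
  \<open>c - P'\<close> in \<open>W\<close> is dictated by cancellation: with \<open>z\<close> the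
  inner product of \<open>u - v\<close> and \<open>u'\<close>, differentiating
  \<open>(c - P') |u - v|^2 / 2\<close> yields \<open>(c - P') z\<close>, which removes both the
  damping term \<open>- c z\<close> of \<open>P z'\<close> and the term \<open>P' z\<close> from the
  weight. What remains is \<open>c' |u - v|^2 / 2 \<le> 0\<close>, by monotonicity of
  \<open>c\<close>, and \<open>- P'' |u - v|^2 / 2\<close>, which is nonnegative as \<open>P\<close>
  is concave but has a primitive tending to 0. The conditions on \<open>g\<close> fit the two source
  terms: \<open>P |g| |u - v|\<close> in \<open>W'\<close>, and \<open>P^3 |g|^2\<close>, left by
  Young's inequality when half of the dissipation \<open>K P |u'|^2\<close> absorbs
  \<open>P^2 |g| |u'|\<close> in \<open>X'\<close>.\<close>

section \<open>Smooth cut-offs and distributional derivatives\<close>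

text \<open>For \<open>n = 0\<close> this is the classical smooth function that is flat at 0. The
  powers of \<open>1 / x\<close> are the factors that repeated differentiation produces, so the
  linear combinations of the family are closed under differentiation.\<close>

definition flat :: "nat \<Rightarrow> real \<Rightarrow> real" where
  "flat n x = (if x > 0 then (1 / x) ^ n * exp (- (1 / x)) else 0)"

lemma flat_tendsto_0: "((flat n) \<longlongrightarrow> 0) (at_right 0)"
proof -
  have "((\<lambda>x::real. (1/x) ^ n / exp (1/x)) \<longlongrightarrow> 0) (at_right 0)"
    by (rule filterlim_compose[OF tendsto_power_div_exp_0])
       (simp add: divide_inverse filterlim_inverse_at_top_right)
  moreover have "eventually (\<lambda>x. (1/x) ^ n / exp (1/x) = flat n x) (at_right 0)"
    unfolding eventually_at_right_field
    by (intro exI[of _ 1]) (auto simp: flat_def exp_minus field_simps)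
  ultimately show ?thesis
    by (rule Lim_transform_eventually)
qed

text \<open>Away from 0 this is the product rule. At 0 the difference quotient of
  \<open>flat n\<close> from the right is \<open>flat (n + 1)\<close>, which tends to 0, so one
  formula covers all points.\<close>

lemma flat_deriv: "(flat n has_real_derivative flat (n + 2) x - n * flat (n + 1) x) (at x)"
proof (cases x "0::real" rule: linorder_cases)
  case less
  have "((\<lambda>x. 0) has_real_derivative flat (n + 2) x - n * flat (n + 1) x) (at x)"
    using less by (simp add: flat_def)
  then show ?thesis
    by (rule DERIV_cong_ev[OF refl _ refl, THEN iffD1, rotated])
       (use less in \<open>auto simp: flat_def eventually_nhds intro!: exI[of _ "{..<0}"]\<close>)
next
  case greater
  have "((\<lambda>x. (1 / x) ^ n * exp (- (1 / x))) has_real_derivative flat (n + 2) x - n * flat (n + 1) x) (at x)"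
  proof -
    have inv: "((\<lambda>x. 1 / x) has_real_derivative - ((1 / x)\<^sup>2)) (at x)"
      using greater by (auto intro!: derivative_eq_intros simp: power2_eq_square)
    \<comment> \<open>The exponent \<open>n - Suc 0\<close> of the power rule is truncated; for
      \<open>n = 0\<close> the factor \<open>real n\<close> vanishes.\<close>
    have "real n * (- (y\<^sup>2) * y ^ (n - Suc 0)) = - real n * y ^ (n + 1)" for y :: real
      by (cases n) (auto simp: power2_eq_square algebra_simps)
    then have "((\<lambda>x. (1 / x) ^ n) has_real_derivative - real n * (1 / x) ^ (n + 1)) (at x)"
      using DERIV_power[OF inv, of n] by (simp only:)
    moreover have "((\<lambda>x. exp (- (1 / x))) has_real_derivative exp (- (1 / x)) * (1 / x)\<^sup>2) (at x)"
      using DERIV_chain2[OF DERIV_exp DERIV_minus[OF inv]] by simp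
    ultimately have "((\<lambda>x. (1 / x) ^ n * exp (- (1 / x))) has_real_derivative
        - real n * (1 / x) ^ (n + 1) * exp (- (1 / x)) + exp (- (1 / x)) * (1 / x)\<^sup>2 * (1 / x) ^ n) (at x)"
      by (rule DERIV_mult)
    also have "- real n * (1 / x) ^ (n + 1) * exp (- (1 / x)) + exp (- (1 / x)) * (1 / x)\<^sup>2 * (1 / x) ^ n
        = flat (n + 2) x - n * flat (n + 1) x"
      using greater unfolding flat_def by (simp only: if_True power_add) (simp only: algebra_simps)
    finally show ?thesis .
  qed
  then show ?thesis
    by (rule DERIV_cong_ev[OF refl _ refl, THEN iffD1, rotated])
       (use greater in \<open>auto simp: flat_def eventually_nhds intro!: exI[of _ "{0<..}"]\<close>)
next
  case equal
  have "((\<lambda>h. flat n h / h) \<longlongrightarrow> 0) (at_right 0)"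
    by (rule Lim_transform_eventually[OF flat_tendsto_0[of "n+1"]])
       (auto simp: flat_def eventually_at_right_field intro!: exI[of _ 1])
  moreover have "((\<lambda>h. flat n h / h) \<longlongrightarrow> 0) (at_left 0)"
    by (rule Lim_transform_eventually[OF tendsto_const])
       (auto simp: flat_def eventually_at_left_field intro!: exI[of _ "-1"])
  ultimately have "((\<lambda>h. flat n h / h) \<longlongrightarrow> 0) (at 0)"
    by (simp add: filterlim_split_at)
  then show ?thesis using equal
    by (simp add: DERIV_def flat_def)
qed

text \<open>The class is closed under differentiation, so its members are infinitely differentiable.\<close>

inductive bump_alg :: "(real \<Rightarrow> real) \<Rightarrow> bool" where
  flat: "bump_alg (\<lambda>x. flat n (a * x + b))"
| const: "bump_alg (\<lambda>x. c)"
| add: "bump_alg f \<Longrightarrow> bump_alg g \<Longrightarrow> bump_alg (\<lambda>x. f x + g x)"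
| mult: "bump_alg f \<Longrightarrow> bump_alg g \<Longrightarrow> bump_alg (\<lambda>x. f x * g x)"
| inverse: "bump_alg f \<Longrightarrow> (\<And>x. f x \<noteq> 0) \<Longrightarrow> bump_alg (\<lambda>x. inverse (f x))"

lemma bump_alg_cmult: "bump_alg f \<Longrightarrow> bump_alg (\<lambda>x. c * f x)"
  by (intro bump_alg.mult bump_alg.const)

lemma bump_alg_has_derivative:
  assumes "bump_alg f"
  obtains f' where "bump_alg f'" "\<And>x. (f has_real_derivative f' x) (at x)"
proof -
  from assms have "\<exists>f'. bump_alg f' \<and> (\<forall>x. (f has_real_derivative f' x) (at x))"
  proof induction
    case (flat n a b)
    have "((\<lambda>x. flat n (a * x + b)) has_real_derivative
        a * (flat (n + 2) (a * x + b) + (- real n) * flat (n + 1) (a * x + b))) (at x)" for x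
      by (rule DERIV_cong[OF DERIV_chain2[OF flat_deriv]])
         (auto intro!: derivative_eq_intros)
    moreover have "bump_alg (\<lambda>x. a * (flat (n + 2) (a * x + b) + (- real n) * flat (n + 1) (a * x + b)))"
      by (intro bump_alg_cmult bump_alg.add bump_alg.flat)
    ultimately show ?case by blast
  next
    case (const c)
    show ?case by (intro exI[of _ "\<lambda>x. 0"]) (auto intro: bump_alg.const)
  next
    case (add f g)
    then obtain f' g' where "bump_alg f'" "bump_alg g'"
      and d: "\<And>x. (f has_real_derivative f' x) (at x)" "\<And>x. (g has_real_derivative g' x) (at x)"
      by blast
    then have "bump_alg (\<lambda>x. f' x + g' x)" by (intro bump_alg.add)
    then show ?case using DERIV_add[OF d] by blast
  next
    case (mult f g)
    then obtain f' g' where *: "bump_alg f'" "bump_alg g'"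
      and d: "\<And>x. (f has_real_derivative f' x) (at x)" "\<And>x. (g has_real_derivative g' x) (at x)"
      by blast
    have "bump_alg (\<lambda>x. f' x * g x + g' x * f x)"
      using * mult by (intro bump_alg.add bump_alg.mult)
    then show ?case using DERIV_mult[OF d] by blast
  next
    case (inverse f)
    then obtain f' where *: "bump_alg f'"
      and d: "\<And>x. (f has_real_derivative f' x) (at x)" by blast
    have "bump_alg (\<lambda>x. (-1) * (inverse (f x) * f' x * inverse (f x)))"
      using * inverse by (intro bump_alg_cmult bump_alg.mult bump_alg.inverse)
    moreover have "((\<lambda>x. inverse (f x)) has_real_derivative (-1) * (inverse (f x) * f' x * inverse (f x))) (at x)" for x
      using DERIV_inverse'[OF d, of x] inverse by simp
    ultimately show ?case by blast
  qed
  then show thesis using that by blast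
qed

lemma bump_alg_deriv: "bump_alg f \<Longrightarrow> bump_alg (deriv f)"
  by (metis (no_types) DERIV_imp_deriv bump_alg_has_derivative ext)

lemma bump_alg_differentiable: "bump_alg f \<Longrightarrow> f differentiable (at x)"
  by (metis bump_alg_has_derivative real_differentiable_def)

lemma bump_alg_funpow_deriv: "bump_alg f \<Longrightarrow> bump_alg ((deriv ^^ n) f)"
  by (induction n) (auto intro: bump_alg_deriv)

lemma bump_alg_continuous: "bump_alg f \<Longrightarrow> continuous_on S f"
  by (intro differentiable_imp_continuous_on)
     (auto simp: differentiable_on_def intro: bump_alg_differentiable differentiable_at_withinI)

lemma flat_nonneg: "flat n x \<ge> 0"
  by (auto simp: flat_def)

text \<open>The standard smooth transition between the constants 0 and 1. The denominator is
  positive everywhere, so the quotient stays in \<open>bump_alg\<close>.\<close>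

definition smooth_step :: "real \<Rightarrow> real" where
  "smooth_step x = flat 0 x / (flat 0 x + flat 0 (1 - x))"

lemma smooth_step_denom_pos: "flat 0 x + flat 0 (1 - x) > 0"
  using flat_nonneg[of 0 x] flat_nonneg[of 0 "1 - x"]
  by (cases "x > 0") (auto simp: flat_def add_pos_nonneg)

lemma smooth_step_le_0: "x \<le> 0 \<Longrightarrow> smooth_step x = 0"
  and smooth_step_ge_1: "x \<ge> 1 \<Longrightarrow> smooth_step x = 1"
  by (auto simp: smooth_step_def flat_def)

lemma smooth_step_range: "0 \<le> smooth_step x" "smooth_step x \<le> 1"
  using flat_nonneg[of 0 x] flat_nonneg[of 0 "1 - x"] smooth_step_denom_pos[of x]
  by (auto simp: smooth_step_def)

lemma bump_alg_smooth_step: "bump_alg (\<lambda>x. smooth_step (a * x + b))"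
proof -
  have "bump_alg (\<lambda>x. flat 0 (a * x + b) * inverse (flat 0 (a * x + b) + flat 0 ((-a) * x + (1 - b))))"
  proof (intro bump_alg.mult bump_alg.inverse bump_alg.add bump_alg.flat)
    fix x
    have "(-a) * x + (1 - b) = 1 - (a * x + b)" by simp
    then show "flat 0 (a * x + b) + flat 0 ((-a) * x + (1 - b)) \<noteq> 0"
      using smooth_step_denom_pos[of "a * x + b"] by (simp only:)
  qed
  then show ?thesis
    by (simp add: smooth_step_def divide_inverse algebra_simps)
qed

lemma continuous_smooth_step: "continuous_on S smooth_step" "continuous_on S (deriv smooth_step)"
  using bump_alg_smooth_step[of 1 0] by (auto intro: bump_alg_continuous bump_alg_deriv)

lemma smooth_step_deriv: "(smooth_step has_real_derivative deriv smooth_step x) (at x)"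
  using bump_alg_differentiable[OF bump_alg_smooth_step[of 1 0]]
  by (simp add: DERIV_deriv_iff_real_differentiable)

lemma deriv_smooth_step_eq_0: 
  assumes "x \<notin> {0..1}" shows "deriv smooth_step x = 0"
proof (cases "x < 0")
  case True
  have "(smooth_step has_real_derivative 0) (at x)"
    by (rule DERIV_cong_ev[OF refl _ refl, THEN iffD1, rotated, OF DERIV_const[of 0]])
       (use True in \<open>auto simp: smooth_step_le_0 eventually_nhds intro!: exI[of _ "{..<0}"]\<close>)
  then show ?thesis by (rule DERIV_imp_deriv)
next
  case False
  have "(smooth_step has_real_derivative 0) (at x)"
    by (rule DERIV_cong_ev[OF refl _ refl, THEN iffD1, rotated, OF DERIV_const[of 1]])
       (use assms False in \<open>auto simp: smooth_step_ge_1 eventually_nhds intro!: exI[of _ "{1<..}"]\<close>)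
  then show ?thesis by (rule DERIV_imp_deriv)
qed

text \<open>A smooth approximation of the indicator of \<open>{s<..t}\<close>. Both ramps have width
  \<open>1 / (n + 1)\<close> and lie to the right of \<open>s\<close> and of \<open>t\<close>, so
  all supports lie in \<open>{s..t+1}\<close>, away from 0 whenever \<open>s > 0\<close>.\<close>

definition plateau :: "nat \<Rightarrow> real \<Rightarrow> real \<Rightarrow> real \<Rightarrow> real" where
  "plateau n s t x = smooth_step (real (Suc n) * (x - s)) - smooth_step (real (Suc n) * (x - t))"

lemma plateau_eq_0:
  assumes "s \<le> t" "x \<notin> {s..t+1}"
  shows "plateau n s t x = 0"
proof -
  from assms(2) consider "x < s" | "x > t + 1" by force
  then show ?thesis
  proof cases
    case 1
    then show ?thesis using assms(1) by (simp add: plateau_def smooth_step_le_0 mult_nonneg_nonpos)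
  next
    case 2
    then have "1 * 1 \<le> real (Suc n) * (x - t)" "1 * 1 \<le> real (Suc n) * (x - s)"
      using assms(1) by (intro mult_mono; simp)+
    then show ?thesis by (simp add: plateau_def smooth_step_ge_1)
  qed
qed

lemma test_function_plateau:
  assumes "0 < s" "s \<le> t"
  shows "test_function (plateau n s t)"
  unfolding test_function_def
proof (intro conjI allI)
  have eq: "plateau n s t = (\<lambda>x. smooth_step (real (Suc n) * x + (- real (Suc n) * s)) + (-1) * smooth_step (real (Suc n) * x + (- real (Suc n) * t)))"
    by (auto simp: plateau_def fun_eq_iff algebra_simps)
  have "bump_alg (plateau n s t)"
    unfolding eq by (intro bump_alg.add bump_alg_cmult bump_alg_smooth_step)
  then show "((deriv ^^ k) (plateau n s t)) differentiable (at x)" for k x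
    by (intro bump_alg_differentiable bump_alg_funpow_deriv)
  show "\<exists>a b. 0 < a \<and> (\<forall>x. x \<notin> {a..b} \<longrightarrow> plateau n s t x = 0)"
  proof (rule exI[of _ s], rule exI[of _ "t+1"], intro conjI allI impI)
    show "0 < s" by (rule assms(1))
    show "plateau n s t x = 0" if "x \<notin> {s..t+1}" for x
      by (rule plateau_eq_0[OF assms(2) that])
  qed
qed

lemma deriv_plateau:
  "deriv (plateau n s t) x =
     real (Suc n) * deriv smooth_step (real (Suc n) * (x - s)) - real (Suc n) * deriv smooth_step (real (Suc n) * (x - t))"
proof (rule DERIV_imp_deriv)
  have "((\<lambda>x. smooth_step (real (Suc n) * (x - s))) has_real_derivative deriv smooth_step (real (Suc n) * (x - s)) * real (Suc n)) (at x)" for s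
    by (rule DERIV_chain2[OF smooth_step_deriv]) (auto intro!: derivative_eq_intros)
  from DERIV_diff[OF this[of s] this[of t]]
  show "(plateau n s t has_real_derivative
     real (Suc n) * deriv smooth_step (real (Suc n) * (x - s)) - real (Suc n) * deriv smooth_step (real (Suc n) * (x - t))) (at x)"
    by (simp add: plateau_def[abs_def] mult.commute)
qed

lemma plateau_tendsto:
  assumes "s \<le> t"
  shows "(\<lambda>n. plateau n s t x) \<longlonglongrightarrow> indicator {s<..t} x"
proof -
  have *: "(\<lambda>n. smooth_step (real (Suc n) * y)) \<longlonglongrightarrow> (if y > 0 then 1 else 0)" for y
  proof (cases "y > 0")
    case True
    obtain m where m: "1 / y \<le> real m" using real_arch_simple by blast
    have "1 \<le> real (Suc n) * y" if "n \<ge> m" for n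
    proof -
      have "1 / y \<le> real (Suc n)" using m that by linarith
      then show ?thesis using True by (simp add: field_simps)
    qed
    then have "\<forall>\<^sub>F n in sequentially. smooth_step (real (Suc n) * y) = 1"
      by (intro eventually_sequentiallyI[of m]) (simp add: smooth_step_ge_1)
    then show ?thesis using True by (simp only: if_True tendsto_eventually)
  next
    case False
    then show ?thesis by (simp add: smooth_step_le_0 mult_nonneg_nonpos)
  qed
  have "(\<lambda>n. plateau n s t x) \<longlonglongrightarrow> (if x - s > 0 then 1 else 0) - (if x - t > 0 then 1 else 0)"
    unfolding plateau_def by (intro tendsto_diff *)
  also have "(if x - s > 0 then 1 else 0) - (if x - t > 0 then 1 else (0::real)) = indicator {s<..t} x"
    using assms by (auto simp: indicator_def)
  finally show ?thesis .
qed

section \<open>Increments of a continuous function from its distributional derivative\<close>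

lemma continuous_on_Icc_norm_bound:
  fixes f :: "real \<Rightarrow> 'a::real_normed_vector"
  assumes "continuous_on {a..b} f"
  obtains B where "\<And>x. x \<in> {a..b} \<Longrightarrow> norm (f x) \<le> B"
proof -
  have "bounded (f ` {a..b})"
    by (rule compact_imp_bounded[OF compact_continuous_image[OF assms compact_Icc]])
  then obtain B where "\<forall>y\<in>f ` {a..b}. norm y \<le> B" by (auto simp: bounded_iff)
  then show thesis by (intro that[of B]) auto
qed

text \<open>The rescaled derivative of \<open>smooth_step\<close> is an approximate identity carried
  by an interval of length \<open>1 / (n + 1)\<close> to the right of \<open>s\<close>. Substituting
  \<open>x = s + y / (n + 1)\<close> moves the scaling into the argument of \<open>\<phi>\<close>;
  then dominated convergence on \<open>{0..1}\<close> applies, and the total mass is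
  \<open>smooth_step 1 - smooth_step 0 = 1\<close>.\<close>

lemma mollify_tendsto:
  fixes \<phi> :: "real \<Rightarrow> real"
  assumes cont: "continuous_on UNIV \<phi>"
  shows "integrable lborel (\<lambda>x. real (Suc n) * deriv smooth_step (real (Suc n) * (x - s)) * \<phi> x)"
    and "(\<lambda>n. LINT x|lborel. real (Suc n) * deriv smooth_step (real (Suc n) * (x - s)) * \<phi> x) \<longlonglongrightarrow> \<phi> s"
proof -
  let ?r = "deriv smooth_step"
  define G where "G n y = ?r y * \<phi> (s + y / real (Suc n))" for n :: nat and y
  have [measurable]: "\<phi> \<in> borel_measurable borel" "?r \<in> borel_measurable borel"
    using cont continuous_smooth_step by (auto intro: borel_measurable_continuous_onI)
  obtain B where B: "\<And>y. y \<in> {0..1} \<Longrightarrow> norm (?r y) \<le> B"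
    using continuous_on_Icc_norm_bound[OF continuous_smooth_step(2)] by metis
  obtain C where C: "\<And>y. y \<in> {s..s+1} \<Longrightarrow> norm (\<phi> y) \<le> C"
    using continuous_on_Icc_norm_bound[OF continuous_on_subset[OF cont subset_UNIV]] by metis
  have bound: "norm (G n y) \<le> indicator {0..1} y * (B * C)" for n y
  proof (cases "y \<in> {0..1}")
    case True
    then have "y / real (Suc n) \<le> 1" by (auto simp: field_simps)
    moreover have "y / real (Suc n) \<ge> 0" using True by auto
    ultimately have "norm (\<phi> (s + y / real (Suc n))) \<le> C" by (intro C) auto
    then have "norm (?r y) * norm (\<phi> (s + y / real (Suc n))) \<le> B * C"
      using B[OF True] by (intro mult_mono order_trans[OF norm_ge_zero B[OF True]]) auto
    then show ?thesis using True by (simp add: G_def abs_mult)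
  next
    case False
    then show ?thesis by (simp add: G_def deriv_smooth_step_eq_0)
  qed
  have int_dom: "integrable lborel (\<lambda>y. indicator {0..1::real} y * (B * C))"
    by simp
  have meas[measurable]: "G n \<in> borel_measurable lborel" for n unfolding G_def by measurable
  have int_G: "integrable lborel (G n)" for n
    by (rule Bochner_Integration.integrable_bound[OF int_dom]) (auto intro!: AE_I2 order_trans[OF bound[unfolded real_norm_def] abs_ge_self])
  have eq: "G n y = inverse (real (Suc n)) * (real (Suc n) * ?r (real (Suc n) * ((s + inverse (real (Suc n)) * y) - s)) * \<phi> (s + inverse (real (Suc n)) * y))" for n y
  proof -
    have "real (Suc n) * ((s + inverse (real (Suc n)) * y) - s) = y"
      by (simp add: field_simps)
    then show ?thesis unfolding G_def by (simp only: divide_inverse) (simp add: mult.commute)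
  qed
  have eq2: "real (Suc n) * G n y = real (Suc n) * ?r (real (Suc n) * ((s + inverse (real (Suc n)) * y) - s)) * \<phi> (s + inverse (real (Suc n)) * y)" for n y
    unfolding eq by simp
  have "integrable lborel (\<lambda>y. real (Suc n) * ?r (real (Suc n) * ((s + inverse (real (Suc n)) * y) - s)) * \<phi> (s + inverse (real (Suc n)) * y))"
    unfolding eq2[symmetric] by (rule integrable_mult_right[OF int_G])
  then show "integrable lborel (\<lambda>x. real (Suc n) * ?r (real (Suc n) * (x - s)) * \<phi> x)"
    by (subst (asm) lborel_integrable_real_affine_iff) auto
  have int_eq: "(LINT x|lborel. real (Suc n) * ?r (real (Suc n) * (x - s)) * \<phi> x) = integral\<^sup>L lborel (G n)" for n
    by (subst lborel_integral_real_affine[where c="inverse (real (Suc n))" and t=s], simp)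
       (simp only: eq[abs_def] integral_mult_right_zero, simp)
  have "(\<lambda>n. integral\<^sup>L lborel (G n)) \<longlonglongrightarrow> integral\<^sup>L lborel (\<lambda>y. ?r y * \<phi> s)"
  proof (rule integral_dominated_convergence[OF _ meas int_dom])
    show "AE y in lborel. (\<lambda>n. G n y) \<longlonglongrightarrow> ?r y * \<phi> s"
    proof (rule AE_I2)
      fix y
      have "(\<lambda>n. s + y / real (Suc n)) \<longlonglongrightarrow> s + 0"
        by (intro tendsto_add tendsto_const) (rule LIMSEQ_Suc[OF lim_const_over_n])
      then have "(\<lambda>n. \<phi> (s + y / real (Suc n))) \<longlonglongrightarrow> \<phi> s"
        using isCont_tendsto_compose[of s \<phi>] cont by (simp add: continuous_on_eq_continuous_at)
      then show "(\<lambda>n. G n y) \<longlonglongrightarrow> ?r y * \<phi> s"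
        unfolding G_def by (intro tendsto_mult tendsto_const)
    qed
  qed (use bound in auto)
  also have "integral\<^sup>L lborel (\<lambda>y. ?r y * \<phi> s) = \<phi> s"
  proof -
    have "integral\<^sup>L lborel (\<lambda>y. ?r y * indicator {0..1} y) = smooth_step 1 - smooth_step 0"
      by (rule integral_FTC_Icc_real)
         (use smooth_step_deriv continuous_smooth_step(2)[of UNIV] in \<open>auto simp: continuous_on_eq_continuous_at\<close>)
    also have "(\<lambda>y. ?r y * indicator {0..1} y) = ?r"
      using deriv_smooth_step_eq_0 by (force simp: fun_eq_iff indicator_def)
    finally show ?thesis by (simp add: smooth_step_le_0 smooth_step_ge_1)
  qed
  finally show "(\<lambda>n. LINT x|lborel. real (Suc n) * ?r (real (Suc n) * (x - s)) * \<phi> x) \<longlonglongrightarrow> \<phi> s"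
    unfolding int_eq .
qed

text \<open>Test with the plateaus of \<open>{s<..t}\<close>: their derivatives act on
  \<open>\<phi>\<close> like two approximate identities and produce
  \<open>\<phi> s - \<phi> t\<close> in the limit, while the plateaus themselves converge boundedly
  to the indicator and produce the integral of \<open>\<psi>\<close>.\<close>

lemma has_integral_of_distributional_derivative:
  fixes \<phi> \<psi> :: "real \<Rightarrow> real"
  assumes cont: "continuous_on {0..} \<phi>"
    and int: "\<And>T. T > 0 \<Longrightarrow> \<psi> absolutely_integrable_on {0..T}"
    and distr: "\<And>\<theta>. test_function \<theta> \<Longrightarrow> \<exists>x. has_bochner_integral lebesgue (\<lambda>t. deriv \<theta> t * \<phi> t) x
                     \<and> has_bochner_integral lebesgue (\<lambda>t. \<theta> t * \<psi> t) (- x)"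
    and "0 \<le> s" "s \<le> t"
  shows "(\<psi> has_integral \<phi> t - \<phi> s) {s..t}"
proof -
  have sub: "\<psi> absolutely_integrable_on {a..b}" if "0 \<le> a" for a b
    by (rule absolutely_integrable_on_subinterval[OF int[of "max b 1"]]) (use that in auto)
  have pos: "(\<psi> has_integral \<phi> t - \<phi> s) {s..t}" if "0 < s" "s \<le> t" for s t
  proof -
    \<comment> \<open>\<open>mollify_tendsto\<close> asks for continuity on the whole line, so
      \<open>\<phi>\<close> is extended to negative times by its value at 0.\<close>
    define \<phi>1 where "\<phi>1 x = \<phi> (max 0 x)" for x
    have c1: "continuous_on UNIV \<phi>1"
      unfolding \<phi>1_def by (intro continuous_on_compose2[OF cont] continuous_intros) auto
    let ?P = "\<lambda>n. plateau n s t"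
    let ?r = "\<lambda>n s x. real (Suc n) * deriv smooth_step (real (Suc n) * (x - s)) * \<phi>1 x"
    have eq: "deriv (?P n) x * \<phi> x = ?r n s x - ?r n t x" for n x
    proof (cases "x \<ge> 0")
      case True
      then show ?thesis by (simp add: deriv_plateau \<phi>1_def algebra_simps)
    next
      case False
      have "deriv smooth_step (real (Suc n) * (x - a)) = 0" if "a > 0" for a
        using False that by (intro deriv_smooth_step_eq_0) (simp add: zero_le_mult_iff)
      then show ?thesis using \<open>0 < s\<close> \<open>s \<le> t\<close> by (simp add: deriv_plateau)
    qed
    have int_L: "(LINT x|lebesgue. deriv (?P n) x * \<phi> x) = (LINT x|lborel. ?r n s x) - (LINT x|lborel. ?r n t x)" for n
      unfolding eq using mollify_tendsto(1)[OF c1, of n s] mollify_tendsto(1)[OF c1, of n t]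
      by (subst integral_completion) auto
    have L: "(\<lambda>n. LINT x|lebesgue. deriv (?P n) x * \<phi> x) \<longlonglongrightarrow> \<phi>1 s - \<phi>1 t"
      unfolding int_L by (intro tendsto_diff mollify_tendsto(2) c1)
    have R: "(\<lambda>n. LINT x|lebesgue. ?P n x * \<psi> x) \<longlonglongrightarrow> (LINT x|lebesgue. indicator {s<..t} x * \<psi> x)"
    proof (rule integral_dominated_convergence)
      have si: "integrable lebesgue (\<lambda>x. indicator {s..t+1} x * \<psi> x)"
        using sub[of s "t+1"] \<open>0 < s\<close> by (simp add: set_integrable_def)
      have "integrable lebesgue (\<lambda>x. indicator {s<..t} x * (indicator {s..t+1} x * \<psi> x))"
        using integrable_real_mult_indicator[OF _ si, of "{s<..t}"] by (simp add: mult.commute)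
      also have "(\<lambda>x. indicator {s<..t} x * (indicator {s..t+1} x * \<psi> x)) = (\<lambda>x. indicator {s<..t} x * \<psi> x)"
        by (auto simp: indicator_def)
      finally show "(\<lambda>x. indicator {s<..t} x * \<psi> x) \<in> borel_measurable lebesgue" by auto
      show "integrable lebesgue (\<lambda>x. norm (indicator {s..t+1} x * \<psi> x))"
        using si by (rule integrable_norm)
      show "(\<lambda>x. ?P n x * \<psi> x) \<in> borel_measurable lebesgue" for n
        using distr[OF test_function_plateau[OF that]] has_bochner_integral_iff by blast
      show "AE x in lebesgue. (\<lambda>n. ?P n x * \<psi> x) \<longlonglongrightarrow> indicator {s<..t} x * \<psi> x"
        by (intro AE_I2 tendsto_mult tendsto_const plateau_tendsto that)
      show "AE x in lebesgue. norm (?P n x * \<psi> x) \<le> norm (indicator {s..t+1} x * \<psi> x)" for n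
      proof (rule AE_I2)
        fix x
        show "norm (?P n x * \<psi> x) \<le> norm (indicator {s..t+1} x * \<psi> x)"
        proof (cases "x \<in> {s..t+1}")
          case True
          have "\<bar>?P n x\<bar> \<le> 1"
            using smooth_step_range[of "real (Suc n) * (x - s)"] smooth_step_range[of "real (Suc n) * (x - t)"]
            by (auto simp: plateau_def)
          then show ?thesis using True by (simp add: abs_mult mult_left_le_one_le)
        next
          case False
          then have "?P n x = 0" by (rule plateau_eq_0[OF that(2)])
          then show ?thesis by simp
        qed
      qed
    qed
    have "(LINT x|lebesgue. ?P n x * \<psi> x) = - (LINT x|lebesgue. deriv (?P n) x * \<phi> x)" for n
    proof -
      obtain x where "has_bochner_integral lebesgue (\<lambda>x. deriv (?P n) x * \<phi> x) x"
        and "has_bochner_integral lebesgue (\<lambda>x. ?P n x * \<psi> x) (- x)"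
        using distr[OF test_function_plateau[OF \<open>0 < s\<close> \<open>s \<le> t\<close>], of n] by blast
      then show ?thesis by (simp add: has_bochner_integral_integral_eq)
    qed
    with tendsto_minus[OF L] have "(\<lambda>n. LINT x|lebesgue. ?P n x * \<psi> x) \<longlonglongrightarrow> \<phi>1 t - \<phi>1 s"
      by simp
    from LIMSEQ_unique[OF R this] have "(LINT x|lebesgue. indicator {s<..t} x * \<psi> x) = \<phi> t - \<phi> s"
      using that by (simp add: \<phi>1_def)
    also have "(LINT x|lebesgue. indicator {s<..t} x * \<psi> x) = (LINT x|lebesgue. indicator {s..t} x *\<^sub>R \<psi> x)"
    proof (rule integral_cong_AE)
      have "AE x in lebesgue. x \<noteq> s"
        by (auto intro!: AE_I[where N="{s}"])
      then show "AE x in lebesgue. indicator {s<..t} x * \<psi> x = indicator {s..t} x *\<^sub>R \<psi> x"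
        by eventually_elim (auto simp: indicator_def)
      show "(\<lambda>x. indicator {s..t} x *\<^sub>R \<psi> x) \<in> borel_measurable lebesgue"
        using sub[of s t] that by (auto simp: set_integrable_def)
      have "(\<lambda>x. indicator {s<..t} x * (indicator {s..t} x * \<psi> x)) \<in> borel_measurable lebesgue"
        using borel_measurable_times[OF borel_measurable_indicator
            borel_measurable_integrable[OF sub[of s t, unfolded set_integrable_def]], of "{s<..t}"] that
        by simp
      also have "(\<lambda>x. indicator {s<..t} x * (indicator {s..t} x * \<psi> x)) = (\<lambda>x. indicator {s<..t} x * \<psi> x)"
        by (auto simp: indicator_def)
      finally show "(\<lambda>x. indicator {s<..t} x * \<psi> x) \<in> borel_measurable lebesgue" .
    qed
    finally have "(LINT x:{s..t}|lebesgue. \<psi> x) = \<phi> t - \<phi> s"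
      by (simp add: set_lebesgue_integral_def)
    with has_integral_set_lebesgue[OF sub[of s t]] that show ?thesis by simp
  qed
  show ?thesis
  proof (cases "s = t")
    case True then show ?thesis using has_integral_refl(2)[of \<psi> t] by simp
  next
    case False
    with \<open>s \<le> t\<close> \<open>0 \<le> s\<close> have st: "s < t" "0 \<le> s" by auto
    have intble: "\<psi> integrable_on {s..t}"
      using sub[of s t] st set_lebesgue_integral_eq_integral(1) by blast
    \<comment> \<open>At \<open>s = 0\<close> a plateau is not an admissible test function. The
      identity is carried over from starting points \<open>x > s\<close> by letting \<open>x\<close>
      tend to \<open>s\<close>, both sides being continuous.\<close>
    have "continuous_on {s..t} (\<lambda>x. integral {x..t} \<psi>)"
      by (rule indefinite_integral_continuous_1'[OF intble])
    moreover have "continuous_on {s..t} (\<lambda>x. \<phi> t - \<phi> x)"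
      using st by (intro continuous_intros continuous_on_subset[OF cont]) auto
    ultimately have c: "continuous_on {s..t} (\<lambda>x. integral {x..t} \<psi>)" "continuous_on {s..t} (\<lambda>x. \<phi> t - \<phi> x)"
      by blast+
    have "integral {s..t} \<psi> = \<phi> t - \<phi> s"
    proof -
      have A: "((\<lambda>x. integral {x..t} \<psi>) \<longlongrightarrow> integral {s..t} \<psi>) (at_right s)"
        by (rule continuous_on_Icc_at_rightD[OF c(1) st(1)])
      have B: "((\<lambda>x. \<phi> t - \<phi> x) \<longlongrightarrow> \<phi> t - \<phi> s) (at_right s)"
        by (rule continuous_on_Icc_at_rightD[OF c(2) st(1)])
      have C: "eventually (\<lambda>x. \<phi> t - \<phi> x = integral {x..t} \<psi>) (at_right s)"
        unfolding eventually_at_right_field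
        by (intro exI[of _ t]) (use st pos in \<open>auto intro!: integral_unique[symmetric]\<close>)
      show ?thesis
        by (rule tendsto_unique[OF trivial_limit_at_right_real A Lim_transform_eventually[OF B C]])
    qed
    then show ?thesis using integrable_integral[OF intble] by simp
  qed
qed

section \<open>Primitives on the half-line and the chain rule\<close>

text \<open>\<open>u\<close> is a primitive of \<open>w\<close> on the half-line: \<open>w\<close> is only required to have integrable norm and to be
  scalarly integrable, so that every integral is one of a real function and no separability is needed.\<close>

definition primitive_on_halfline :: "(real \<Rightarrow> 'a::real_normed_vector) \<Rightarrow> (real \<Rightarrow> 'a) \<Rightarrow> bool" where
  "primitive_on_halfline u w \<longleftrightarrow> continuous_on {0..} u \<and>
     (\<forall>T\<ge>0. (\<lambda>t. norm (w t)) absolutely_integrable_on {0..T}) \<and>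
     (\<forall>l::'a \<Rightarrow>\<^sub>L real. \<forall>s t. 0 \<le> s \<longrightarrow> s \<le> t \<longrightarrow>
        (\<lambda>r. l (w r)) absolutely_integrable_on {s..t} \<and>
        ((\<lambda>r. l (w r)) has_integral l (u t - u s)) {s..t})"

lemma primitive_on_halflineD:
  assumes "primitive_on_halfline u w"
  shows "continuous_on {0..} u"
    and "\<And>s t. 0 \<le> s \<Longrightarrow> (\<lambda>t. norm (w t)) absolutely_integrable_on {s..t}"
    and "\<And>s t. 0 \<le> s \<Longrightarrow> (\<lambda>t. norm (w t)) integrable_on {s..t}"
    and "\<And>(l::_ \<Rightarrow>\<^sub>L real) s t. 0 \<le> s \<Longrightarrow> (\<lambda>r. l (w r)) absolutely_integrable_on {s..t}"
    and "\<And>(l::_ \<Rightarrow>\<^sub>L real) s t. 0 \<le> s \<Longrightarrow> s \<le> t \<Longrightarrow> ((\<lambda>r. l (w r)) has_integral l (u t - u s)) {s..t}"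
proof -
  show *: "(\<lambda>t. norm (w t)) absolutely_integrable_on {s..t}" if "0 \<le> s" for s t
    by (rule absolutely_integrable_on_subinterval[where S="{0..max t 0}"])
       (use assms that in \<open>auto simp: primitive_on_halfline_def\<close>)
  show "(\<lambda>t. norm (w t)) integrable_on {s..t}" if "0 \<le> s" for s t
    using *[OF that] by (rule set_lebesgue_integral_eq_integral(1))
  show "(\<lambda>r. l (w r)) absolutely_integrable_on {s..t}" if "0 \<le> s" for s t and l :: "_ \<Rightarrow>\<^sub>L real"
    by (cases "s \<le> t") (use assms that in \<open>auto simp: primitive_on_halfline_def\<close>)
qed (use assms in \<open>auto simp: primitive_on_halfline_def\<close>)

lemma primitive_on_halfline_realI:
  fixes u w :: "real \<Rightarrow> real"
  assumes "continuous_on {0..} u"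
    and int: "\<And>s t. 0 \<le> s \<Longrightarrow> s \<le> t \<Longrightarrow> w absolutely_integrable_on {s..t}"
    and ftc: "\<And>s t. 0 \<le> s \<Longrightarrow> s \<le> t \<Longrightarrow> (w has_integral (u t - u s)) {s..t}"
  shows "primitive_on_halfline u w"
  unfolding primitive_on_halfline_def
proof (intro conjI allI impI assms(1))
  show "(\<lambda>t. norm (w t)) absolutely_integrable_on {0..T}" if "0 \<le> T" for T
    by (rule set_integrable_norm[OF int]) (use that in auto)
  fix l :: "real \<Rightarrow>\<^sub>L real" and s t :: real assume "0 \<le> s" "s \<le> t"
  have l: "l x = x * l 1" for x
    using blinfun.scaleR_right[of l x 1] by simp
  show "(\<lambda>r. l (w r)) absolutely_integrable_on {s..t}"
    by (subst l) (intro set_integrable_mult_left int \<open>0 \<le> s\<close> \<open>s \<le> t\<close>)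
  show "((\<lambda>r. l (w r)) has_integral l (u t - u s)) {s..t}"
    by (subst (1 2) l) (intro has_integral_mult_left ftc \<open>0 \<le> s\<close> \<open>s \<le> t\<close>)
qed

lemma primitive_on_halfline_realD:
  fixes u w :: "real \<Rightarrow> real"
  assumes "primitive_on_halfline u w" "0 \<le> s"
  shows "w absolutely_integrable_on {s..t}"
    and "w integrable_on {s..t}"
    and "s \<le> t \<Longrightarrow> (w has_integral (u t - u s)) {s..t}"
    and "s \<le> t \<Longrightarrow> integral {s..t} w = u t - u s"
proof -
  have id: "blinfun_apply id_blinfun = (\<lambda>x::real. x)" by auto
  show *: "w absolutely_integrable_on {s..t}"
    using primitive_on_halflineD(4)[OF assms, of t id_blinfun] by (simp add: id)
  then show "w integrable_on {s..t}" by (rule set_lebesgue_integral_eq_integral(1))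
  show "s \<le> t \<Longrightarrow> (w has_integral (u t - u s)) {s..t}"
    using primitive_on_halflineD(5)[OF assms, of _ id_blinfun] by (simp add: id)
  then show "s \<le> t \<Longrightarrow> integral {s..t} w = u t - u s" by (rule integral_unique)
qed

lemma primitive_on_halfline_C1:
  fixes u w :: "real \<Rightarrow> real"
  assumes d: "\<And>t. 0 \<le> t \<Longrightarrow> (u has_real_derivative w t) (at t)" and c: "continuous_on {0..} w"
  shows "primitive_on_halfline u w"
proof (rule primitive_on_halfline_realI)
  show "continuous_on {0..} u"
    using d by (intro continuous_at_imp_continuous_on ballI) (auto intro: DERIV_isCont)
  show "w absolutely_integrable_on {s..t}" if "0 \<le> s" "s \<le> t" for s t
    by (intro absolutely_integrable_continuous_real continuous_on_subset[OF c]) (use that in auto)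
  show "(w has_integral (u t - u s)) {s..t}" if "0 \<le> s" "s \<le> t" for s t
    by (rule fundamental_theorem_of_calculus)
       (use that d in \<open>auto simp flip: has_real_derivative_iff_has_vector_derivative
          intro: has_field_derivative_at_within\<close>)
qed

text \<open>Pairing turns the product rule for inner products into an instance of the chain rule. A
  functional on the product splits into its restrictions to the two factors.\<close>

lemma primitive_on_halfline_Pair:
  assumes "primitive_on_halfline u1 w1" "primitive_on_halfline u2 w2"
  shows "primitive_on_halfline (\<lambda>t. (u1 t, u2 t)) (\<lambda>t. (w1 t, w2 t))"
  unfolding primitive_on_halfline_def
proof (intro conjI allI impI)
  note D1 = primitive_on_halflineD[OF assms(1)] and D2 = primitive_on_halflineD[OF assms(2)]
  show "continuous_on {0..} (\<lambda>t. (u1 t, u2 t))" by (intro continuous_intros D1 D2)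
  fix T :: real assume "0 \<le> T"
  have n1: "set_borel_measurable lebesgue {0..T} (\<lambda>t. norm (w1 t))"
    and n2: "set_borel_measurable lebesgue {0..T} (\<lambda>t. norm (w2 t))"
    using D1(2)[of 0 T] D2(2)[of 0 T] by (auto simp: set_integrable_def set_borel_measurable_def)
  have "set_borel_measurable lebesgue {0..T} (\<lambda>t. norm (w1 t, w2 t))"
  proof -
    have "(\<lambda>t. sqrt ((indicator {0..T} t *\<^sub>R norm (w1 t))\<^sup>2 + (indicator {0..T} t *\<^sub>R norm (w2 t))\<^sup>2)) \<in> borel_measurable lebesgue"
      using n1 n2 unfolding set_borel_measurable_def by measurable
    also have "(\<lambda>t. sqrt ((indicator {0..T} t *\<^sub>R norm (w1 t))\<^sup>2 + (indicator {0..T} t *\<^sub>R norm (w2 t))\<^sup>2))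
       = (\<lambda>t. indicator {0..T} t *\<^sub>R norm (w1 t, w2 t))"
      by (auto simp: norm_Pair indicator_def fun_eq_iff)
    finally show ?thesis by (simp add: set_borel_measurable_def)
  qed
  then show "(\<lambda>t. norm (w1 t, w2 t)) absolutely_integrable_on {0..T}"
    by (rule set_integrable_bound[OF set_integral_add(1)[OF D1(2)[OF order_refl] D2(2)[OF order_refl]]])
       (simp add: norm_Pair_le)
next
  note D1 = primitive_on_halflineD[OF assms(1)] and D2 = primitive_on_halflineD[OF assms(2)]
  fix l :: "('a \<times> 'b) \<Rightarrow>\<^sub>L real" and s t :: real assume st: "0 \<le> s" "s \<le> t"
  obtain l1 :: "'a \<Rightarrow>\<^sub>L real" where l1: "l1 x = l (x, 0)" for x
    using bounded_linear_Blinfun_apply[OF bounded_linear_compose[OF blinfun.bounded_linear_right[of l]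
        bounded_linear_Pair[OF bounded_linear_ident bounded_linear_zero]]] by metis
  obtain l2 :: "'b \<Rightarrow>\<^sub>L real" where l2: "l2 x = l (0, x)" for x
    using bounded_linear_Blinfun_apply[OF bounded_linear_compose[OF blinfun.bounded_linear_right[of l]
        bounded_linear_Pair[OF bounded_linear_zero bounded_linear_ident]]] by metis
  have l: "l (x, y) = l1 x + l2 y" for x y
    unfolding l1 l2 by (simp flip: blinfun.add_right)
  show "(\<lambda>r. l (w1 r, w2 r)) absolutely_integrable_on {s..t}"
    unfolding l using st by (intro set_integral_add D1(4) D2(4))
  show "((\<lambda>r. l (w1 r, w2 r)) has_integral l ((u1 t, u2 t) - (u1 s, u2 s))) {s..t}"
    unfolding l diff_Pair using st by (intro has_integral_add D1 D2)
qed

text \<open>Only scalar integrals are at hand; pairing with the unit vector in the direction of the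
  increment reduces the estimate to one of them.\<close>

lemma norm_primitive_diff_le:
  fixes u :: "real \<Rightarrow> 'a::real_inner"
  assumes "primitive_on_halfline u w" "0 \<le> s" "s \<le> t"
  shows "norm (u t - u s) \<le> integral {s..t} (\<lambda>r. norm (w r))"
proof (cases "u t = u s")
  case True
  then show ?thesis using integral_nonneg[OF primitive_on_halflineD(3)[OF assms(1,2)]] by simp
next
  case False
  define e where "e = (u t - u s) /\<^sub>R norm (u t - u s)"
  have e: "norm e = 1" using False by (simp add: e_def)
  have "norm (u t - u s) = blinfun_inner_right e (u t - u s)"
    using False by (simp add: e_def dot_square_norm power2_eq_square)
  also have "\<dots> \<le> integral {s..t} (\<lambda>r. norm (w r))"
  proof (rule has_integral_le)
    show "((\<lambda>r. blinfun_inner_right e (w r)) has_integral blinfun_inner_right e (u t - u s)) {s..t}"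
      using assms by (intro primitive_on_halflineD)
    show "((\<lambda>r. norm (w r)) has_integral integral {s..t} (\<lambda>r. norm (w r))) {s..t}"
      using assms by (intro integrable_integral primitive_on_halflineD(3)) 
    show "blinfun_inner_right e (w r) \<le> norm (w r)" for r
      using norm_cauchy_schwarz[of e "w r"] e by simp
  qed
  finally show ?thesis .
qed

text \<open>Sampling times on the grid of mesh \<open>1 / (n + 1)\<close>. They replace a continuous
  function of time by one with countably many values wherever measurability has to be shown.\<close>

lemma floor_mult_divide_tendsto:
  "(\<lambda>n. real_of_int \<lfloor>real (Suc n) * r\<rfloor> / real (Suc n)) \<longlonglongrightarrow> r"
proof (rule tendsto_sandwich)
  let ?x = "\<lambda>n. real_of_int \<lfloor>real (Suc n) * r\<rfloor> / real (Suc n)"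
  have "?x n \<le> r" for n
  proof -
    have "real_of_int \<lfloor>real (Suc n) * r\<rfloor> \<le> real (Suc n) * r" by (rule of_int_floor_le)
    then show ?thesis by (simp only: pos_divide_le_eq of_nat_0_less_iff zero_less_Suc mult.commute)
  qed
  then show "\<forall>\<^sub>F n in sequentially. ?x n \<le> r" by simp
  have "r - 1 / real (Suc n) \<le> ?x n" for n
  proof -
    have "real (Suc n) * r - 1 \<le> real_of_int \<lfloor>real (Suc n) * r\<rfloor>" by linarith
    then have "(real (Suc n) * r - 1) / real (Suc n) \<le> ?x n" by (rule divide_right_mono) simp
    then show ?thesis by (simp add: diff_divide_distrib)
  qed
  then show "\<forall>\<^sub>F n in sequentially. r - 1 / real (Suc n) \<le> ?x n" by simp
  have "(\<lambda>n. r - 1 / real (Suc n)) \<longlonglongrightarrow> r - 0"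
    by (intro tendsto_diff tendsto_const LIMSEQ_Suc lim_const_over_n)
  then show "(\<lambda>n. r - 1 / real (Suc n)) \<longlonglongrightarrow> r" by simp
qed simp

text \<open>Measurability of \<open>l (w r)\<close> is known only for a fixed functional
  \<open>l\<close>. Freezing \<open>D\<close> at the grid point below \<open>r\<close> uses
  countably many functionals, and continuity of \<open>D\<close> lets the mesh tend to 0. The bound
  is \<open>norm (w r)\<close> times the maximum of the norm of \<open>D\<close> on
  \<open>{s..t}\<close>.\<close>

lemma absolutely_integrable_continuous_dual_apply:
  fixes w :: "real \<Rightarrow> 'a::real_normed_vector" and D :: "real \<Rightarrow> ('a \<Rightarrow>\<^sub>L real)"
  assumes prim: "primitive_on_halfline u w" and D: "continuous_on {0..} D" and "0 \<le> s"
  shows "(\<lambda>r. D r (w r)) absolutely_integrable_on {s..t}"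
proof -
  note * = primitive_on_halflineD[OF prim]
  define x where "x n r = real_of_int \<lfloor>real (Suc n) * r\<rfloor> / real (Suc n)" for n r
  have x_nonneg: "x n r \<ge> 0" if "r \<ge> 0" for n r
    using that by (simp add: x_def)
  have x_lim: "(\<lambda>n. x n r) \<longlonglongrightarrow> r" for r
    unfolding x_def by (rule floor_mult_divide_tendsto)
  have meas: "(\<lambda>r. indicator {s..t} r * (D (x n r)) (w r)) \<in> borel_measurable lebesgue" for n
  proof -
    have "(\<lambda>r. indicator {s..t} r * (D (real_of_int i / real (Suc n))) (w r)) \<in> borel_measurable lebesgue" for i
      using *(4)[OF \<open>0 \<le> s\<close>] by (auto simp: set_integrable_def)
    moreover have "(\<lambda>r. \<lfloor>real (Suc n) * r\<rfloor>) \<in> measurable lebesgue (count_space UNIV)"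
      by (rule measurable_completion) measurable
    ultimately show ?thesis unfolding x_def by (rule measurable_compose_countable)
  qed
  have "(\<lambda>r. indicator {s..t} r * D r (w r)) \<in> borel_measurable lebesgue"
  proof (rule borel_measurable_LIMSEQ_real[OF _ meas])
    fix r
    show "(\<lambda>n. indicator {s..t} r * (D (x n r)) (w r)) \<longlonglongrightarrow> indicator {s..t} r * D r (w r)"
    proof (cases "r \<in> {s..t}")
      case True
      with \<open>0 \<le> s\<close> have "0 \<le> r" by auto
      have "(\<lambda>n. D (x n r)) \<longlonglongrightarrow> D r"
        by (rule continuous_on_tendsto_compose[OF D x_lim]) (use \<open>0 \<le> r\<close> x_nonneg in auto)
      then show ?thesis
        by (intro tendsto_mult tendsto_const blinfun.tendsto)
    qed simp
  qed
  then have meas_lim: "set_borel_measurable lebesgue {s..t} (\<lambda>r. D r (w r))"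
    by (simp add: set_borel_measurable_def)
  obtain B where B: "\<And>r. r \<in> {s..t} \<Longrightarrow> norm (D r) \<le> B"
    using continuous_on_Icc_norm_bound[of s t D] continuous_on_subset[OF D] \<open>0 \<le> s\<close>
    by (metis atLeastAtMost_iff atLeast_iff order_trans subsetI)
  have "(\<lambda>r. B * norm (w r)) absolutely_integrable_on {s..t}"
    by (intro set_integrable_mult_right *(2) \<open>0 \<le> s\<close>)
  then show ?thesis
  proof (rule set_integrable_bound[OF _ meas_lim])
    show "AE r in lebesgue. r \<in> {s..t} \<longrightarrow> norm (D r (w r)) \<le> norm (B * norm (w r))"
    proof (intro AE_I2 impI)
      fix r assume "r \<in> {s..t}"
      have "norm (D r (w r)) \<le> norm (D r) * norm (w r)" by (rule norm_blinfun)
      also have "\<dots> \<le> B * norm (w r)" using B[OF \<open>r \<in> {s..t}\<close>] by (simp add: mult_right_mono)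
      finally show "norm (D r (w r)) \<le> norm (B * norm (w r))" by simp
    qed
  qed
qed

text \<open>\<open>u\<close> need not be differentiable at \<open>x\<close>. Near \<open>u x\<close>
  the map \<open>\<phi> - \<phi>' (u x)\<close> has a derivative of norm at most
  \<open>\<epsilon> / 2\<close>, and the linear map \<open>\<phi>' (u x)\<close> obeys the
  fundamental theorem because \<open>u\<close> is a primitive of \<open>w\<close>; replacing it by
  \<open>\<phi>' (u r)\<close> under the integral costs the other \<open>\<epsilon> / 2\<close>.
  Short intervals around \<open>x\<close> are what a bisection argument asks for.\<close>

lemma chain_rule_local_estimate:
  fixes u :: "real \<Rightarrow> 'a::real_inner" and \<phi> :: "'a \<Rightarrow> real"
  assumes prim: "primitive_on_halfline u w"
    and \<phi>: "\<And>x. (\<phi> has_derivative blinfun_apply (\<phi>' x)) (at x)" and cont: "continuous_on UNIV \<phi>'"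
    and "0 \<le> x" "\<epsilon> > 0"
  obtains \<delta> where "\<delta> > 0"
    "\<And>s t. 0 \<le> s \<Longrightarrow> s \<le> x \<Longrightarrow> x \<le> t \<Longrightarrow> t - s < \<delta> \<Longrightarrow>
       \<bar>\<phi> (u t) - \<phi> (u s) - integral {s..t} (\<lambda>r. \<phi>' (u r) (w r))\<bar> \<le> \<epsilon> * integral {s..t} (\<lambda>r. norm (w r))"
proof -
  note * = primitive_on_halflineD[OF prim]
  have D: "continuous_on {0..} (\<lambda>r. \<phi>' (u r))"
    by (rule continuous_on_compose2[OF cont *(1)]) auto
  obtain \<eta> where \<eta>: "\<eta> > 0" "\<And>y. dist y (u x) < \<eta> \<Longrightarrow> dist (\<phi>' y) (\<phi>' (u x)) < \<epsilon> / 2"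
    using cont[unfolded continuous_on_iff, rule_format, of "u x" "\<epsilon>/2"] \<open>\<epsilon> > 0\<close> by auto
  obtain \<delta> where \<delta>: "\<delta> > 0" "\<And>r. 0 \<le> r \<Longrightarrow> dist r x < \<delta> \<Longrightarrow> dist (u r) (u x) < \<eta>"
    using *(1)[unfolded continuous_on_iff, rule_format, of x \<eta>] \<eta>(1) \<open>0 \<le> x\<close> by auto
  show thesis
  proof (rule that[OF \<delta>(1)])
    fix s t assume st: "0 \<le> s" "s \<le> x" "x \<le> t" "t - s < \<delta>"
    have near: "u r \<in> ball (u x) \<eta>" if "r \<in> {s..t}" for r
      using \<delta>(2)[of r] that st by (auto simp: dist_real_def dist_commute)
    have le: "norm (\<phi>' y - \<phi>' (u x)) \<le> \<epsilon> / 2" if "y \<in> ball (u x) \<eta>" for y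
      using \<eta>(2)[of y] that by (simp add: dist_norm norm_minus_commute less_imp_le)
    let ?L = "\<phi>' (u x)"
    let ?N = "integral {s..t} (\<lambda>r. norm (w r))"
    have "norm ((\<phi> (u t) - ?L (u t)) - (\<phi> (u s) - ?L (u s))) \<le> \<epsilon> / 2 * norm (u t - u s)"
    proof (rule differentiable_bound[where S="ball (u x) \<eta>" and f'="\<lambda>y h. (\<phi>' y - ?L) h"])
      show "((\<lambda>y. \<phi> y - ?L y) has_derivative (\<lambda>h. (\<phi>' y - ?L) h)) (at y within ball (u x) \<eta>)" for y
        by (auto simp: blinfun.diff_left intro!: derivative_eq_intros has_derivative_at_withinI[OF \<phi>])
      show "onorm (\<lambda>h. (\<phi>' y - ?L) h) \<le> \<epsilon> / 2" if "y \<in> ball (u x) \<eta>" for y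
        using le[OF that] by (simp add: norm_blinfun.rep_eq)
    qed (use near st in auto)
    also have "\<dots> \<le> \<epsilon> / 2 * ?N"
      using norm_primitive_diff_le[OF prim, of s t] st \<open>\<epsilon> > 0\<close> by (intro mult_left_mono) auto
    finally have A: "\<bar>\<phi> (u t) - \<phi> (u s) - ?L (u t - u s)\<bar> \<le> \<epsilon> / 2 * ?N"
      by (simp add: blinfun.diff_right algebra_simps)
    have i1: "(\<lambda>r. \<phi>' (u r) (w r)) integrable_on {s..t}"
      using absolutely_integrable_continuous_dual_apply[OF prim D st(1)] set_lebesgue_integral_eq_integral(1) by blast
    have "\<bar>?L (u t - u s) - integral {s..t} (\<lambda>r. \<phi>' (u r) (w r))\<bar> \<le> integral {s..t} (\<lambda>r. \<epsilon> / 2 * norm (w r))"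
    proof -
      have i2: "((\<lambda>r. ?L (w r) - \<phi>' (u r) (w r)) has_integral ?L (u t - u s) - integral {s..t} (\<lambda>r. \<phi>' (u r) (w r))) {s..t}"
        using st i1 by (intro has_integral_diff * integrable_integral) auto
      have i3: "(\<lambda>r. \<epsilon> / 2 * norm (w r)) integrable_on {s..t}"
        using *(3)[OF st(1)] by (intro integrable_on_mult_right)
      have "norm (integral {s..t} (\<lambda>r. ?L (w r) - \<phi>' (u r) (w r))) \<le> integral {s..t} (\<lambda>r. \<epsilon> / 2 * norm (w r))"
      proof (rule integral_norm_bound_integral[OF _ i3])
        show "(\<lambda>r. ?L (w r) - \<phi>' (u r) (w r)) integrable_on {s..t}" using i2 by blast
        fix r assume "r \<in> {s..t}"
        have "norm (?L (w r) - \<phi>' (u r) (w r)) = norm ((\<phi>' (u r) - ?L) (w r))"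
          by (simp add: blinfun.diff_left abs_minus_commute)
        also have "\<dots> \<le> norm (\<phi>' (u r) - ?L) * norm (w r)" by (rule norm_blinfun)
        also have "\<dots> \<le> \<epsilon> / 2 * norm (w r)" by (intro mult_right_mono le near \<open>r \<in> {s..t}\<close>) auto
        finally show "norm (?L (w r) - \<phi>' (u r) (w r)) \<le> \<epsilon> / 2 * norm (w r)" .
      qed
      then show ?thesis unfolding integral_unique[OF i2] by simp
    qed
    then have "\<bar>?L (u t - u s) - integral {s..t} (\<lambda>r. \<phi>' (u r) (w r))\<bar> \<le> \<epsilon> / 2 * ?N" by simp
    with A show "\<bar>\<phi> (u t) - \<phi> (u s) - integral {s..t} (\<lambda>r. \<phi>' (u r) (w r))\<bar> \<le> \<epsilon> * ?N"
      by linarith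
  qed
qed

text \<open>An error bound by \<open>\<epsilon>\<close> times the integral of
  \<open>norm (w r)\<close> is additive over adjacent intervals, so it passes from short intervals
  to \<open>{s..t}\<close> by bisection; then \<open>\<epsilon>\<close> is arbitrary.\<close>

lemma primitive_on_halfline_chain:
  fixes u :: "real \<Rightarrow> 'a::real_inner" and \<phi> :: "'a \<Rightarrow> real"
  assumes prim: "primitive_on_halfline u w"
    and \<phi>: "\<And>x. (\<phi> has_derivative blinfun_apply (\<phi>' x)) (at x)" and cont: "continuous_on UNIV \<phi>'"
  shows "primitive_on_halfline (\<lambda>t. \<phi> (u t)) (\<lambda>t. \<phi>' (u t) (w t))"
proof (rule primitive_on_halfline_realI)
  note * = primitive_on_halflineD[OF prim]
  have D: "continuous_on {0..} (\<lambda>r. \<phi>' (u r))"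
    by (rule continuous_on_compose2[OF cont *(1)]) auto
  have "continuous_on UNIV \<phi>"
    using \<phi> by (meson continuous_at_imp_continuous_on has_derivative_continuous)
  then show "continuous_on {0..} (\<lambda>t. \<phi> (u t))"
    by (rule continuous_on_compose2[OF _ *(1)]) auto
  show int: "(\<lambda>t. \<phi>' (u t) (w t)) absolutely_integrable_on {s..t}" if "0 \<le> s" "s \<le> t" for s t
    by (rule absolutely_integrable_continuous_dual_apply[OF prim D that(1)])
  fix s t :: real assume st: "0 \<le> s" "s \<le> t"
  let ?J = "\<lambda>s t. integral {s..t} (\<lambda>r. \<phi>' (u r) (w r))" and ?N = "\<lambda>s t. integral {s..t} (\<lambda>r. norm (w r))"
  have intb: "(\<lambda>t. \<phi>' (u t) (w t)) integrable_on {s..t}" if "0 \<le> s" for s t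
    using absolutely_integrable_continuous_dual_apply[OF prim D that] set_lebesgue_integral_eq_integral(1) by blast
  have est: "\<bar>\<phi> (u t) - \<phi> (u s) - ?J s t\<bar> \<le> \<epsilon> * ?N s t" if "\<epsilon> > 0" for \<epsilon>
  proof -
    have "0 \<le> s \<longrightarrow> \<bar>\<phi> (u t) - \<phi> (u s) - ?J s t\<bar> \<le> \<epsilon> * ?N s t"
      using \<open>s \<le> t\<close>
    proof (induction rule: Bolzano)
      case (trans a b c)
      show ?case
      proof
        assume "0 \<le> a"
        have "?J a b + ?J b c = ?J a c"
          using trans \<open>0 \<le> a\<close> intb by (intro Henstock_Kurzweil_Integration.integral_combine) auto
        moreover have "?N a b + ?N b c = ?N a c"
          using trans \<open>0 \<le> a\<close> *(3) by (intro Henstock_Kurzweil_Integration.integral_combine) auto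
        then have "\<epsilon> * ?N a c = \<epsilon> * ?N a b + \<epsilon> * ?N b c"
          by (metis distrib_left)
        ultimately show "\<bar>\<phi> (u c) - \<phi> (u a) - ?J a c\<bar> \<le> \<epsilon> * ?N a c"
          using trans \<open>0 \<le> a\<close> by linarith
      qed
    next
      case (local x)
      then have "0 \<le> x" using st by simp
      then show ?case
        using chain_rule_local_estimate[OF prim \<phi> cont \<open>0 \<le> x\<close> that] by metis
    qed
    with st show ?thesis by simp
  qed
  have "\<bar>\<phi> (u t) - \<phi> (u s) - ?J s t\<bar> \<le> 0"
  proof (rule field_le_epsilon)
    fix \<epsilon> :: real assume "\<epsilon> > 0"
    have N0: "?N s t \<ge> 0" using *(3)[OF st(1)] by (intro integral_nonneg) auto
    \<comment> \<open>The \<open>+ 1\<close> covers the case in which the integral of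
      \<open>norm (w r)\<close> is 0.\<close>
    have "\<bar>\<phi> (u t) - \<phi> (u s) - ?J s t\<bar> \<le> \<epsilon> / (?N s t + 1) * ?N s t"
      using N0 \<open>\<epsilon> > 0\<close> by (intro est) (auto intro: divide_pos_pos)
    also have "\<dots> \<le> \<epsilon>" using N0 \<open>\<epsilon> > 0\<close> by (simp add: field_simps)
    finally show "\<bar>\<phi> (u t) - \<phi> (u s) - ?J s t\<bar> \<le> 0 + \<epsilon>" by simp
  qed
  then have "?J s t = \<phi> (u t) - \<phi> (u s)" by simp
  then show "((\<lambda>t. \<phi>' (u t) (w t)) has_integral \<phi> (u t) - \<phi> (u s)) {s..t}"
    using integrable_integral[OF intb[OF st(1), of t]] by simp
qed

section \<open>Product rules and linear operations\<close>

lemma primitive_on_halfline_inner: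
  fixes u1 :: "real \<Rightarrow> 'a::real_inner"
  assumes "primitive_on_halfline u1 w1" "primitive_on_halfline u2 w2"
  shows "primitive_on_halfline (\<lambda>t. u1 t \<bullet> u2 t) (\<lambda>t. w1 t \<bullet> u2 t + u1 t \<bullet> w2 t)"
proof -
  obtain f s :: "('a \<times> 'a) \<Rightarrow>\<^sub>L 'a" where f: "\<And>x. f x = fst x" and s: "\<And>x. s x = snd x"
    by (metis bounded_linear_Blinfun_apply bounded_linear_fst bounded_linear_snd)
  define D :: "'a \<times> 'a \<Rightarrow> ('a \<times> 'a) \<Rightarrow>\<^sub>L real" where
    "D x = (blinfun_inner_right (snd x) o\<^sub>L f) + (blinfun_inner_right (fst x) o\<^sub>L s)" for x
  have "primitive_on_halfline (\<lambda>t. (\<lambda>x. fst x \<bullet> snd x) (u1 t, u2 t)) (\<lambda>t. D (u1 t, u2 t) (w1 t, w2 t))"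
  proof (rule primitive_on_halfline_chain[OF primitive_on_halfline_Pair[OF assms]])
    show "((\<lambda>x. fst x \<bullet> snd x) has_derivative D x) (at x)" for x
      by (auto intro!: derivative_eq_intros simp: D_def f s blinfun.add_left inner_commute fun_eq_iff add.commute)
    show "continuous_on UNIV D"
      unfolding D_def by (intro continuous_intros)
  qed
  then show ?thesis by (simp add: D_def f s blinfun.add_left inner_commute)
qed

lemma primitive_on_halfline_mult:
  fixes u1 u2 :: "real \<Rightarrow> real"
  assumes "primitive_on_halfline u1 w1" "primitive_on_halfline u2 w2"
  shows "primitive_on_halfline (\<lambda>t. u1 t * u2 t) (\<lambda>t. w1 t * u2 t + u1 t * w2 t)"
  using primitive_on_halfline_inner[OF assms] by simp

lemma primitive_on_halfline_add:
  assumes "primitive_on_halfline u1 w1" "primitive_on_halfline u2 (w2 :: real \<Rightarrow> real)"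
  shows "primitive_on_halfline (\<lambda>t. u1 t + u2 t) (\<lambda>t. w1 t + w2 t)"
proof -
  note * = primitive_on_halflineD[OF assms(1)] primitive_on_halflineD[OF assms(2)]
     primitive_on_halfline_realD[OF assms(1)] primitive_on_halfline_realD[OF assms(2)]
  show ?thesis
  proof (rule primitive_on_halfline_realI)
    show "((\<lambda>t. w1 t + w2 t) has_integral (u1 t + u2 t - (u1 s + u2 s))) {s..t}" if "0 \<le> s" "s \<le> t" for s t
      using has_integral_add[OF *(13)[OF that] *(17)[OF that]] by (simp add: algebra_simps)
  qed (use * in \<open>auto intro!: continuous_intros set_integral_add\<close>)
qed

lemma primitive_on_halfline_const: "primitive_on_halfline (\<lambda>t. c) (\<lambda>t. 0::real)"
  by (rule primitive_on_halfline_C1) (auto intro: continuous_intros)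

lemma primitive_on_halfline_cmult:
  fixes u w :: "real \<Rightarrow> real"
  assumes "primitive_on_halfline u w"
  shows "primitive_on_halfline (\<lambda>t. c * u t) (\<lambda>t. c * w t)"
  using primitive_on_halfline_mult[OF primitive_on_halfline_const[of c] assms] by simp

lemma primitive_on_halfline_diff_const:
  assumes "primitive_on_halfline u w"
  shows "primitive_on_halfline (\<lambda>t. u t - c) w"
  using assms by (auto simp: primitive_on_halfline_def intro!: continuous_intros)

section \<open>Bochner integrals and weak derivatives\<close>

text \<open>In a nonseparable space the difference of two Borel measurable maps need not be Borel
  measurable. Here \<open>s\<close> takes finitely many values \<open>c\<close>, and for each of
  them \<open>norm (f t - c)\<close> is a continuous function of \<open>f t\<close>.\<close>

lemma borel_measurable_norm_diff_simple:
  fixes f s :: "'b \<Rightarrow> 'a::real_normed_vector"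
  assumes "f \<in> borel_measurable M" "simple_function M s"
  shows "(\<lambda>t. norm (f t - s t)) \<in> borel_measurable M"
proof (rule measurable_compose_countable'[where I="s ` space M" and f="\<lambda>c t. norm (f t - c)" and g=s])
  fix c :: 'a
  have "(\<lambda>x. norm (x - c)) \<in> borel_measurable borel"
    by (intro borel_measurable_continuous_onI continuous_intros)
  from measurable_compose[OF assms(1) this] show "(\<lambda>t. norm (f t - c)) \<in> borel_measurable M" .
next
  show "s \<in> measurable M (count_space (s ` space M))"
    using assms(2) by (auto simp: measurable_count_space_eq2 simple_function_def)
qed (use assms(2) in \<open>auto simp: simple_function_def intro: countable_finite\<close>)

lemma has_bochner_bounded_linear:
  fixes T :: "'a::real_normed_vector \<Rightarrow> 'b::real_normed_vector"
  assumes T: "bounded_linear T" and f: "has_bochner f x"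
  shows "has_bochner (\<lambda>t. T (f t)) (T x)"
proof -
  interpret T: bounded_linear T by fact
  from f obtain s where f_meas: "f \<in> borel_measurable lebesgue"
    and s: "\<And>i::nat. Bochner_Integration.simple_bochner_integrable lebesgue (s i)"
    and f_s: "(\<lambda>i. \<integral>\<^sup>+t. ennreal (norm (f t - s i t)) \<partial>lebesgue) \<longlonglongrightarrow> 0"
    and lim: "(\<lambda>i. Bochner_Integration.simple_bochner_integral lebesgue (s i)) \<longlonglongrightarrow> x"
    unfolding has_bochner_def by blast
  obtain K where K: "K > 0" "\<And>x. norm (T x) \<le> norm x * K" using T.pos_bounded by auto
  have [measurable]: "(\<lambda>t. norm (f t - s i t)) \<in> borel_measurable lebesgue" for i
    using f_meas s[of i] by (intro borel_measurable_norm_diff_simple)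
      (auto elim: Bochner_Integration.simple_bochner_integrable.cases)
  have "(\<lambda>t. T (f t)) \<in> borel_measurable lebesgue"
    by (rule measurable_compose[OF f_meas])
       (intro borel_measurable_continuous_onI T.continuous_on continuous_on_id)
  moreover have "Bochner_Integration.simple_bochner_integrable lebesgue (\<lambda>t. T (s i t))" for i
    using s[of i] Bochner_Integration.simple_bochner_integrable_compose2[of "\<lambda>x y. T x" lebesgue "s i" "s i"]
    by (simp add: T.zero)
  moreover have "(\<lambda>i. \<integral>\<^sup>+t. ennreal (norm (T (f t) - T (s i t))) \<partial>lebesgue) \<longlonglongrightarrow> 0"
  proof (rule tendsto_sandwich[OF _ _ tendsto_const])
    show "\<forall>\<^sub>F i in sequentially. (\<integral>\<^sup>+t. ennreal (norm (T (f t) - T (s i t))) \<partial>lebesgue)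
        \<le> ennreal K * (\<integral>\<^sup>+t. ennreal (norm (f t - s i t)) \<partial>lebesgue)"
    proof (intro always_eventually allI)
      fix i
      have "(\<integral>\<^sup>+t. ennreal (norm (T (f t) - T (s i t))) \<partial>lebesgue)
          \<le> (\<integral>\<^sup>+t. ennreal K * ennreal (norm (f t - s i t)) \<partial>lebesgue)"
        using K by (intro nn_integral_mono) (auto simp: T.diff[symmetric] ennreal_mult[symmetric] mult.commute)
      also have "\<dots> = ennreal K * (\<integral>\<^sup>+t. ennreal (norm (f t - s i t)) \<partial>lebesgue)"
        by (intro nn_integral_cmult) measurable
      finally show "(\<integral>\<^sup>+t. ennreal (norm (T (f t) - T (s i t))) \<partial>lebesgue)
        \<le> ennreal K * (\<integral>\<^sup>+t. ennreal (norm (f t - s i t)) \<partial>lebesgue)" .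
    qed
    show "(\<lambda>i. ennreal K * (\<integral>\<^sup>+t. ennreal (norm (f t - s i t)) \<partial>lebesgue)) \<longlonglongrightarrow> 0"
      using ennreal_tendsto_cmult[OF _ f_s, of "ennreal K"] by simp
  qed auto
  moreover have "(\<lambda>i. Bochner_Integration.simple_bochner_integral lebesgue (\<lambda>t. T (s i t))) \<longlonglongrightarrow> T x"
    unfolding Bochner_Integration.simple_bochner_integral_linear[OF T.linear_axioms s]
    by (rule T.tendsto[OF lim])
  ultimately show ?thesis
    unfolding has_bochner_def by (intro conjI exI[of _ "\<lambda>i t. T (s i t)"] allI)
qed

lemma L1_on_bounded_linear:
  assumes T: "bounded_linear T" and "L1_on S f"
  shows "L1_on S (\<lambda>t. T (f t))"
proof -
  from assms(2) obtain x where "has_bochner (\<lambda>t. indicator S t *\<^sub>R f t) x" by (auto simp: L1_on_def)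
  from has_bochner_bounded_linear[OF T this] show ?thesis
    unfolding L1_on_def by (auto simp: linear_simps[OF T])
qed

lemma L1_on_real: "L1_on S (f :: real \<Rightarrow> real) \<longleftrightarrow> f absolutely_integrable_on S"
  by (auto simp: L1_on_def has_bochner_eq_has_bochner_integral set_integrable_def integrable.simps)

text \<open>A single simple approximant at distance less than 1 suffices: the norm of
  \<open>f\<close> is at most the error plus the norm of the approximant, both of finite
  integral.\<close>

lemma L1_on_norm:
  fixes f :: "real \<Rightarrow> 'a::real_normed_vector"
  assumes "L1_on S f"
  shows "(\<lambda>t. norm (f t)) absolutely_integrable_on S"
proof -
  let ?f = "\<lambda>t. indicator S t *\<^sub>R f t"
  from assms obtain s x where f_meas: "?f \<in> borel_measurable lebesgue"
    and s: "\<And>i::nat. Bochner_Integration.simple_bochner_integrable lebesgue (s i)"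
    and f_s: "(\<lambda>i. \<integral>\<^sup>+t. ennreal (norm (?f t - s i t)) \<partial>lebesgue) \<longlonglongrightarrow> 0"
    unfolding has_bochner_def L1_on_def by blast
  have norm_meas: "(\<lambda>t. norm (?f t)) \<in> borel_measurable lebesgue"
    by (rule measurable_compose[OF f_meas]) (intro borel_measurable_continuous_onI continuous_intros)
  obtain i where i: "(\<integral>\<^sup>+t. ennreal (norm (?f t - s i t)) \<partial>lebesgue) < 1"
    using order_tendstoD(2)[OF f_s, of 1] by (auto simp: eventually_sequentially)
  have d_meas: "(\<lambda>t. norm (?f t - s i t)) \<in> borel_measurable lebesgue"
    using f_meas s[of i] by (intro borel_measurable_norm_diff_simple)
      (auto elim: Bochner_Integration.simple_bochner_integrable.cases)
  have "Bochner_Integration.simple_bochner_integrable lebesgue (\<lambda>t. norm (s i t))"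
    using s[of i] Bochner_Integration.simple_bochner_integrable_compose2[of "\<lambda>x y. norm x" lebesgue "s i" "s i"] by simp
  then have s_int: "integrable lebesgue (\<lambda>t. norm (s i t))"
    using has_bochner_integral_simple_bochner_integrable by (auto simp: integrable.simps)
  have "(\<integral>\<^sup>+t. ennreal (norm (?f t)) \<partial>lebesgue)
      \<le> (\<integral>\<^sup>+t. ennreal (norm (?f t - s i t)) + ennreal (norm (s i t)) \<partial>lebesgue)"
    proof (intro nn_integral_mono)
    fix t
    have "norm (?f t) \<le> norm (?f t - s i t) + norm (s i t)"
      using norm_triangle_sub[of "?f t" "s i t"] by linarith
    then show "ennreal (norm (?f t)) \<le> ennreal (norm (?f t - s i t)) + ennreal (norm (s i t))"
      by (simp only: ennreal_plus[symmetric] norm_ge_zero ennreal_leI)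
  qed
  also have "\<dots> = (\<integral>\<^sup>+t. ennreal (norm (?f t - s i t)) \<partial>lebesgue) + (\<integral>\<^sup>+t. ennreal (norm (s i t)) \<partial>lebesgue)"
    using d_meas s_int by (intro nn_integral_add) auto
  also have "\<dots> < \<infinity>"
    using i s_int by (auto simp: integrable_iff_bounded ennreal_add_less_top intro: less_trans)
  finally have "integrable lebesgue (\<lambda>t. norm (?f t))"
    using norm_meas by (simp add: integrable_iff_bounded)
  then show ?thesis by (simp add: set_integrable_def)
qed

lemma weak_deriv_bounded_linear:
  assumes T: "bounded_linear T" and "weak_deriv u w"
  shows "weak_deriv (\<lambda>t. T (u t)) (\<lambda>t. T (w t))"
  unfolding weak_deriv_def
proof (intro conjI allI impI)
  show "L1_loc (\<lambda>t. T (u t))" "L1_loc (\<lambda>t. T (w t))"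
    using assms(2) by (auto simp: weak_deriv_def L1_loc_def intro: L1_on_bounded_linear[OF T])
  fix \<phi> :: "real \<Rightarrow> real" assume "test_function \<phi>"
  then obtain x where x: "has_bochner (\<lambda>t. deriv \<phi> t *\<^sub>R u t) x" "has_bochner (\<lambda>t. \<phi> t *\<^sub>R w t) (- x)"
    using assms(2) unfolding weak_deriv_def by blast
  show "\<exists>x. has_bochner (\<lambda>t. deriv \<phi> t *\<^sub>R T (u t)) x \<and> has_bochner (\<lambda>t. \<phi> t *\<^sub>R T (w t)) (- x)"
    using x[THEN has_bochner_bounded_linear[OF T]] by (auto simp: linear_simps[OF T])
qed

text \<open>Composing with a functional \<open>l\<close> turns the distributional identity into a
  scalar one, for which the plateau argument is available.\<close>

lemma weak_deriv_imp_primitive: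
  fixes u w :: "real \<Rightarrow> 'a::real_normed_vector"
  assumes cont: "continuous_on {0..} u" and w: "weak_deriv u w"
  shows "primitive_on_halfline u w"
  unfolding primitive_on_halfline_def
proof (intro conjI allI impI cont)
  have L1: "L1_on {0..T} w" if "T > 0" for T
    using w that by (simp add: weak_deriv_def L1_loc_def)
  show "(\<lambda>t. norm (w t)) absolutely_integrable_on {0..T}" if "0 \<le> T" for T
    by (rule absolutely_integrable_on_subinterval[OF L1_on_norm[OF L1[of "T+1"]]]) (use that in auto)
  fix l :: "'a \<Rightarrow>\<^sub>L real" and s t :: real assume st: "0 \<le> s" "s \<le> t"
  have l: "bounded_linear (blinfun_apply l)" by (rule blinfun.bounded_linear_right)
  have int: "(\<lambda>r. l (w r)) absolutely_integrable_on {0..T}" if "T > 0" for T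
    using L1_on_bounded_linear[OF l L1[OF that]] by (simp add: L1_on_real)
  then show "(\<lambda>r. l (w r)) absolutely_integrable_on {s..t}"
    by (rule absolutely_integrable_on_subinterval[where S="{0..t+1}"]) (use st in auto)
  have "((\<lambda>r. l (w r)) has_integral l (u t) - l (u s)) {s..t}"
  proof (rule has_integral_of_distributional_derivative[OF _ int _ st])
    show "continuous_on {0..} (\<lambda>r. l (u r))" by (intro continuous_intros cont)
    fix \<theta> :: "real \<Rightarrow> real" assume "test_function \<theta>"
    then obtain x where "has_bochner (\<lambda>t. deriv \<theta> t *\<^sub>R l (u t)) x" "has_bochner (\<lambda>t. \<theta> t *\<^sub>R l (w t)) (- x)"
      using weak_deriv_bounded_linear[OF l w] unfolding weak_deriv_def by blast
    then show "\<exists>x. has_bochner_integral lebesgue (\<lambda>t. deriv \<theta> t * l (u t)) x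
         \<and> has_bochner_integral lebesgue (\<lambda>t. \<theta> t * l (w t)) (- x)"
      by (auto simp: has_bochner_eq_has_bochner_integral)
  qed
  then show "((\<lambda>r. l (w r)) has_integral l (u t - u s)) {s..t}" by (simp add: blinfun.diff_right)
qed

text \<open>Lebesgue differentiation: outside a null set the value at \<open>x\<close> is the limit
  of the averages over \<open>{x..x + h}\<close>, and these all vanish. Extending \<open>f\<close>
  by 0 to negative times keeps all interval integrals 0.\<close>

lemma AE_eq_0_of_integrals_eq_0:
  fixes f :: "real \<Rightarrow> real"
  assumes "\<And>a b. 0 \<le> a \<Longrightarrow> a \<le> b \<Longrightarrow> (f has_integral 0) {a..b}"
  shows "AE t in lebesgue. 0 \<le> t \<longrightarrow> f t = 0"
proof -
  define g where "g x = (if x \<in> {0..} then f x else 0)" for x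
  have g: "(g has_integral 0) {a..b}" if "a \<le> b" for a b
  proof -
    have "{0..} \<inter> {a..b} = {max 0 a..b}" by auto
    moreover have "(f has_integral 0) {max 0 a..b}"
      using assms[of "max 0 a" b] by (cases "max 0 a \<le> b") auto
    ultimately show ?thesis
      unfolding g_def[abs_def] by (subst has_integral_restrict_Int) simp
  qed
  then have "g integrable_on cbox a b" for a b
    by (cases "a \<le> b") (auto intro: has_integral_integrable)
  from integrable_ccontinuous_explicit[OF this] obtain N where N: "negligible N"
    and lim: "\<And>x e. x \<notin> N \<Longrightarrow> 0 < e \<Longrightarrow> \<exists>d>0. \<forall>h. 0 < h \<and> h < d \<longrightarrow>
                         norm (integral (cbox x (x + h *\<^sub>R One)) g /\<^sub>R h ^ DIM(real) - g x) < e"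
    by blast
  have "g x = 0" if "x \<notin> N" for x
  proof (rule ccontr)
    assume "g x \<noteq> 0"
    with lim[OF that, of "norm (g x)"] obtain d where "d > 0"
      and d: "\<And>h. 0 < h \<Longrightarrow> h < d \<Longrightarrow> norm (integral {x..x + h} g / h - g x) < norm (g x)"
      by (auto simp: divide_inverse mult.commute)
    from d[of "d/2"] g[of x "x + d/2"] \<open>d > 0\<close> show False by (simp add: integral_unique)
  qed
  moreover have "AE x in lebesgue. x \<notin> N"
    using N by (simp add: negligible_iff_null_sets AE_not_in)
  ultimately have "AE x in lebesgue. g x = 0" by auto
  then show ?thesis by eventually_elim (auto simp: g_def split: if_splits)
qed

text \<open>Pythagoras. It bounds \<open>z\<close> by the error of any approximation
  \<open>d\<close> that happens to be orthogonal to it.\<close>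

lemma norm_le_norm_diff_orthogonal:
  fixes z d :: "'a::real_inner"
  assumes "d \<bullet> z = 0"
  shows "norm z \<le> norm (z - d)"
proof (rule power2_le_imp_le)
  have "(norm (z - d))\<^sup>2 = (norm z)\<^sup>2 + (norm d)\<^sup>2"
    using assms by (simp add: power2_norm_eq_inner inner_diff_left inner_diff_right inner_commute[of z d])
  then show "(norm z)\<^sup>2 \<le> (norm (z - d))\<^sup>2" by simp
qed simp

lemma L1_approx:
  fixes f :: "real \<Rightarrow> 'a::real_normed_vector"
  assumes "L1_on S f"
  obtains s where "\<And>i::nat. simple_function lebesgue (s i)"
    and "\<And>i. (\<lambda>t. norm (indicator S t *\<^sub>R f t - s i t)) \<in> borel_measurable lebesgue"
    and "(\<lambda>i. \<integral>\<^sup>+t. ennreal (norm (indicator S t *\<^sub>R f t - s i t)) \<partial>lebesgue) \<longlonglongrightarrow> 0"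
proof -
  from assms obtain s where "(\<lambda>t. indicator S t *\<^sub>R f t) \<in> borel_measurable lebesgue"
    and "\<And>i::nat. Bochner_Integration.simple_bochner_integrable lebesgue (s i)"
    and "(\<lambda>i. \<integral>\<^sup>+t. ennreal (norm (indicator S t *\<^sub>R f t - s i t)) \<partial>lebesgue) \<longlonglongrightarrow> 0"
    unfolding has_bochner_def L1_on_def by blast
  then show thesis
    by (intro that[of s] borel_measurable_norm_diff_simple)
       (auto elim: Bochner_Integration.simple_bochner_integrable.cases)
qed

text \<open>For every vector \<open>d\<close>, \<open>\<langle>d, w1 - w2\<rangle>\<close> vanishes outside a null set, but the null set depends on \<open>d\<close> and
  the space need not be separable. It suffices to take for \<open>d\<close> the countably many values of
  the simple functions approximating \<open>w1 - w2\<close>.\<close>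

lemma weak_deriv_unique:
  fixes v w1 w2 :: "real \<Rightarrow> 'a::real_inner"
  assumes cont: "continuous_on {0..} v" and w1: "weak_deriv v w1" and w2: "weak_deriv v w2"
  shows "AE t in lebesgue. 0 \<le> t \<longrightarrow> w1 t = w2 t"
proof -
  have orth: "AE t in lebesgue. 0 \<le> t \<longrightarrow> d \<bullet> (w1 t - w2 t) = 0" for d
  proof (rule AE_eq_0_of_integrals_eq_0)
    fix a b :: real assume "0 \<le> a" "a \<le> b"
    from has_integral_diff[OF primitive_on_halflineD(5)[OF weak_deriv_imp_primitive[OF cont w1] this, of "blinfun_inner_right d"]
        primitive_on_halflineD(5)[OF weak_deriv_imp_primitive[OF cont w2] this, of "blinfun_inner_right d"]]
    show "((\<lambda>t. d \<bullet> (w1 t - w2 t)) has_integral 0) {a..b}" by (simp add: inner_diff_right)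
  qed
  have "AE t in lebesgue. t \<in> {0..T} \<longrightarrow> w1 t = w2 t" if "T > 0" for T
  proof -
    have L1: "L1_on {0..T} w1" "L1_on {0..T} w2"
      using w1 w2 that by (auto simp: weak_deriv_def L1_loc_def)
    let ?I = "indicator {0..T} :: real \<Rightarrow> real"
    obtain s1 where s1: "\<And>i::nat. simple_function lebesgue (s1 i)"
      "\<And>i. (\<lambda>t. norm (?I t *\<^sub>R w1 t - s1 i t)) \<in> borel_measurable lebesgue"
      "(\<lambda>i. \<integral>\<^sup>+t. ennreal (norm (?I t *\<^sub>R w1 t - s1 i t)) \<partial>lebesgue) \<longlonglongrightarrow> 0"
      by (rule L1_approx[OF L1(1)]) (rule that)
    obtain s2 where s2: "\<And>i::nat. simple_function lebesgue (s2 i)"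
      "\<And>i. (\<lambda>t. norm (?I t *\<^sub>R w2 t - s2 i t)) \<in> borel_measurable lebesgue"
      "(\<lambda>i. \<integral>\<^sup>+t. ennreal (norm (?I t *\<^sub>R w2 t - s2 i t)) \<partial>lebesgue) \<longlonglongrightarrow> 0"
      by (rule L1_approx[OF L1(2)]) (rule that)
    define b where "b i t = ennreal (norm (?I t *\<^sub>R w1 t - s1 i t)) + ennreal (norm (?I t *\<^sub>R w2 t - s2 i t))" for i t
    have b_meas[measurable]: "b i \<in> borel_measurable lebesgue" for i
      unfolding b_def using s1(2)[of i] s2(2)[of i] by measurable
    \<comment> \<open>By Fatou's lemma, errors whose integrals tend to 0 have lower limit 0 almost
      everywhere; no subsequence has to be extracted.\<close>
    have "(\<integral>\<^sup>+t. liminf (\<lambda>i. b i t) \<partial>lebesgue) \<le> liminf (\<lambda>i. integral\<^sup>N lebesgue (b i))"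
      by (rule nn_integral_liminf) measurable
    also have "(\<lambda>i. integral\<^sup>N lebesgue (b i)) = (\<lambda>i. (\<integral>\<^sup>+t. ennreal (norm (?I t *\<^sub>R w1 t - s1 i t)) \<partial>lebesgue)
        + (\<integral>\<^sup>+t. ennreal (norm (?I t *\<^sub>R w2 t - s2 i t)) \<partial>lebesgue))"
      unfolding b_def using s1(2) s2(2) by (intro ext nn_integral_add) auto
    also have "liminf \<dots> = 0"
      using tendsto_add[OF s1(3) s2(3)] by (simp add: lim_imp_Liminf)
    finally have lim0: "AE t in lebesgue. liminf (\<lambda>i. b i t) = 0"
      by (subst (asm) le_zero_eq, subst (asm) nn_integral_0_iff_AE) auto
    have "AE t in lebesgue. \<forall>i. \<forall>d \<in> (\<lambda>(x, y). x - y) ` (range (s1 i) \<times> range (s2 i)). 0 \<le> t \<longrightarrow> d \<bullet> (w1 t - w2 t) = 0"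
      unfolding AE_all_countable
      using s1(1) s2(1) orth by (intro allI AE_finite_allI) (auto simp: simple_function_def)
    with lim0 show ?thesis
    proof (eventually_elim, intro impI)
      fix t assume lim0: "liminf (\<lambda>i. b i t) = 0" and t: "t \<in> {0..T}"
        and o: "\<forall>i. \<forall>d \<in> (\<lambda>(x, y). x - y) ` (range (s1 i) \<times> range (s2 i)). 0 \<le> t \<longrightarrow> d \<bullet> (w1 t - w2 t) = 0"
      let ?z = "w1 t - w2 t"
      have "ennreal (norm ?z) \<le> b i t" for i
      proof -
        let ?d = "s1 i t - s2 i t"
        have "?d \<in> (\<lambda>(x, y). x - y) ` (range (s1 i) \<times> range (s2 i))"
          by (intro image_eqI[of _ _ "(s1 i t, s2 i t)"]) simp_all
        then have "0 \<le> t \<longrightarrow> ?d \<bullet> ?z = 0" by (rule bspec[OF spec[OF o]])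
        then have "?d \<bullet> ?z = 0" using t by simp
        then have "norm ?z \<le> norm (?z - ?d)" by (rule norm_le_norm_diff_orthogonal)
        also have "\<dots> = norm ((w1 t - s1 i t) - (w2 t - s2 i t))" by (simp add: algebra_simps)
        also have "\<dots> \<le> norm (w1 t - s1 i t) + norm (w2 t - s2 i t)" by (rule norm_triangle_ineq4)
        finally show ?thesis using t by (simp add: b_def ennreal_leI flip: ennreal_plus)
      qed
      then have "ennreal (norm ?z) \<le> liminf (\<lambda>i. b i t)"
        by (intro Liminf_bounded) auto
      then show "w1 t = w2 t" using lim0 by simp
    qed
  qed
  then have "AE t in lebesgue. \<forall>n. t \<in> {0..real (Suc n)} \<longrightarrow> w1 t = w2 t"
    unfolding AE_all_countable by auto
  then show ?thesis
  proof eventually_elim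
    case (elim t)
    obtain n where "t \<le> real n" using real_arch_simple by blast
    then show ?case using elim[rule_format, of n] by auto
  qed
qed

section \<open>Differential inequalities with vanishing damping\<close>

lemma primitive_diff_le_integral:
  fixes \<phi> \<phi>' k :: "real \<Rightarrow> real"
  assumes prim: "primitive_on_halfline \<phi> \<phi>'" and st: "0 \<le> s" "s \<le> t"
    and le: "AE r in lebesgue. r \<in> {s..t} \<longrightarrow> \<phi>' r \<le> k r" and k: "k integrable_on {s..t}"
  shows "\<phi> t - \<phi> s \<le> integral {s..t} k"
proof -
  obtain N where N: "N \<in> null_sets lebesgue" "\<And>r. r \<notin> N \<Longrightarrow> r \<in> {s..t} \<Longrightarrow> \<phi>' r \<le> k r"
    using AE_E3[OF le] by auto
  \<comment> \<open>On the null set where the inequality may fail, \<open>k\<close> is replaced by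
    \<open>\<phi>'\<close>. This keeps its integral and makes the comparison hold at every
    point.\<close>
  have "((\<lambda>r. if r \<in> N then \<phi>' r else k r) has_integral integral {s..t} k) {s..t}"
    by (rule has_integral_spike[OF _ _ integrable_integral[OF k], of N])
       (use N in \<open>auto simp: negligible_iff_null_sets\<close>)
  then show ?thesis
    by (rule has_integral_le[OF primitive_on_halfline_realD(3)[OF prim st]]) (use N(2) in auto)
qed

lemma antimono_bounded_below_convergent:
  fixes \<psi> :: "real \<Rightarrow> real"
  assumes anti: "\<And>s t. T \<le> s \<Longrightarrow> s \<le> t \<Longrightarrow> \<psi> t \<le> \<psi> s" and lower: "\<And>t. T \<le> t \<Longrightarrow> m \<le> \<psi> t"
  shows "\<exists>L. (\<psi> \<longlongrightarrow> L) at_top"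
proof
  have bdd: "bdd_below (\<psi> ` {T..})" using lower by (auto intro!: bdd_belowI[of _ m])
  show "(\<psi> \<longlongrightarrow> Inf (\<psi> ` {T..})) at_top"
  proof (rule decreasing_tendsto)
    show "\<forall>\<^sub>F t in at_top. Inf (\<psi> ` {T..}) \<le> \<psi> t"
      by (rule eventually_at_top_linorderI[of T]) (auto intro!: cInf_lower bdd)
    fix x assume "Inf (\<psi> ` {T..}) < x"
    then obtain s where "T \<le> s" "\<psi> s < x"
      using cInf_lessD[of "\<psi> ` {T..}" x] by auto
    then show "\<forall>\<^sub>F t in at_top. \<psi> t < x"
      using anti by (intro eventually_at_top_linorderI[of s]) (auto intro: le_less_trans)
  qed
qed

text \<open>Subtracting the integral of \<open>k\<close> makes \<open>\<phi>\<close> nonincreasing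
  and bounded below, hence convergent; the integral of \<open>k\<close> converges as well, being
  monotone and bounded. A one-sided bound on the derivative is thus enough.\<close>

lemma convergent_of_derivative_le_integrable:
  fixes \<phi> \<phi>' k :: "real \<Rightarrow> real"
  assumes prim: "primitive_on_halfline \<phi> \<phi>'" and "0 \<le> T"
    and le: "AE t in lebesgue. T \<le> t \<longrightarrow> \<phi>' t \<le> k t"
    and k: "\<And>t. T \<le> t \<Longrightarrow> k integrable_on {T..t}" "\<And>t. T \<le> t \<Longrightarrow> 0 \<le> k t"
    and B: "\<And>t. T \<le> t \<Longrightarrow> integral {T..t} k \<le> B"
    and lower: "\<And>t. T \<le> t \<Longrightarrow> m \<le> \<phi> t"
  shows "\<exists>L. (\<phi> \<longlongrightarrow> L) at_top"
proof -
  have k_sub: "k integrable_on {s..t}" if "T \<le> s" for s t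
    by (rule integrable_on_subinterval[OF k(1)[of "max T t"]]) (use that in auto)
  have combine: "integral {T..s} k + integral {s..t} k = integral {T..t} k" if "T \<le> s" "s \<le> t" for s t
    using that k(1) by (intro Henstock_Kurzweil_Integration.integral_combine) auto
  have "\<exists>L. ((\<lambda>t. - integral {T..t} k) \<longlongrightarrow> L) at_top"
  proof (rule antimono_bounded_below_convergent)
    show "- integral {T..t} k \<le> - integral {T..s} k" if "T \<le> s" "s \<le> t" for s t
      using combine[OF that] integral_nonneg[OF k_sub[OF that(1), of t]] k(2) that by auto
    show "- B \<le> - integral {T..t} k" if "T \<le> t" for t using B[OF that] by simp
  qed
  then obtain L1 where L1: "((\<lambda>t. - integral {T..t} k) \<longlongrightarrow> L1) at_top" by blast
  have "\<exists>L. ((\<lambda>t. \<phi> t - integral {T..t} k) \<longlongrightarrow> L) at_top"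
  proof (rule antimono_bounded_below_convergent)
    show "\<phi> t - integral {T..t} k \<le> \<phi> s - integral {T..s} k" if "T \<le> s" "s \<le> t" for s t
    proof -
      have "AE r in lebesgue. r \<in> {s..t} \<longrightarrow> \<phi>' r \<le> k r"
        using le by eventually_elim (use that in auto)
      from primitive_diff_le_integral[OF prim _ that(2) this k_sub] that \<open>0 \<le> T\<close> combine[OF that]
      show ?thesis by auto
    qed
    show "m - B \<le> \<phi> t - integral {T..t} k" if "T \<le> t" for t using B[OF that] lower[OF that] by simp
  qed
  then obtain L2 where L2: "((\<lambda>t. \<phi> t - integral {T..t} k) \<longlongrightarrow> L2) at_top" by blast
  from tendsto_diff[OF L2 L1] show ?thesis by auto
qed

lemma primitive_powr:
  "primitive_on_halfline (\<lambda>t. (1 + t) powr \<beta>) (\<lambda>t. \<beta> * (1 + t) powr (\<beta> - 1))"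
  by (rule primitive_on_halfline_C1) (auto intro!: derivative_eq_intros continuous_intros)

text \<open>The differential inequalities satisfied by the energy \<open>e\<close>, the speed \<open>p = |u'|\<close>, the distance
  \<open>r = |u - v|\<close> to a minimizer and the product \<open>z = \<langle>u - v, u'\<rangle>\<close>; here \<open>n = |g|\<close> and
  \<open>c(t) = (1 + t)\<^sup>\<alpha> \<gamma>(t)\<close>.\<close>

locale damped_inequalities =
  fixes \<alpha> K t\<^sub>0 :: real and c c' e e' p r z z' n :: "real \<Rightarrow> real"
  assumes \<alpha>: "0 \<le> \<alpha>" "\<alpha> < 1" and K: "K > 0" and t0: "0 \<le> t\<^sub>0"
    and c_prim: "primitive_on_halfline c c'"
    and c_lower: "\<And>t. t\<^sub>0 \<le> t \<Longrightarrow> K \<le> c t"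
    and c_decr: "AE t in lebesgue. t\<^sub>0 \<le> t \<longrightarrow> c' t \<le> 0"
    and e_prim: "primitive_on_halfline e e'"
    and p_nonneg: "\<And>t. 0 \<le> p t" and r_nonneg: "\<And>t. 0 \<le> r t" and n_nonneg: "\<And>t. 0 \<le> n t"
    and e_lower: "\<And>t. (p t)\<^sup>2 / 2 \<le> e t"
    and e_ineq: "AE t in lebesgue. 0 \<le> t \<longrightarrow> e' t \<le> - (c t / (1 + t) powr \<alpha>) * (p t)\<^sup>2 + n t * p t"
    and r_prim: "primitive_on_halfline (\<lambda>t. (r t)\<^sup>2 / 2) z"
    and z_prim: "primitive_on_halfline z z'"
    and z_bound: "\<And>t. \<bar>z t\<bar> \<le> p t * r t"
    and z_ineq: "AE t in lebesgue. 0 \<le> t \<longrightarrow>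
      z' t \<le> - (c t / (1 + t) powr \<alpha>) * z t + 3/2 * (p t)\<^sup>2 - e t + n t * r t"
    and n_L1: "(\<lambda>t. (1 + t) powr \<alpha> * n t) absolutely_integrable_on {0..}"
    and n_L2: "(\<lambda>t. (1 + t) powr (3 * \<alpha>) * (n t)\<^sup>2) absolutely_integrable_on {0..}"
begin

section \<open>Weighted energy, Lyapunov function and their differential inequalities\<close>

abbreviation "P t \<equiv> (1 + t) powr \<alpha>"
text \<open>This is \<open>P'\<close>. It decreases to 0 because \<alpha> < 1, which is what makes
  the error terms small at late times.\<close>

abbreviation "Q t \<equiv> \<alpha> * (1 + t) powr (\<alpha> - 1)"

definition "X t = (1 + t) powr (2 * \<alpha>) * e t"
definition "X' t = (2 * \<alpha>) * (1 + t) powr (2 * \<alpha> - 1) * e t + (1 + t) powr (2 * \<alpha>) * e' t"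

definition "W t = P t * z t + (c t * ((r t)\<^sup>2 / 2) + (- Q t) * ((r t)\<^sup>2 / 2))"
text \<open>Left in the shape in which the sum and product rules deliver it; the cancellations take
  place in \<open>W_ineq\<close>.\<close>

definition "W' t = (\<alpha> * (1 + t) powr (\<alpha> - 1) * z t + P t * z' t) +
   ((c' t * ((r t)\<^sup>2 / 2) + c t * z t) +
    (\<alpha> * (1 - \<alpha>) * (1 + t) powr (\<alpha> - 2) * ((r t)\<^sup>2 / 2) + (- Q t) * z t))"

lemma e_nonneg: "0 \<le> e t"
  using e_lower[of t] zero_le_power2[of "p t"] by linarith

lemma Q_prim: "primitive_on_halfline (\<lambda>t. - Q t) (\<lambda>t. \<alpha> * (1 - \<alpha>) * (1 + t) powr (\<alpha> - 2))"
  using primitive_on_halfline_cmult[OF primitive_powr[of "\<alpha> - 1"], of "- \<alpha>"]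
  by (simp add: algebra_simps)

lemma X_prim: "primitive_on_halfline X X'"
  unfolding X_def X'_def by (intro primitive_on_halfline_mult primitive_powr e_prim)

lemma W_prim: "primitive_on_halfline W W'"
  unfolding W_def W'_def
  by (intro primitive_on_halfline_add primitive_on_halfline_mult primitive_powr z_prim c_prim r_prim Q_prim)

lemma powr_facts:
  assumes "0 \<le> t"
  shows "0 < P t" "1 \<le> P t" "(1 + t) powr (2 * \<alpha>) = (P t)\<^sup>2" "(1 + t) powr (3 * \<alpha>) = (P t) ^ 3"
    "0 \<le> Q t" "Q t \<le> 1" "P t \<le> 1 + t"
    "(2 * \<alpha>) * (1 + t) powr (2 * \<alpha> - 1) = 2 * Q t * P t"
proof -
  show "0 < P t" "0 \<le> Q t" using assms \<alpha> by auto
  show "1 \<le> P t" using assms \<alpha> by (intro ge_one_powr_ge_zero) auto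
  show "(1 + t) powr (2 * \<alpha>) = (P t)\<^sup>2" "(1 + t) powr (3 * \<alpha>) = (P t) ^ 3"
    using assms by (simp_all add: powr_power mult.commute)
  have "(1 + t) powr (\<alpha> - 1) \<le> (1 + t) powr 0" using assms \<alpha> by (intro powr_mono) auto
  then have "\<alpha> * (1 + t) powr (\<alpha> - 1) \<le> 1 * 1" using assms \<alpha> by (intro mult_mono) auto
  then show "Q t \<le> 1" by simp
  have "P t \<le> (1 + t) powr 1" using assms \<alpha> by (intro powr_mono) auto
  then show "P t \<le> 1 + t" using assms by simp
  show "(2 * \<alpha>) * (1 + t) powr (2 * \<alpha> - 1) = 2 * Q t * P t"
    by (simp flip: powr_add)
qed

lemma X_eq: "0 \<le> t \<Longrightarrow> X t = (P t)\<^sup>2 * e t"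
  by (simp add: X_def powr_facts)

lemma X_nonneg: "0 \<le> X t"
  unfolding X_def using e_nonneg by simp

text \<open>Half of the damping \<open>K P p^2\<close> is spent on the source: by Young's inequality
  it absorbs \<open>P^2 n p\<close> at the price of \<open>P^3 n^2 / (2 K)\<close>. The other half
  is kept as dissipation.\<close>

lemma X_ineq: "AE t in lebesgue. t\<^sub>0 \<le> t \<longrightarrow>
   X' t \<le> 2 * Q t * (P t * e t) - K / 2 * (P t * (p t)\<^sup>2) + (1 / (2 * K)) * ((1 + t) powr (3 * \<alpha>) * (n t)\<^sup>2)"
  using e_ineq
proof (eventually_elim, intro impI)
  fix t assume ineq: "0 \<le> t \<longrightarrow> e' t \<le> - (c t / P t) * (p t)\<^sup>2 + n t * p t" and t: "t\<^sub>0 \<le> t"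
  with t0 have "0 \<le> t" by simp
  note F = powr_facts[OF this]
  have "(P t)\<^sup>2 * e' t \<le> (P t)\<^sup>2 * (- (c t / P t) * (p t)\<^sup>2 + n t * p t)"
    using ineq \<open>0 \<le> t\<close> by (intro mult_left_mono) auto
  also have "\<dots> = - (c t * (P t * (p t)\<^sup>2)) + (P t)\<^sup>2 * n t * p t"
    using F(1) by (simp add: power2_eq_square field_simps)
  also have "\<dots> \<le> - (K * (P t * (p t)\<^sup>2)) + (P t)\<^sup>2 * n t * p t"
    using c_lower[OF t] F(1) by (intro add_mono) (auto intro!: mult_right_mono)
  also have "(P t)\<^sup>2 * n t * p t \<le> K / 2 * (P t * (p t)\<^sup>2) + (1 / (2 * K)) * ((P t) ^ 3 * (n t)\<^sup>2)"
  proof -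
    have "0 \<le> P t * (K * p t - P t * n t)\<^sup>2 / (2 * K)" using F(1) K by simp
    also have "\<dots> = K / 2 * (P t * (p t)\<^sup>2) + (1 / (2 * K)) * ((P t) ^ 3 * (n t)\<^sup>2) - (P t)\<^sup>2 * n t * p t"
      using K by (simp add: power2_eq_square power3_eq_cube field_simps)
    finally show ?thesis by simp
  qed
  finally show "X' t \<le> 2 * Q t * (P t * e t) - K / 2 * (P t * (p t)\<^sup>2) + (1 / (2 * K)) * ((1 + t) powr (3 * \<alpha>) * (n t)\<^sup>2)"
    unfolding X'_def F(3) F(4) F(8) by (simp add: mult.assoc)
qed

text \<open>The damping contributes \<open>- c z\<close> and the coefficient \<open>c\<close>
  contributes \<open>c z\<close>; \<open>Q z\<close> and \<open>- Q z\<close> cancel likewise. The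
  term with \<open>c'\<close> is nonpositive, and the last term on the right is
  \<open>- P'' r^2 / 2\<close>.\<close>

lemma W_ineq: "AE t in lebesgue. t\<^sub>0 \<le> t \<longrightarrow>
   W' t \<le> 3/2 * (P t * (p t)\<^sup>2) - P t * e t + (P t * n t) * r t + \<alpha> * (1 - \<alpha>) * (1 + t) powr (\<alpha> - 2) * ((r t)\<^sup>2 / 2)"
  using z_ineq c_decr
proof (eventually_elim, intro impI)
  fix t assume ineq: "0 \<le> t \<longrightarrow> z' t \<le> - (c t / P t) * z t + 3/2 * (p t)\<^sup>2 - e t + n t * r t"
    and c': "t\<^sub>0 \<le> t \<longrightarrow> c' t \<le> 0" and t: "t\<^sub>0 \<le> t"
  with t0 have "0 \<le> t" by simp
  note F = powr_facts[OF this]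
  have "P t * z' t \<le> P t * (- (c t / P t) * z t + 3/2 * (p t)\<^sup>2 - e t + n t * r t)"
    using ineq \<open>0 \<le> t\<close> F(1) by (intro mult_left_mono) auto
  also have "\<dots> = - (c t * z t) + 3/2 * (P t * (p t)\<^sup>2) - P t * e t + (P t * n t) * r t"
    using F(1) by (simp add: algebra_simps)
  finally have A: "P t * z' t \<le> - (c t * z t) + 3/2 * (P t * (p t)\<^sup>2) - P t * e t + (P t * n t) * r t" .
  have "c' t * ((r t)\<^sup>2 / 2) \<le> 0" using c' t by (simp add: mult_nonpos_nonneg)
  with A show "W' t \<le> 3/2 * (P t * (p t)\<^sup>2) - P t * e t + (P t * n t) * r t + \<alpha> * (1 - \<alpha>) * (1 + t) powr (\<alpha> - 2) * ((r t)\<^sup>2 / 2)"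
    unfolding W'_def by (simp add: algebra_simps)
qed

definition "C1 = integral {0..} (\<lambda>t. P t * n t)"
definition "C2 = integral {0..} (\<lambda>t. (1 + t) powr (3 * \<alpha>) * (n t)\<^sup>2)"

lemma n_integrals:
  assumes "0 \<le> s"
  shows "(\<lambda>t. P t * n t) integrable_on {s..t}" "integral {s..t} (\<lambda>t. P t * n t) \<le> C1"
    "(\<lambda>t. (1 + t) powr (3 * \<alpha>) * (n t)\<^sup>2) integrable_on {s..t}"
    "integral {s..t} (\<lambda>t. (1 + t) powr (3 * \<alpha>) * (n t)\<^sup>2) \<le> C2"
proof -
  have sub: "{s..t} \<subseteq> {0..}" using assms by auto
  have i: "(\<lambda>t. P t * n t) integrable_on {0..}" "(\<lambda>t. (1 + t) powr (3 * \<alpha>) * (n t)\<^sup>2) integrable_on {0..}"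
    using n_L1 n_L2 set_lebesgue_integral_eq_integral(1) by blast+
  show *: "(\<lambda>t. P t * n t) integrable_on {s..t}" "(\<lambda>t. (1 + t) powr (3 * \<alpha>) * (n t)\<^sup>2) integrable_on {s..t}"
    using i integrable_on_subinterval sub by blast+
  show "integral {s..t} (\<lambda>t. P t * n t) \<le> C1"
    unfolding C1_def using n_nonneg by (intro integral_subset_le sub * i) auto
  show "integral {s..t} (\<lambda>t. (1 + t) powr (3 * \<alpha>) * (n t)\<^sup>2) \<le> C2"
    unfolding C2_def by (intro integral_subset_le sub * i) auto
qed

lemma Pe_integrable: "0 \<le> s \<Longrightarrow> (\<lambda>t. P t * e t) integrable_on {s..t}"
  by (intro integrable_continuous_real continuous_intros
      continuous_on_subset[OF primitive_on_halflineD(1)[OF e_prim]]) auto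

text \<open>The factor \<open>8 / K\<close> lets the dissipation \<open>K/2 P p\<^sup>2\<close> of \<open>X\<close> absorb the term \<open>3/2 P p\<^sup>2\<close> of \<open>W'\<close>, and
  \<open>X\<close> absorb the indefinite term \<open>P z\<close> of \<open>W\<close>.\<close>

definition "L t = W t + 8 / K * X t"

lemma Q_tendsto_0: "(Q \<longlongrightarrow> 0) at_top"
proof -
  have "((\<lambda>t. (1 + t) powr (\<alpha> - 1)) \<longlongrightarrow> 0) at_top"
    by (rule tendsto_neg_powr) (use \<alpha> in \<open>auto intro: filterlim_tendsto_add_at_top[OF tendsto_const] filterlim_ident\<close>)
  from tendsto_mult_right_zero[OF this] show ?thesis .
qed

lemma Q_antimono: "0 \<le> s \<Longrightarrow> s \<le> t \<Longrightarrow> Q t \<le> Q s"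
  using \<alpha> by (intro mult_left_mono powr_mono2') auto

text \<open>Young's inequality, weighted so that \<open>K / 8\<close> is well below the
  \<open>K / 2\<close> that \<open>c r^2 / 2\<close> provides. Then \<open>p^2 \<le> 2 e\<close>
  turns \<open>2 / K P^2 p^2\<close> into \<open>4 / K X\<close>, half of what \<open>L\<close>
  contains.\<close>

lemma Pz_bound:
  assumes "0 \<le> t"
  shows "\<bar>P t * z t\<bar> \<le> K / 8 * (r t)\<^sup>2 + 4 / K * X t"
proof -
  note F = powr_facts[OF assms]
  have "\<bar>P t * z t\<bar> \<le> P t * (p t * r t)"
    using z_bound[of t] F(1) by (simp add: abs_mult)
  also have "\<dots> \<le> K / 8 * (r t)\<^sup>2 + 2 / K * ((P t)\<^sup>2 * (p t)\<^sup>2)"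
  proof -
    have "0 \<le> (K * r t - 4 * (P t * p t))\<^sup>2 / (8 * K)" using K by simp
    also have "\<dots> = K / 8 * (r t)\<^sup>2 + 2 / K * ((P t)\<^sup>2 * (p t)\<^sup>2) - P t * (p t * r t)"
      using K by (simp add: power2_eq_square field_simps)
    finally show ?thesis by simp
  qed
  also have "2 / K * ((P t)\<^sup>2 * (p t)\<^sup>2) \<le> 2 / K * ((P t)\<^sup>2 * (2 * e t))"
    using K e_lower[of t] by (intro mult_left_mono) auto
  finally show ?thesis by (simp add: X_eq assms mult.commute mult.left_commute)
qed

text \<open>The coefficient of \<open>r^2\<close> is at least \<open>K / 2\<close> from
  \<open>c\<close>, minus \<open>K / 64\<close> from \<open>Q\<close> and \<open>K / 8\<close> from
  \<open>P z\<close>, which exceeds \<open>K / 4\<close>. Of the \<open>8 / K X\<close> in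
  \<open>L\<close>, one half survives.\<close>

lemma L_lower:
  assumes "t\<^sub>0 \<le> t" "Q t \<le> K / 32"
  shows "K / 4 * (r t)\<^sup>2 + 4 / K * X t \<le> L t"
proof -
  have "0 \<le> t" using assms t0 by simp
  define a where "a = c t * ((r t)\<^sup>2 / 2)"
  define b where "b = Q t * ((r t)\<^sup>2 / 2)"
  define y where "y = 4 / K * X t"
  define d where "d = K * (r t)\<^sup>2"
  have "K * ((r t)\<^sup>2 / 2) \<le> a"
    unfolding a_def using c_lower[OF assms(1)] by (intro mult_right_mono) auto
  moreover have "b \<le> K / 32 * ((r t)\<^sup>2 / 2)"
    unfolding b_def using assms(2) by (intro mult_right_mono) auto
  moreover have "- (P t * z t) \<le> K / 8 * (r t)\<^sup>2 + y"
    unfolding y_def using Pz_bound[OF \<open>0 \<le> t\<close>] by linarith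
  moreover have "0 \<le> d" using K by (simp add: d_def)
  moreover have "L t = P t * z t + a - b + 2 * y"
    by (simp add: L_def W_def a_def b_def y_def)
  ultimately have "K / 4 * (r t)\<^sup>2 + y \<le> L t" unfolding d_def by simp
  then show ?thesis by (simp add: y_def)
qed

text \<open>The term \<open>- P'' r^2 / 2\<close> is at most \<open>- P'' R^2 / 2\<close>, which is
  the derivative of \<open>- Q R^2 / 2\<close>. Adding \<open>Q R^2 / 2\<close> to \<open>L\<close>
  therefore removes it and leaves only the boundary term at \<open>T\<close>. A bound
  \<open>R\<close> on \<open>{T..t}\<close> alone is asked for, since the estimate is first applied
  before \<open>r\<close> is known to be bounded.\<close>

lemma L_estimate:
  assumes T: "t\<^sub>0 \<le> T" "Q T \<le> K / 32" and "T \<le> t" and R: "\<And>s. T \<le> s \<Longrightarrow> s \<le> t \<Longrightarrow> r s \<le> R"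
  shows "L t + 1/2 * integral {T..t} (\<lambda>s. P s * e s) \<le> L T + Q T * (R\<^sup>2 / 2) + R * C1 + 4 / K\<^sup>2 * C2"
proof -
  have "0 \<le> T" using T t0 by simp
  have "0 \<le> R" using R[of T] \<open>T \<le> t\<close> r_nonneg[of T] by simp
  define M where "M s = L s + (- (R\<^sup>2 / 2)) * (- Q s)" for s
  define M' where "M' s = (W' s + 8 / K * X' s) + (- (R\<^sup>2 / 2)) * (\<alpha> * (1 - \<alpha>) * (1 + s) powr (\<alpha> - 2))" for s
  have M: "primitive_on_halfline M M'"
    unfolding M_def L_def M'_def
    by (intro primitive_on_halfline_add primitive_on_halfline_cmult W_prim X_prim Q_prim)
  define k where "k s = - (1/2) * (P s * e s) + (R * (P s * n s) + 4 / K\<^sup>2 * ((1 + s) powr (3 * \<alpha>) * (n s)\<^sup>2))" for s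
  have ineq: "AE s in lebesgue. s \<in> {T..t} \<longrightarrow> M' s \<le> k s"
    using X_ineq W_ineq
  proof (eventually_elim, intro impI)
    fix s
    assume x: "t\<^sub>0 \<le> s \<longrightarrow> X' s \<le> 2 * Q s * (P s * e s) - K / 2 * (P s * (p s)\<^sup>2) + (1 / (2 * K)) * ((1 + s) powr (3 * \<alpha>) * (n s)\<^sup>2)"
      and w: "t\<^sub>0 \<le> s \<longrightarrow> W' s \<le> 3/2 * (P s * (p s)\<^sup>2) - P s * e s + (P s * n s) * r s + \<alpha> * (1 - \<alpha>) * (1 + s) powr (\<alpha> - 2) * ((r s)\<^sup>2 / 2)"
      and s: "s \<in> {T..t}"
    show "M' s \<le> k s"
    proof -
      have "T \<le> s" "s \<le> t" using s by auto
      have "0 \<le> s" "t\<^sub>0 \<le> s" using \<open>T \<le> s\<close> \<open>0 \<le> T\<close> T by auto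
      note F = powr_facts[OF \<open>0 \<le> s\<close>]
      have Q: "Q s \<le> K / 32" using Q_antimono[OF \<open>0 \<le> T\<close> \<open>T \<le> s\<close>] T(2) by linarith
      have r: "r s \<le> R" using R s by auto
      have Pe: "0 \<le> P s * e s" using F(1) e_nonneg[of s] by simp
      have "8 / K * X' s \<le> 8 / K * (2 * Q s * (P s * e s) - K / 2 * (P s * (p s)\<^sup>2) + (1 / (2 * K)) * ((1 + s) powr (3 * \<alpha>) * (n s)\<^sup>2))"
        using x \<open>t\<^sub>0 \<le> s\<close> K by (intro mult_left_mono) auto
      also have "\<dots> = 16 / K * Q s * (P s * e s) - 4 * (P s * (p s)\<^sup>2) + 4 / K\<^sup>2 * ((1 + s) powr (3 * \<alpha>) * (n s)\<^sup>2)"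
        using K by (simp add: field_simps power2_eq_square)
      finally have a1: "8 / K * X' s \<le> \<dots>" .
      \<comment> \<open>This fixes the threshold \<open>K / 32\<close>: the growth of the weight in
        \<open>X\<close> then consumes at most half of the \<open>- P e\<close> coming from
        \<open>W\<close>.\<close>
      have "16 / K * Q s \<le> 1/2" using Q K by (simp add: field_simps)
      then have a3: "16 / K * Q s * (P s * e s) \<le> 1/2 * (P s * e s)" by (rule mult_right_mono[OF _ Pe])
      have a4: "(P s * n s) * r s \<le> R * (P s * n s)"
        using mult_left_mono[OF r, of "P s * n s"] F(1) n_nonneg[of s] by (simp add: mult.commute)
      have "(r s)\<^sup>2 \<le> R\<^sup>2" using r r_nonneg[of s] by (intro power_mono)
      then have "\<alpha> * (1 - \<alpha>) * (1 + s) powr (\<alpha> - 2) * ((r s)\<^sup>2 / 2) \<le> \<alpha> * (1 - \<alpha>) * (1 + s) powr (\<alpha> - 2) * (R\<^sup>2 / 2)"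
        using \<alpha> by (intro mult_left_mono) auto
      then have a5: "\<alpha> * (1 - \<alpha>) * (1 + s) powr (\<alpha> - 2) * ((r s)\<^sup>2 / 2)
          + (- (R\<^sup>2 / 2)) * (\<alpha> * (1 - \<alpha>) * (1 + s) powr (\<alpha> - 2)) \<le> 0"
        by (simp add: mult.commute)
      have a6: "0 \<le> P s * (p s)\<^sup>2" using F(1) by simp
      have "M' s \<le> - (1/2) * (P s * e s) + (R * (P s * n s) + 4 / K\<^sup>2 * ((1 + s) powr (3 * \<alpha>) * (n s)\<^sup>2))"
        using mp[OF w \<open>t\<^sub>0 \<le> s\<close>] a1 a3 a4 a5 a6 unfolding M'_def by linarith
      then show ?thesis by (simp add: k_def)
    qed
  qed
  have "M t - M T \<le> integral {T..t} k"
  proof -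
    have k_int: "k integrable_on {T..t}"
      unfolding k_def by (intro integrable_add integrable_on_mult_right Pe_integrable n_integrals \<open>0 \<le> T\<close>)
    show ?thesis
      by (rule primitive_diff_le_integral[OF M \<open>0 \<le> T\<close> \<open>T \<le> t\<close> ineq k_int])
  qed
  also have "integral {T..t} k = - (1/2) * integral {T..t} (\<lambda>s. P s * e s) +
      (R * integral {T..t} (\<lambda>s. P s * n s) + 4 / K\<^sup>2 * integral {T..t} (\<lambda>s. (1 + s) powr (3 * \<alpha>) * (n s)\<^sup>2))"
    unfolding k_def
    by (subst integral_add integral_mult_right,
        (intro integrable_add integrable_on_mult_right Pe_integrable n_integrals \<open>0 \<le> T\<close>)+)+ simp
  also have "\<dots> \<le> - (1/2) * integral {T..t} (\<lambda>s. P s * e s) + (R * C1 + 4 / K\<^sup>2 * C2)"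
    using n_integrals[OF \<open>0 \<le> T\<close>] \<open>0 \<le> R\<close> by (intro add_left_mono add_mono mult_left_mono) auto
  finally have "M t - M T \<le> - (1/2) * integral {T..t} (\<lambda>s. P s * e s) + (R * C1 + 4 / K\<^sup>2 * C2)" .
  moreover have "0 \<le> Q t * (R\<^sup>2 / 2)" using powr_facts(5)[of t] \<open>0 \<le> T\<close> \<open>T \<le> t\<close> by simp
  ultimately show ?thesis unfolding M_def by (simp add: mult.commute)
qed

section \<open>A priori bounds\<close>

lemma continuous_on_r: "continuous_on {0..} r"
proof -
  have "continuous_on {0..} (\<lambda>t. sqrt (2 * ((r t)\<^sup>2 / 2)))"
    by (intro continuous_intros primitive_on_halflineD(1)[OF r_prim])
  then show ?thesis using r_nonneg by simp
qed

lemma small_Q_time: obtains T where "t\<^sub>0 \<le> T" "0 \<le> T" "Q T \<le> K / 32"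
proof -
  have "\<forall>\<^sub>F t in at_top. Q t < K / 32 \<and> t\<^sub>0 \<le> t"
    using order_tendstoD(2)[OF Q_tendsto_0, of "K / 32"] K by (intro eventually_conj eventually_ge_at_top) simp
  then obtain T where "Q T < K / 32 \<and> t\<^sub>0 \<le> T"
    unfolding eventually_at_top_linorder by (meson order_refl)
  then show thesis using t0 by (intro that[of T]) auto
qed

lemma Pe_integral_nonneg: "0 \<le> T \<Longrightarrow> 0 \<le> integral {T..t} (\<lambda>s. P s * e s)"
  by (intro integral_nonneg Pe_integrable) (auto simp: e_nonneg)

text \<open>At a time \<open>t\<close> where \<open>r\<close> is maximal on \<open>{T..S}\<close>,
  \<open>L_estimate\<close> applies with \<open>R = r t\<close>. The left side contains
  \<open>K / 4\<close> times \<open>(r t)^2\<close>, the right side at most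
  \<open>K / 64 + K / 16\<close> times it after Young's inequality, so at least \<open>K / 8\<close>
  remains; its inverse is the factor in \<open>B\<close>. The bound is independent of
  \<open>S\<close>, and times before \<open>T\<close> are covered by compactness.\<close>

lemma r_bounded: "\<exists>R. \<forall>t\<ge>0. r t \<le> R"
proof -
  obtain T where T: "t\<^sub>0 \<le> T" "0 \<le> T" "Q T \<le> K / 32" by (rule small_Q_time)
  define B where "B = 8 / K * (L T + 4 / K\<^sup>2 * C2 + 4 * C1\<^sup>2 / K)"
  have late: "r S \<le> sqrt B" if "T \<le> S" for S
  proof -
    have "continuous_on {T..S} r" by (rule continuous_on_subset[OF continuous_on_r]) (use T in auto)
    from continuous_attains_sup[OF compact_Icc _ this] that
    obtain t where t: "t \<in> {T..S}" and max: "\<And>s. s \<in> {T..S} \<Longrightarrow> r s \<le> r t" by auto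
    have "L t + 1/2 * integral {T..t} (\<lambda>s. P s * e s) \<le> L T + Q T * ((r t)\<^sup>2 / 2) + r t * C1 + 4 / K\<^sup>2 * C2"
      by (rule L_estimate[OF T(1,3)]) (use t max in auto)
    moreover have "K / 4 * (r t)\<^sup>2 + 4 / K * X t \<le> L t"
      using T t Q_antimono[of T t] by (intro L_lower) auto
    moreover have "0 \<le> 4 / K * X t" using X_nonneg K by simp
    moreover have "0 \<le> integral {T..t} (\<lambda>s. P s * e s)" by (rule Pe_integral_nonneg[OF T(2)])
    moreover have "Q T * ((r t)\<^sup>2 / 2) \<le> K / 32 * ((r t)\<^sup>2 / 2)" using T(3) by (intro mult_right_mono) auto
    moreover have "r t * C1 \<le> K / 16 * (r t)\<^sup>2 + 4 * C1\<^sup>2 / K"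
    proof -
      have "0 \<le> (K * r t - 8 * C1)\<^sup>2 / (16 * K)" using K by simp
      also have "\<dots> = K / 16 * (r t)\<^sup>2 + 4 * C1\<^sup>2 / K - r t * C1"
        using K by (simp add: power2_eq_square field_simps)
      finally show ?thesis by simp
    qed
    moreover have "0 \<le> K * (r t)\<^sup>2" using K by simp
    ultimately have "K / 8 * (r t)\<^sup>2 \<le> L T + 4 / K\<^sup>2 * C2 + 4 * C1\<^sup>2 / K"
      by linarith
    then have "(r t)\<^sup>2 \<le> B" using K by (simp add: B_def field_simps)
    then have "r t \<le> sqrt B" by (rule real_le_rsqrt)
    with max[of S] that show ?thesis by auto
  qed
  obtain R where R: "\<And>t. t \<in> {0..T} \<Longrightarrow> norm (r t) \<le> R"
    using continuous_on_Icc_norm_bound[of 0 T r] continuous_on_subset[OF continuous_on_r] by (metis Icc_subset_Ici_iff order_refl)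
  show ?thesis
  proof (intro exI[of _ "max (sqrt B) R"] allI impI)
    fix t :: real assume "0 \<le> t"
    then show "r t \<le> max (sqrt B) R"
      using late[of t] R[of t] by (cases "T \<le> t") auto
  qed
qed

lemma X_Pe_bounded:
  obtains R T B where "t\<^sub>0 \<le> T" "0 \<le> T" "\<And>t. 0 \<le> t \<Longrightarrow> r t \<le> R" "0 \<le> R"
    "\<And>t. T \<le> t \<Longrightarrow> X t \<le> B" "\<And>t. T \<le> t \<Longrightarrow> integral {T..t} (\<lambda>s. P s * e s) \<le> B"
proof -
  obtain T where T: "t\<^sub>0 \<le> T" "0 \<le> T" "Q T \<le> K / 32" by (rule small_Q_time)
  obtain R where R: "\<And>t. 0 \<le> t \<Longrightarrow> r t \<le> R" using r_bounded by blast
  define D where "D = L T + Q T * (R\<^sup>2 / 2) + R * C1 + 4 / K\<^sup>2 * C2"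
  have est: "X t \<le> K / 4 * D" "integral {T..t} (\<lambda>s. P s * e s) \<le> 2 * D" "0 \<le> D" if "T \<le> t" for t
  proof -
    have "L t + 1/2 * integral {T..t} (\<lambda>s. P s * e s) \<le> D"
      unfolding D_def by (rule L_estimate[OF T(1,3) that]) (use R T in auto)
    moreover have "K / 4 * (r t)\<^sup>2 + 4 / K * X t \<le> L t"
      using T that Q_antimono[of T t] by (intro L_lower) auto
    moreover have "0 \<le> 4 / K * X t" using X_nonneg K by simp
    moreover have "0 \<le> integral {T..t} (\<lambda>s. P s * e s)" by (rule Pe_integral_nonneg[OF T(2)])
    moreover have "0 \<le> K / 4 * (r t)\<^sup>2" using K by simp
    ultimately have *: "4 / K * X t \<le> D" "integral {T..t} (\<lambda>s. P s * e s) \<le> 2 * D" "0 \<le> D" by linarith+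
    then show "X t \<le> K / 4 * D" using K by (simp add: field_simps)
    from * show "integral {T..t} (\<lambda>s. P s * e s) \<le> 2 * D" "0 \<le> D" by blast+
  qed
  show thesis
  proof (rule that[OF T(1,2)])
    show "0 \<le> R" using R[of 0] r_nonneg[of 0] by simp
    \<comment> \<open>Since \<open>D \<ge> 0\<close>, one constant dominates both bounds,
      \<open>K / 4 * D\<close> and \<open>2 * D\<close>.\<close>
    show "X t \<le> (K / 4 + 2) * D" if "T \<le> t" for t
      using est[OF that] by (simp add: algebra_simps)
    show "integral {T..t} (\<lambda>s. P s * e s) \<le> (K / 4 + 2) * D" if "T \<le> t" for t
    proof -
      have "0 \<le> K / 4 * D" using est(3)[OF that] K by simp
      then show ?thesis using est(2)[OF that] by (simp only: distrib_right)
    qed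
  qed (fact R)
qed

section \<open>Decay of the weighted energy\<close>

lemma X_tendsto_0: "(X \<longlongrightarrow> 0) at_top"
proof -
  obtain R T B where T: "t\<^sub>0 \<le> T" "0 \<le> T" and "\<And>t. 0 \<le> t \<Longrightarrow> r t \<le> R" "0 \<le> R" "\<And>t. T \<le> t \<Longrightarrow> X t \<le> B"
    and B: "\<And>t. T \<le> t \<Longrightarrow> integral {T..t} (\<lambda>s. P s * e s) \<le> B"
    by (rule X_Pe_bounded) blast
  define k where "k t = 2 * (P t * e t) + (1 / (2 * K)) * ((1 + t) powr (3 * \<alpha>) * (n t)\<^sup>2)" for t
  have "\<exists>l. (X \<longlongrightarrow> l) at_top"
  proof (rule convergent_of_derivative_le_integrable[OF X_prim T(2)])
    show "AE t in lebesgue. T \<le> t \<longrightarrow> X' t \<le> k t"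
      using X_ineq
    proof (eventually_elim, intro impI)
      fix t assume x: "t\<^sub>0 \<le> t \<longrightarrow> X' t \<le> 2 * Q t * (P t * e t) - K / 2 * (P t * (p t)\<^sup>2) + (1 / (2 * K)) * ((1 + t) powr (3 * \<alpha>) * (n t)\<^sup>2)"
        and "T \<le> t"
      then have "0 \<le> t" "t\<^sub>0 \<le> t" using T by auto
      note F = powr_facts[OF \<open>0 \<le> t\<close>]
      have "2 * Q t * (P t * e t) \<le> 2 * 1 * (P t * e t)"
        using F e_nonneg by (intro mult_right_mono mult_left_mono) auto
      moreover have "0 \<le> K / 2 * (P t * (p t)\<^sup>2)" using F K by simp
      ultimately show "X' t \<le> k t" using mp[OF x \<open>t\<^sub>0 \<le> t\<close>] unfolding k_def by linarith
    qed
    show k_int: "k integrable_on {T..t}" for t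
      unfolding k_def by (intro integrable_add integrable_on_mult_right Pe_integrable n_integrals T)
    show "0 \<le> k t" if "T \<le> t" for t using K e_nonneg by (simp add: k_def)
    show "0 \<le> X t" for t by (rule X_nonneg)
    show "integral {T..t} k \<le> 2 * B + (1 / (2 * K)) * C2" if "T \<le> t" for t
    proof -
      have "integral {T..t} k = 2 * integral {T..t} (\<lambda>s. P s * e s) + (1 / (2 * K)) * integral {T..t} (\<lambda>s. (1 + s) powr (3 * \<alpha>) * (n s)\<^sup>2)"
        unfolding k_def
        by (subst integral_add integral_mult_right,
            (intro integrable_add integrable_on_mult_right Pe_integrable n_integrals T)+)+ simp
      also have "\<dots> \<le> 2 * B + (1 / (2 * K)) * C2"
        using B[OF that] n_integrals(4)[OF T(2)] K by (intro add_mono mult_left_mono) auto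
      finally show ?thesis .
    qed
  qed
  then obtain l where l: "(X \<longlongrightarrow> l) at_top" by blast
  have "l \<ge> 0" by (rule tendsto_lowerbound[OF l]) (auto intro: always_eventually X_nonneg)
  moreover have "\<not> l > 0"
  proof
    assume "l > 0"
    then have "\<forall>\<^sub>F t in at_top. l / 2 < X t" using order_tendstoD(1)[OF l, of "l/2"] by simp
    then obtain S where S: "\<And>t. S \<le> t \<Longrightarrow> l / 2 < X t" unfolding eventually_at_top_linorder by blast
    define T1 where "T1 = max S T"
    \<comment> \<open>For a positive limit \<open>l\<close>, \<open>P e = X / P\<close> eventually
      exceeds \<open>l / 2 / (1 + s)\<close>, because \<open>P s \<le> 1 + s\<close>. The integral
      then grows like a logarithm, against the bound \<open>B\<close>.\<close>
    have le: "l / 2 * (ln (1 + t) - ln (1 + T1)) \<le> B" if "T1 \<le> t" for t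
    proof -
      have "0 \<le> T1" using T by (simp add: T1_def)
      have "((\<lambda>s. l / 2 * (1 / (1 + s))) has_integral l / 2 * (ln (1 + t) - ln (1 + T1))) {T1..t}"
      proof (intro has_integral_mult_right fundamental_theorem_of_calculus[OF that])
        show "((\<lambda>s. ln (1 + s)) has_vector_derivative 1 / (1 + s)) (at s within {T1..t})" if "s \<in> {T1..t}" for s
          using that \<open>0 \<le> T1\<close> unfolding has_real_derivative_iff_has_vector_derivative[symmetric]
          by (auto intro!: derivative_eq_intros)
      qed
      then have "l / 2 * (ln (1 + t) - ln (1 + T1)) \<le> integral {T1..t} (\<lambda>s. P s * e s)"
      proof (rule has_integral_le[OF _ integrable_integral[OF Pe_integrable[OF \<open>0 \<le> T1\<close>]]])
        fix s assume "s \<in> {T1..t}"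
        then have "0 \<le> s" "S \<le> s" using \<open>0 \<le> T1\<close> by (auto simp: T1_def)
        note F = powr_facts[OF \<open>0 \<le> s\<close>]
        have "l / 2 * (1 / (1 + s)) \<le> l / 2 * (1 / P s)"
          using F \<open>0 < l\<close> \<open>0 \<le> s\<close> by (intro mult_left_mono divide_left_mono) auto
        also have "\<dots> \<le> X s * (1 / P s)" using S[OF \<open>S \<le> s\<close>] F by (intro mult_right_mono) auto
        also have "\<dots> = P s * e s" using F \<open>0 \<le> s\<close> by (simp add: X_eq power2_eq_square)
        finally show "l / 2 * (1 / (1 + s)) \<le> P s * e s" .
      qed
      also have "\<dots> \<le> integral {T..t} (\<lambda>s. P s * e s)"
        by (rule integral_subset_le) (use T e_nonneg in \<open>auto simp: T1_def intro!: Pe_integrable\<close>)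
      also have "\<dots> \<le> B" using B that by (simp add: T1_def)
      finally show ?thesis .
    qed
    have "filterlim (\<lambda>t::real. l / 2 * (ln (1 + t) - ln (1 + T1))) at_top at_top"
    proof (rule filterlim_tendsto_pos_mult_at_top[OF tendsto_const])
      have "filterlim (\<lambda>t::real. 1 + t) at_top at_top"
        by (rule filterlim_tendsto_add_at_top[OF tendsto_const filterlim_ident])
      then have "filterlim (\<lambda>t::real. ln (1 + t)) at_top at_top"
        by (rule filterlim_compose[OF ln_at_top])
      from filterlim_tendsto_add_at_top[OF tendsto_const[of "- ln (1 + T1)"] this]
      show "filterlim (\<lambda>t::real. ln (1 + t) - ln (1 + T1)) at_top at_top" by simp
    qed (use \<open>0 < l\<close> in simp)
    then have "\<forall>\<^sub>F t in at_top. B < l / 2 * (ln (1 + t) - ln (1 + T1)) \<and> T1 \<le> t"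
      by (auto simp: filterlim_at_top_dense intro: eventually_conj eventually_ge_at_top)
    then obtain t where "B < l / 2 * (ln (1 + t) - ln (1 + T1))" "T1 \<le> t"
      unfolding eventually_at_top_linorder by (meson order_refl)
    with le[of t] show False by simp
  qed
  ultimately show ?thesis using l by simp
qed

section \<open>Convergence of the distance to a minimizer\<close>

lemma c_convergent: obtains c1 where "(c \<longlongrightarrow> c1) at_top" "K \<le> c1"
proof -
  have "\<exists>l. (c \<longlongrightarrow> l) at_top"
    by (rule convergent_of_derivative_le_integrable[OF c_prim t0 c_decr, of 0 K]) (auto intro: c_lower)
  then obtain l where l: "(c \<longlongrightarrow> l) at_top" by blast
  moreover have "K \<le> l"
    by (rule tendsto_lowerbound[OF l]) (auto intro: eventually_at_top_linorderI c_lower)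
  ultimately show thesis using that by blast
qed

text \<open>A corrected \<open>W\<close> converges, and of its parts only \<open>c r^2 / 2\<close>
  survives in the limit: \<open>P z\<close> is at most \<open>sqrt (2 X) R\<close>, and
  \<open>Q\<close> tends to 0. The limit of \<open>c\<close> is at least \<open>K\<close>, so one
  may divide by \<open>c\<close>.\<close>

lemma r_convergent: "\<exists>l. (r \<longlongrightarrow> l) at_top"
proof -
  obtain R T B where T: "t\<^sub>0 \<le> T" "0 \<le> T" and R: "\<And>t. 0 \<le> t \<Longrightarrow> r t \<le> R" "0 \<le> R"
    and BX: "\<And>t. T \<le> t \<Longrightarrow> X t \<le> B"
    and B: "\<And>t. T \<le> t \<Longrightarrow> integral {T..t} (\<lambda>s. P s * e s) \<le> B"
    by (rule X_Pe_bounded) blast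
  have r2: "(r t)\<^sup>2 \<le> R\<^sup>2" if "0 \<le> t" for t using R(1)[OF that] r_nonneg[of t] by (intro power_mono)
  define M where "M t = W t + (- (R\<^sup>2 / 2)) * (- Q t)" for t
  define M' where "M' t = W' t + (- (R\<^sup>2 / 2)) * (\<alpha> * (1 - \<alpha>) * (1 + t) powr (\<alpha> - 2))" for t
  have M: "primitive_on_halfline M M'"
    unfolding M_def M'_def
    by (intro primitive_on_halfline_add primitive_on_halfline_cmult W_prim Q_prim)
  \<comment> \<open>\<open>3/2 P p^2\<close> is at most \<open>3 P e\<close>, and
    \<open>W_ineq\<close> subtracts one \<open>P e\<close>.\<close>
  define k where "k t = 2 * (P t * e t) + R * (P t * n t)" for t
  \<comment> \<open>Adding \<open>Q R^2 / 2\<close> to \<open>W\<close> compensates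
    \<open>- P'' r^2 / 2\<close> in the derivative and makes the last term nonnegative for
    \<open>t \<ge> 0\<close>. As the term with \<open>c\<close> is nonnegative at late times,
    \<open>M\<close> is bounded below as soon as \<open>P z\<close> is.\<close>
  have M_eq: "M t = P t * z t + c t * ((r t)\<^sup>2 / 2) + Q t * ((R\<^sup>2 - (r t)\<^sup>2) / 2)" for t
    unfolding M_def W_def by (simp add: algebra_simps diff_divide_distrib)
  have "\<exists>l. (M \<longlongrightarrow> l) at_top"
  proof (rule convergent_of_derivative_le_integrable[OF M T(2)])
    show "AE t in lebesgue. T \<le> t \<longrightarrow> M' t \<le> k t"
      using W_ineq
    proof (eventually_elim, intro impI)
      fix t assume w: "t\<^sub>0 \<le> t \<longrightarrow> W' t \<le> 3/2 * (P t * (p t)\<^sup>2) - P t * e t + (P t * n t) * r t + \<alpha> * (1 - \<alpha>) * (1 + t) powr (\<alpha> - 2) * ((r t)\<^sup>2 / 2)"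
        and "T \<le> t"
      then have "0 \<le> t" "t\<^sub>0 \<le> t" using T by auto
      note F = powr_facts[OF \<open>0 \<le> t\<close>]
      have "P t * (p t)\<^sup>2 \<le> P t * (2 * e t)" using e_lower[of t] F(1) by (intro mult_left_mono) auto
      moreover have "(P t * n t) * r t \<le> R * (P t * n t)"
        using mult_left_mono[OF R(1)[OF \<open>0 \<le> t\<close>], of "P t * n t"] F(1) n_nonneg[of t] by (simp add: mult.commute)
      moreover have "\<alpha> * (1 - \<alpha>) * (1 + t) powr (\<alpha> - 2) * ((r t)\<^sup>2 / 2) \<le> \<alpha> * (1 - \<alpha>) * (1 + t) powr (\<alpha> - 2) * (R\<^sup>2 / 2)"
        using \<alpha> r2[OF \<open>0 \<le> t\<close>] by (intro mult_left_mono) auto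
      then have "\<alpha> * (1 - \<alpha>) * (1 + t) powr (\<alpha> - 2) * ((r t)\<^sup>2 / 2)
          + (- (R\<^sup>2 / 2)) * (\<alpha> * (1 - \<alpha>) * (1 + t) powr (\<alpha> - 2)) \<le> 0"
        by (simp add: mult.commute)
      ultimately show "M' t \<le> k t" using mp[OF w \<open>t\<^sub>0 \<le> t\<close>] unfolding k_def M'_def by linarith
    qed
    show k_int: "k integrable_on {T..t}" for t
      unfolding k_def by (intro integrable_add integrable_on_mult_right Pe_integrable n_integrals T)
    show "0 \<le> k t" for t using e_nonneg R(2) n_nonneg by (simp add: k_def)
    show "integral {T..t} k \<le> 2 * B + R * C1" if "T \<le> t" for t
    proof -
      have "integral {T..t} k = 2 * integral {T..t} (\<lambda>s. P s * e s) + R * integral {T..t} (\<lambda>s. P s * n s)"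
        unfolding k_def
        by (subst integral_add integral_mult_right,
            (intro integrable_add integrable_on_mult_right Pe_integrable n_integrals T)+)+ simp
      also have "\<dots> \<le> 2 * B + R * C1"
        using B[OF that] n_integrals(2)[OF T(2)] R(2) by (intro add_mono mult_left_mono) auto
      finally show ?thesis .
    qed
    show "- (K / 8 * R\<^sup>2 + 4 / K * B) \<le> M t" if "T \<le> t" for t
    proof -
      have "0 \<le> t" "t\<^sub>0 \<le> t" using that T by auto
      have "\<bar>P t * z t\<bar> \<le> K / 8 * (r t)\<^sup>2 + 4 / K * X t" by (rule Pz_bound[OF \<open>0 \<le> t\<close>])
      also have "\<dots> \<le> K / 8 * R\<^sup>2 + 4 / K * B"
        using K BX[OF that] r2[OF \<open>0 \<le> t\<close>] by (intro add_mono mult_left_mono) auto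
      moreover have "0 \<le> c t * ((r t)\<^sup>2 / 2)" using c_lower[OF \<open>t\<^sub>0 \<le> t\<close>] K by simp
      moreover have "0 \<le> Q t * ((R\<^sup>2 - (r t)\<^sup>2) / 2)"
        using r2[OF \<open>0 \<le> t\<close>] by (intro mult_nonneg_nonneg[OF powr_facts(5)[OF \<open>0 \<le> t\<close>]]) auto
      ultimately show ?thesis unfolding M_eq by linarith
    qed
  qed
  then obtain l where l: "(M \<longlongrightarrow> l) at_top" by blast
  have Pz: "((\<lambda>t. P t * z t) \<longlongrightarrow> 0) at_top"
  proof (rule Lim_null_comparison)
    have "((\<lambda>t. sqrt (2 * X t) * R) \<longlongrightarrow> sqrt (2 * 0) * R) at_top"
      by (intro tendsto_intros X_tendsto_0)
    then show "((\<lambda>t. sqrt (2 * X t) * R) \<longlongrightarrow> 0) at_top" by simp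
    show "\<forall>\<^sub>F t in at_top. norm (P t * z t) \<le> sqrt (2 * X t) * R"
    proof (rule eventually_at_top_linorderI[of 0])
      fix t :: real assume "0 \<le> t"
      note F = powr_facts[OF this]
      have "(P t * p t)\<^sup>2 \<le> 2 * X t"
        using e_lower[of t] \<open>0 \<le> t\<close> F(1) by (simp add: X_eq power_mult_distrib)
      then have "P t * p t \<le> sqrt (2 * X t)" by (rule real_le_rsqrt)
      have "norm (P t * z t) \<le> P t * (p t * r t)" using z_bound[of t] F(1) by (simp add: abs_mult)
      also have "\<dots> = P t * p t * r t" by simp
      also have "\<dots> \<le> sqrt (2 * X t) * R"
        using \<open>P t * p t \<le> sqrt (2 * X t)\<close> R(1)[OF \<open>0 \<le> t\<close>] r_nonneg[of t] X_nonneg[of t] by (intro mult_mono) auto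
      finally show "norm (P t * z t) \<le> sqrt (2 * X t) * R" .
    qed
  qed
  have Qr: "((\<lambda>t. Q t * ((R\<^sup>2 - (r t)\<^sup>2) / 2)) \<longlongrightarrow> 0) at_top"
  proof (rule Lim_null_comparison)
    show "((\<lambda>t. Q t * (R\<^sup>2 / 2)) \<longlongrightarrow> 0) at_top"
      by (rule tendsto_mult_left_zero[OF Q_tendsto_0])
    show "\<forall>\<^sub>F t in at_top. norm (Q t * ((R\<^sup>2 - (r t)\<^sup>2) / 2)) \<le> Q t * (R\<^sup>2 / 2)"
    proof (rule eventually_at_top_linorderI[of 0])
      fix t :: real assume "0 \<le> t"
      have "0 \<le> (R\<^sup>2 - (r t)\<^sup>2) / 2" "(R\<^sup>2 - (r t)\<^sup>2) / 2 \<le> R\<^sup>2 / 2" using r2[OF \<open>0 \<le> t\<close>] by auto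
      moreover have "norm (Q t * ((R\<^sup>2 - (r t)\<^sup>2) / 2)) = Q t * ((R\<^sup>2 - (r t)\<^sup>2) / 2)"
        unfolding real_norm_def
        by (rule abs_of_nonneg[OF mult_nonneg_nonneg[OF powr_facts(5)[OF \<open>0 \<le> t\<close>] calculation(1)]])
      ultimately show "norm (Q t * ((R\<^sup>2 - (r t)\<^sup>2) / 2)) \<le> Q t * (R\<^sup>2 / 2)"
        using mult_left_mono[OF _ powr_facts(5)[OF \<open>0 \<le> t\<close>]] by metis
    qed
  qed
  obtain c1 where c: "(c \<longlongrightarrow> c1) at_top" "K \<le> c1" by (rule c_convergent)
  have "((\<lambda>t. (M t - P t * z t - Q t * ((R\<^sup>2 - (r t)\<^sup>2) / 2)) / c t) \<longlongrightarrow> (l - 0 - 0) / c1) at_top"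
    by (intro tendsto_intros l Pz Qr c) (use K c in auto)
  moreover have "\<forall>\<^sub>F t in at_top. (M t - P t * z t - Q t * ((R\<^sup>2 - (r t)\<^sup>2) / 2)) / c t = (r t)\<^sup>2 / 2"
  proof (rule eventually_at_top_linorderI[of t\<^sub>0])
    fix t assume "t\<^sub>0 \<le> t"
    then have "c t \<noteq> 0" using c_lower[of t] K by auto
    then show "(M t - P t * z t - Q t * ((R\<^sup>2 - (r t)\<^sup>2) / 2)) / c t = (r t)\<^sup>2 / 2"
      unfolding M_eq by simp
  qed
  ultimately have "((\<lambda>t. (r t)\<^sup>2 / 2) \<longlongrightarrow> (l - 0 - 0) / c1) at_top"
    by (rule Lim_transform_eventually)
  from tendsto_real_sqrt[OF tendsto_mult[OF tendsto_const[of 2] this]]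
  have "((\<lambda>t. sqrt (2 * ((r t)\<^sup>2 / 2))) \<longlongrightarrow> sqrt (2 * ((l - 0 - 0) / c1))) at_top" .
  then show ?thesis using r_nonneg by auto
qed

end

section \<open>Closed convex hulls and weak convergence\<close>

text \<open>The points of almost minimal norm in a decreasing sequence of convex sets form a Cauchy
  sequence, by the parallelogram identity.\<close>

lemma decreasing_closed_convex_Inter_nonempty:
  fixes C :: "nat \<Rightarrow> 'v::{real_inner, complete_space} set"
  assumes C: "\<And>n. closed (C n)" "\<And>n. convex (C n)" "\<And>n. C n \<noteq> {}"
    and dec: "\<And>m n. m \<le> n \<Longrightarrow> C n \<subseteq> C m" and bdd: "bounded (C 0)"
  shows "\<exists>v. \<forall>n. v \<in> C n"
proof -
  define D where "D n = Inf ((\<lambda>x. (norm x)\<^sup>2) ` C n)" for n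
  have bb: "bdd_below ((\<lambda>x. (norm x)\<^sup>2) ` C n)" for n by (rule bdd_belowI[of _ 0]) auto
  have D_le: "D n \<le> (norm x)\<^sup>2" if "x \<in> C n" for n x
    unfolding D_def using bb that by (intro cInf_lower) auto
  have "\<exists>x. x \<in> C n \<and> (norm x)\<^sup>2 < D n + 1 / real (Suc n)" for n
  proof -
    have "Inf ((\<lambda>x. (norm x)\<^sup>2) ` C n) < D n + 1 / real (Suc n)" by (simp add: D_def)
    then have "\<exists>a\<in>(\<lambda>x. (norm x)\<^sup>2) ` C n. a < D n + 1 / real (Suc n)"
      by (rule cInf_lessD[rotated]) (simp add: C(3))
    then show ?thesis by (simp add: Bex_def)
  qed
  then obtain x where x: "\<And>n. x n \<in> C n" and x_lt: "\<And>n. (norm (x n))\<^sup>2 < D n + 1 / real (Suc n)"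
    by metis
  obtain B where B: "\<And>y. y \<in> C 0 \<Longrightarrow> norm y \<le> B" using bdd by (auto simp: bounded_iff)
  have "incseq D"
    unfolding incseq_def D_def using dec C(3) bb by (intro allI impI cInf_superset_mono image_mono) auto
  have "D n \<le> B\<^sup>2" for n
  proof -
    have "norm (x n) \<le> B" using x dec[of 0 n] by (intro B) auto
    then have "(norm (x n))\<^sup>2 \<le> B\<^sup>2" by (intro power_mono) auto
    with D_le[OF x[of n]] show ?thesis by simp
  qed
  with \<open>incseq D\<close> obtain l where l: "D \<longlonglongrightarrow> l" "\<And>n. D n \<le> l"
    using incseq_convergent[of D "B\<^sup>2"] by auto
  \<comment> \<open>The midpoint of \<open>x n\<close> and \<open>x m\<close> lies in the convex set
    \<open>C n\<close>, so its squared norm is at least \<open>D n\<close>; this is the lower bound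
    to insert into the parallelogram identity.\<close>
  have dist: "(norm (x n - x m))\<^sup>2 \<le> 2 * (l - D n) + 4 * (1 / real (Suc n))" if "n \<le> m" for n m
  proof -
    have "x m \<in> C n" using x[of m] dec[OF that] by auto
    then have "(1/2) *\<^sub>R x n + (1/2) *\<^sub>R x m \<in> C n" using C(2)[of n] x[of n] by (intro convexD) auto
    from D_le[OF this] have "D n \<le> (norm ((1/2) *\<^sub>R (x n + x m)))\<^sup>2" by (simp add: scaleR_add_right)
    then have "4 * D n \<le> (norm (x n + x m))\<^sup>2" by (simp add: power_divide)
    moreover have "(norm (x n - x m))\<^sup>2 + (norm (x n + x m))\<^sup>2 = 2 * (norm (x n))\<^sup>2 + 2 * (norm (x m))\<^sup>2"
      by (simp add: power2_norm_eq_inner inner_add_left inner_add_right inner_diff_left inner_diff_right)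
    moreover have "1 / real (Suc m) \<le> 1 / real (Suc n)" using that by (intro divide_left_mono) auto
    ultimately show ?thesis using x_lt[of n] x_lt[of m] l(2)[of m] by argo
  qed
  have "Cauchy x"
  proof (rule metric_CauchyI)
    fix \<epsilon> :: real assume "\<epsilon> > 0"
    have "(\<lambda>n. 2 * (l - D n) + 4 * (1 / real (Suc n))) \<longlonglongrightarrow> 2 * (l - l) + 4 * 0"
      by (intro tendsto_intros l LIMSEQ_Suc[OF lim_const_over_n])
    then have "\<forall>\<^sub>F n in sequentially. 2 * (l - D n) + 4 * (1 / real (Suc n)) < (\<epsilon> / 2)\<^sup>2"
      using \<open>\<epsilon> > 0\<close> by (intro order_tendstoD(2)) auto
    then obtain N where N: "2 * (l - D N) + 4 * (1 / real (Suc N)) < (\<epsilon> / 2)\<^sup>2"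
      by (auto simp: eventually_sequentially)
    have near: "norm (x N - x m) < \<epsilon> / 2" if "N \<le> m" for m
      using dist[OF that] N \<open>\<epsilon> > 0\<close> by (intro power2_less_imp_less[of _ "\<epsilon>/2"]) auto
    have "dist (x m) (x n) < \<epsilon>" if "N \<le> m" "N \<le> n" for m n
      using near[OF that(1)] near[OF that(2)] dist_triangle_half_r[of "x N" "x m" \<epsilon> "x n"]
      by (simp add: dist_norm)
    then show "\<exists>M. \<forall>m\<ge>M. \<forall>n\<ge>M. dist (x m) (x n) < \<epsilon>" by blast
  qed
  then obtain v where v: "x \<longlonglongrightarrow> v" using Cauchy_convergent_iff convergent_def by blast
  have "v \<in> C n" for n
  proof (rule closed_sequentially[OF C(1)])
    show "(\<lambda>i. x (i + n)) \<longlonglongrightarrow> v" by (rule LIMSEQ_ignore_initial_segment[OF v])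
    show "x (i + n) \<in> C n" for i using x[of "i + n"] dec[of n "i + n"] by auto
  qed
  then show ?thesis by blast
qed

lemma closed_convex_hull_point:
  fixes A :: "nat \<Rightarrow> 'v::{real_inner, complete_space} set"
  assumes "\<And>n. A n \<noteq> {}" "\<And>m n. m \<le> n \<Longrightarrow> A n \<subseteq> A m" "\<And>x. x \<in> A 0 \<Longrightarrow> norm x \<le> B"
  shows "\<exists>v. \<forall>n. v \<in> closure (convex hull A n)"
proof (rule decreasing_closed_convex_Inter_nonempty)
  show "closure (convex hull A n) \<subseteq> closure (convex hull A m)" if "m \<le> n" for m n
    using assms(2)[OF that] by (intro closure_mono hull_mono)
  have "convex hull A 0 \<subseteq> cball 0 B" using assms(3) by (intro hull_minimal) auto
  then show "bounded (closure (convex hull A 0))"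
    by (intro bounded_closure) (rule bounded_subset[OF bounded_cball])
qed (use assms(1) in \<open>auto intro: convex_closure\<close>)

lemma closed_convex_hull_halfspace:
  fixes l :: "'v::real_normed_vector \<Rightarrow>\<^sub>L real"
  assumes "v \<in> closure (convex hull A)" "\<And>x. x \<in> A \<Longrightarrow> l x \<le> a"
  shows "l v \<le> a"
proof -
  have "convex {x. l x \<le> a}"
  proof (rule convexI)
    fix x y :: 'v and s t :: real assume *: "x \<in> {x. l x \<le> a}" "y \<in> {x. l x \<le> a}" "0 \<le> s" "0 \<le> t" "s + t = 1"
    then have "s * l x + t * l y \<le> s * a + t * a" by (intro add_mono mult_left_mono) auto
    also have "\<dots> = a" using * by (simp flip: distrib_right)
    finally show "s *\<^sub>R x + t *\<^sub>R y \<in> {x. l x \<le> a}" by (simp add: blinfun.add_right blinfun.scaleR_right)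
  qed
  moreover have "closed {x. l x \<le> a}" by (intro closed_Collect_le continuous_intros)
  ultimately have "closure (convex hull A) \<subseteq> {x. l x \<le> a}"
    using assms(2) by (intro closure_minimal hull_minimal) auto
  with assms(1) show ?thesis by auto
qed

text \<open>Opial's argument, with the closed convex hulls of the tails of the trajectory in place of its
  weak cluster points, so that weak compactness is not needed.\<close>

lemma weakly_convergent_of_separating_limits:
  fixes u :: "real \<Rightarrow> 'v::{real_inner, complete_space}"
  assumes bdd: "\<And>t. T \<le> t \<Longrightarrow> norm (u t) \<le> B"
    and cluster: "\<And>v. (\<And>s. v \<in> closure (convex hull (u ` {s..}))) \<Longrightarrow> v \<in> S"
    and sep: "\<And>v w. v \<in> S \<Longrightarrow> w \<in> S \<Longrightarrow> v \<noteq> w \<Longrightarrow>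
      \<exists>(l :: 'v \<Rightarrow>\<^sub>L real) c. l v \<noteq> l w \<and> ((\<lambda>t. l (u t)) \<longlongrightarrow> c) at_top"
  shows "\<exists>v\<in>S. weakly_tendsto u v at_top"
proof -
  let ?H = "\<lambda>s. closure (convex hull (u ` {s..}))"
  have tail: "v \<in> ?H s" if v: "\<And>n. v \<in> closure (convex hull A n)" and A: "\<And>n. A n \<subseteq> u ` {T + real n..}" for v s A
  proof -
    obtain n where "s \<le> T + real n" using real_arch_simple[of "s - T"] by (auto simp: algebra_simps)
    then have "A n \<subseteq> u ` {s..}" using A[of n] by force
    then show ?thesis using v[of n] closure_mono[OF hull_mono] by blast
  qed
  have "\<exists>v. \<forall>n. v \<in> closure (convex hull (u ` {T + real n..}))"
    by (rule closed_convex_hull_point[where B=B]) (use bdd in \<open>auto intro!: imageI\<close>)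
  then obtain v where v: "v \<in> ?H s" for s using tail[of _ "\<lambda>n. u ` {T + real n..}"] by blast
  have "v \<in> S" by (rule cluster[OF v])
  \<comment> \<open>If \<open>l (u t)\<close> converges, late tails lie in closed half-spaces
    arbitrarily close to the limit, and so do their closed hulls. Using both \<open>l\<close> and
    \<open>- l\<close> gives equality.\<close>
  have limit: "l x = c" if x: "\<And>s. x \<in> ?H s" and lim: "((\<lambda>t. l (u t)) \<longlongrightarrow> c) at_top"
    for x c and l :: "'v \<Rightarrow>\<^sub>L real"
  proof -
    have le: "l x \<le> c" if lim: "((\<lambda>t. l (u t)) \<longlongrightarrow> c) at_top" for c and l :: "'v \<Rightarrow>\<^sub>L real"
    proof (rule field_le_epsilon)
      fix \<epsilon> :: real assume "\<epsilon> > 0"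
      then have "\<forall>\<^sub>F t in at_top. l (u t) < c + \<epsilon>" by (intro order_tendstoD(2)[OF lim]) simp
      then obtain s where s: "\<And>t. s \<le> t \<Longrightarrow> l (u t) < c + \<epsilon>" unfolding eventually_at_top_linorder by blast
      show "l x \<le> c + \<epsilon>"
        by (rule closed_convex_hull_halfspace[OF x[of s]]) (use s in \<open>auto intro: less_imp_le\<close>)
    qed
    have "(- l) x \<le> - c"
      by (rule le) (use tendsto_minus[OF lim] in \<open>simp add: blinfun.minus_left\<close>)
    with le[OF lim] show ?thesis by (simp add: blinfun.minus_left)
  qed
  have unique: "w = v" if w: "\<And>s. w \<in> ?H s" for w
  proof (rule ccontr)
    assume "w \<noteq> v"
    with sep[OF cluster[OF w] \<open>v \<in> S\<close>] obtain l :: "'v \<Rightarrow>\<^sub>L real" and c where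
      "l w \<noteq> l v" "((\<lambda>t. l (u t)) \<longlongrightarrow> c) at_top" by blast
    with limit[OF w] limit[OF v] show False by metis
  qed
  \<comment> \<open>Otherwise there are times \<open>\<tau> n\<close> tending to infinity with
    \<open>l (u (\<tau> n)) \<ge> l v + \<epsilon>\<close>. The closed hulls of the tails of this
    sequence have a common point, which belongs to all hulls of \<open>u\<close> and hence equals
    \<open>v\<close>, although the half-space excludes it.\<close>
  have upper: "\<forall>\<^sub>F t in at_top. l (u t) < l v + \<epsilon>" if "\<epsilon> > 0" for \<epsilon> and l :: "'v \<Rightarrow>\<^sub>L real"
  proof (rule ccontr)
    assume "\<not> ?thesis"
    then have "\<exists>t\<ge>s. l v + \<epsilon> \<le> l (u t)" for s
      unfolding eventually_at_top_linorder by (meson not_le)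
    then have "\<forall>n. \<exists>t. T + real n \<le> t \<and> l v + \<epsilon> \<le> l (u t)" by blast
    then obtain \<tau> where \<tau>: "\<And>n::nat. T + real n \<le> \<tau> n" "\<And>n. l v + \<epsilon> \<le> l (u (\<tau> n))"
      by metis
    have sub: "(\<lambda>i. u (\<tau> i)) ` {n..} \<subseteq> u ` {T + real n..}" for n
    proof
      fix y assume "y \<in> (\<lambda>i. u (\<tau> i)) ` {n..}"
      then obtain i where i: "n \<le> i" "y = u (\<tau> i)" by auto
      then have "T + real n \<le> \<tau> i" using \<tau>(1)[of i] by simp
      with i show "y \<in> u ` {T + real n..}" by auto
    qed
    have "\<exists>w. \<forall>n. w \<in> closure (convex hull ((\<lambda>i. u (\<tau> i)) ` {n..}))"
    proof (rule closed_convex_hull_point[where B=B])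
      show "norm x \<le> B" if "x \<in> (\<lambda>i. u (\<tau> i)) ` {0..}" for x
        using subsetD[OF sub that] bdd by auto
    qed auto
    then obtain w where w: "\<And>n. w \<in> closure (convex hull ((\<lambda>i. u (\<tau> i)) ` {n..}))" by blast
    then have "w = v" using tail[OF w sub] by (intro unique)
    moreover have "(- l) w \<le> - (l v + \<epsilon>)"
      by (rule closed_convex_hull_halfspace[OF w[of 0]]) (use \<tau>(2) in \<open>auto simp: blinfun.minus_left algebra_simps\<close>)
    ultimately show False using that by (simp add: blinfun.minus_left)
  qed
  have "weakly_tendsto u v at_top"
    unfolding weakly_tendsto_def
  proof (intro allI order_tendstoI)
    fix l :: "'v \<Rightarrow>\<^sub>L real" and a
    show "\<forall>\<^sub>F t in at_top. l (u t) < a" if "l v < a"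
      using upper[of "a - l v" l] that by simp
    show "\<forall>\<^sub>F t in at_top. a < l (u t)" if "a < l v"
      using upper[of "l v - a" "- l"] that by (simp add: blinfun.minus_left)
  qed
  with \<open>v \<in> S\<close> show ?thesis by blast
qed

text \<open>Restriction to the line through \<open>x\<close> and \<open>y\<close> reduces this to
  the tangent inequality in one variable.\<close>

lemma convex_on_above_tangent:
  fixes \<phi> :: "'v::real_normed_vector \<Rightarrow> real"
  assumes conv: "convex_on UNIV \<phi>" and d: "(\<phi> has_derivative D) (at x)"
  shows "D (y - x) \<le> \<phi> y - \<phi> x"
proof -
  interpret D: bounded_linear D using d by (rule has_derivative_bounded_linear)
  define \<psi> where "\<psi> s = \<phi> (x + s *\<^sub>R (y - x))" for s :: real
  have "convex_on UNIV \<psi>"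
  proof (rule convex_onI)
    fix t a b :: real assume t: "0 < t" "t < 1"
    have "x + ((1 - t) *\<^sub>R a + t *\<^sub>R b) *\<^sub>R (y - x) = (1 - t) *\<^sub>R (x + a *\<^sub>R (y - x)) + t *\<^sub>R (x + b *\<^sub>R (y - x))"
      by (simp add: algebra_simps)
    then show "\<psi> ((1 - t) *\<^sub>R a + t *\<^sub>R b) \<le> (1 - t) * \<psi> a + t * \<psi> b"
      unfolding \<psi>_def using convex_onD[OF conv, of t "x + a *\<^sub>R (y - x)" "x + b *\<^sub>R (y - x)"] t by simp
  qed simp
  moreover have "(\<psi> has_real_derivative D (y - x)) (at 0)"
  proof -
    have "((\<lambda>s. \<phi> (x + s *\<^sub>R (y - x))) has_derivative (\<lambda>s. D (s *\<^sub>R (y - x)))) (at 0)"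
      by (rule has_derivative_compose[of "\<lambda>s. x + s *\<^sub>R (y - x)" "\<lambda>s. s *\<^sub>R (y - x)"])
         (use d in \<open>auto intro!: derivative_eq_intros\<close>)
    then show ?thesis
      by (simp add: \<psi>_def[abs_def] has_field_derivative_def D.scaleR mult_commute_abs)
  qed
  ultimately have "D (y - x) * (1 - 0) \<le> \<psi> 1 - \<psi> 0"
    by (intro convex_on_imp_above_tangent[of UNIV \<psi> 0]) auto
  then show ?thesis by (simp add: \<psi>_def)
qed

text \<open>The convexity defect of a symmetric quadratic form is exactly
  \<open>t (1 - t) A (x - y) (x - y)\<close>.\<close>

lemma convex_on_quadratic:
  fixes A :: "'v::real_normed_vector \<Rightarrow>\<^sub>L ('v \<Rightarrow>\<^sub>L real)"
  assumes "\<And>v w. A v w = A w v" "\<And>v. 0 \<le> A v v"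
  shows "convex_on UNIV (\<lambda>v. A v v)"
proof (rule convex_onI)
  fix t :: real and x y :: 'v assume t: "0 < t" "t < 1"
  have "0 \<le> t * (1 - t) * A (x - y) (x - y)" using t assms(2) by simp
  also have "\<dots> = (1 - t) * A x x + t * A y y - A ((1 - t) *\<^sub>R x + t *\<^sub>R y) ((1 - t) *\<^sub>R x + t *\<^sub>R y)"
    using assms(1)[of y x]
    by (simp add: blinfun.add_right blinfun.add_left blinfun.scaleR_right blinfun.scaleR_left
        blinfun.diff_right blinfun.diff_left algebra_simps)
  finally show "A ((1 - t) *\<^sub>R x + t *\<^sub>R y) ((1 - t) *\<^sub>R x + t *\<^sub>R y) \<le> (1 - t) * A x x + t * A y y"
    by simp
qed simp

text \<open>The approximants sample \<open>y\<close> at grid points, which converge to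
  \<open>t\<close>. Cutting them off at time \<open>n\<close> makes their range finite.\<close>

lemma continuous_imp_strongly_measurable_on:
  fixes y :: "real \<Rightarrow> 'a::real_normed_vector"
  assumes "continuous_on {0..} y"
  shows "strongly_measurable_on {0..} y"
proof -
  define x where "x n r = real_of_int \<lfloor>real (Suc n) * r\<rfloor> / real (Suc n)" for n r
  \<comment> \<open>The index \<open>-1\<close> marks times outside \<open>{0..<real n}\<close>,
    where the approximant is 0; genuine grid indices are nonnegative.\<close>
  define i where "i n t = (if t \<in> {0..<real n} then \<lfloor>real (Suc n) * t\<rfloor> else -1)" for n t
  have i: "simple_function lebesgue (i n)" for n
    unfolding simple_function_def
  proof
    have "i n t \<in> {-1..int (Suc n * n)}" for t
    proof (cases "t \<in> {0..<real n}")
      case True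
      then have "real (Suc n) * t \<le> real (Suc n) * real n" by (intro mult_left_mono) auto
      also have "\<dots> = real_of_int (int (Suc n * n))" by (simp add: algebra_simps)
      finally have "\<lfloor>real (Suc n) * t\<rfloor> \<le> int (Suc n * n)" by linarith
      moreover have "-1 \<le> \<lfloor>real (Suc n) * t\<rfloor>" using True by (simp add: le_floor_iff mult_nonneg_nonneg order_trans[of "-1" 0])
      ultimately show ?thesis using True by (simp add: i_def)
    next
      case False
      then have "i n t = -1" unfolding i_def by (rule if_not_P)
      moreover have "0 \<le> int (Suc n * n)" by (rule of_nat_0_le_iff)
      ultimately show ?thesis by (simp only: atLeastAtMost_iff) linarith
    qed
    then have "i n ` space lebesgue \<subseteq> {-1..int (Suc n * n)}" by blast
    then show "finite (i n ` space lebesgue)" by (rule finite_subset) (rule finite_atLeastAtMost_int)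
    have "(\<lambda>t. i n t) \<in> measurable lborel (count_space UNIV)"
      unfolding i_def by measurable
    then have "i n \<in> measurable lebesgue (count_space UNIV)" by (rule measurable_completion)
    then show "\<forall>k\<in>i n ` space lebesgue. i n -` {k} \<inter> space lebesgue \<in> sets lebesgue"
      by (intro ballI measurable_sets) (auto simp: sets_count_space)
  qed
  define s where "s n t = (if i n t = -1 then 0 else y (real_of_int (i n t) / real (Suc n)))" for n t
  have "simple_function lebesgue (s n)" for n
    unfolding s_def by (rule simple_function_compose1[OF i])
  moreover have "(\<lambda>n. s n t) \<longlonglongrightarrow> indicator {0..} t *\<^sub>R y t" for t
  proof (cases "t \<ge> 0")
    case True
    have lim: "(\<lambda>n. x n t) \<longlonglongrightarrow> t" unfolding x_def by (rule floor_mult_divide_tendsto)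
    have "(\<lambda>n. y (x n t)) \<longlonglongrightarrow> y t"
      by (rule continuous_on_tendsto_compose[OF assms lim]) (use True in \<open>auto simp: x_def\<close>)
    moreover obtain m where m: "t < real m" using reals_Archimedean2 by blast
    have "\<forall>\<^sub>F n in sequentially. y (x n t) = s n t"
    proof (rule eventually_sequentiallyI[of m])
      fix n assume "m \<le> n"
      then have i_eq: "i n t = \<lfloor>real (Suc n) * t\<rfloor>" using m True by (auto simp: i_def)
      have "0 \<le> \<lfloor>real (Suc n) * t\<rfloor>" using True by simp
      then have "i n t \<noteq> -1" unfolding i_eq by linarith
      then show "y (x n t) = s n t" unfolding s_def x_def i_eq[symmetric] by simp
    qed
    ultimately show ?thesis using True by (auto intro: Lim_transform_eventually)
  next
    case False
    then show ?thesis by (simp add: s_def i_def)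
  qed
  ultimately show ?thesis unfolding strongly_measurable_on_def by (auto intro!: exI[of _ s])
qed

section \<open>The perturbed heavy ball equation\<close>

lemma potential_has_derivative:
  fixes A :: "'v::real_normed_vector \<Rightarrow>\<^sub>L ('v \<Rightarrow>\<^sub>L real)" and f :: "'v \<Rightarrow> ('v \<Rightarrow>\<^sub>L real)"
  assumes A_sym: "\<And>v w. A v w = A w v" and F: "\<And>v. (F has_derivative blinfun_apply (f v)) (at v)"
  shows "(potential A F has_derivative blinfun_apply (A v + f v)) (at v)"
proof -
  have "((\<lambda>v. A v v) has_derivative (\<lambda>h. A v h + A h v)) (at v)"
    by (auto intro!: derivative_eq_intros bounded_linear_imp_has_derivative blinfun.bounded_linear_right)
  then have "((\<lambda>v. 1/2 * A v v + F v) has_derivative (\<lambda>h. 1/2 * (A v h + A h v) + f v h)) (at v)"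
    by (intro has_derivative_add[OF has_derivative_mult_right F])
  moreover have "(\<lambda>h. 1/2 * (A v h + A h v) + f v h) = blinfun_apply (A v + f v)"
    using A_sym[of _ v] by (auto simp: blinfun.add_left)
  ultimately show ?thesis by (simp add: potential_def[abs_def])
qed

lemma convex_on_potential:
  fixes A :: "'v::real_normed_vector \<Rightarrow>\<^sub>L ('v \<Rightarrow>\<^sub>L real)"
  assumes "\<And>v w. A v w = A w v" "\<And>v. 0 \<le> A v v" "convex_on UNIV F"
  shows "convex_on UNIV (potential A F)"
  unfolding potential_def[abs_def]
  by (intro convex_on_add convex_on_cmul convex_on_quadratic assms) auto

lemma argmin_set_iff: "v \<in> argmin_set \<Phi> \<longleftrightarrow> (\<forall>w. \<Phi> v \<le> \<Phi> w)"
  for \<Phi> :: "'v \<Rightarrow> real"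
  by (auto simp: argmin_set_def is_arg_min_def not_less)

lemma INF_eq_argmin: "v \<in> argmin_set \<Phi> \<Longrightarrow> (INF w. \<Phi> w) = \<Phi> v"
  for \<Phi> :: "'v \<Rightarrow> real"
  by (intro cInf_eq_minimum) (auto simp: argmin_set_iff)

text \<open>For \<open>x > 1\<close> the constant \<open>b\<close> is at most \<open>b x\<close>,
  and a factor \<open>x\<close> cancels.\<close>

lemma bounded_of_quadratic_le:
  fixes x :: real
  assumes "\<mu> > 0" "0 \<le> b" "0 \<le> d" "0 \<le> x" "\<mu> * x\<^sup>2 \<le> b + d * x"
  shows "x \<le> max 1 ((b + d) / \<mu>)"
proof (cases "x \<le> 1")
  case False
  then have "\<mu> * x * x \<le> (b + d) * x"
    using assms mult_left_mono[of 1 x b] by (simp add: power2_eq_square algebra_simps)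
  then have "\<mu> * x \<le> b + d" using False by simp
  then have "x \<le> (b + d) / \<mu>" using assms(1) by (simp add: field_simps)
  then show ?thesis by simp
qed simp

lemma weighted_norm_integrable:
  fixes g :: "real \<Rightarrow> 'a::real_normed_vector"
  assumes g: "L1_on {0..} g" and fin: "(\<integral>\<^sup>+t\<in>{0..}. ennreal ((1 + t) powr \<beta> * norm (g t) ^ k) \<partial>lebesgue) < \<infinity>"
    and "k > 0"
  shows "(\<lambda>t. (1 + t) powr \<beta> * norm (g t) ^ k) absolutely_integrable_on {0..}"
  unfolding set_integrable_def
proof (rule integrableI_bounded)
  have "(\<lambda>t. indicator {0..} t *\<^sub>R norm (g t)) \<in> borel_measurable lebesgue"
    using L1_on_norm[OF g] by (auto simp: set_integrable_def)
  then have "(\<lambda>t. (indicator {0..} t *\<^sub>R norm (g t)) ^ k) \<in> borel_measurable lebesgue"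
    by (rule borel_measurable_power)
  moreover have "(\<lambda>t. (1 + t) powr \<beta>) \<in> borel_measurable lebesgue"
    by (rule measurable_completion) measurable
  ultimately have "(\<lambda>t. (1 + t) powr \<beta> * (indicator {0..} t *\<^sub>R norm (g t)) ^ k) \<in> borel_measurable lebesgue"
    by (rule borel_measurable_times[rotated])
  \<comment> \<open>At negative times the indicator is 0, and its power is 0 because
    \<open>k > 0\<close>.\<close>
  also have "(\<lambda>t. (1 + t) powr \<beta> * (indicator {0..} t *\<^sub>R norm (g t)) ^ k)
      = (\<lambda>t. indicator {0..} t *\<^sub>R ((1 + t) powr \<beta> * norm (g t) ^ k))"
    using \<open>k > 0\<close> by (auto simp: fun_eq_iff indicator_def)
  finally show "(\<lambda>t. indicator {0..} t *\<^sub>R ((1 + t) powr \<beta> * norm (g t) ^ k)) \<in> borel_measurable lebesgue" .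
  have "(\<integral>\<^sup>+t. ennreal (norm (indicator {0..} t *\<^sub>R ((1 + t) powr \<beta> * norm (g t) ^ k))) \<partial>lebesgue)
      = (\<integral>\<^sup>+t\<in>{0..}. ennreal ((1 + t) powr \<beta> * norm (g t) ^ k) \<partial>lebesgue)"
    by (intro nn_integral_cong) (auto simp: indicator_def)
  with fin show "(\<integral>\<^sup>+t. ennreal (norm (indicator {0..} t *\<^sub>R ((1 + t) powr \<beta> * norm (g t) ^ k))) \<partial>lebesgue) < \<infinity>"
    by simp
qed

theorem theorem1p2:
  fixes j :: "'v::{real_inner, complete_space} \<Rightarrow>\<^sub>L 'h::{real_inner, complete_space}"
    and \<alpha> K t\<^sub>0 lam \<mu> :: real
    and \<gamma> :: "real \<Rightarrow> real"
    and A :: "'v \<Rightarrow>\<^sub>L ('v \<Rightarrow>\<^sub>L real)"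
    and f :: "'v \<Rightarrow> ('v \<Rightarrow>\<^sub>L real)"
    and F :: "'v \<Rightarrow> real"
    and g :: "real \<Rightarrow> 'h"
    and u :: "real \<Rightarrow> 'v"
    and u' u'' :: "real \<Rightarrow> 'h"
  assumes embedding: "inj (blinfun_apply j)" "closure (range (blinfun_apply j)) = UNIV"
    and alpha: "0 \<le> \<alpha>" "\<alpha> < 1"
    and gamma_W11: "W11_loc \<gamma>"
    and gamma_nonneg: "\<And>t. t \<ge> 0 \<Longrightarrow> \<gamma> t \<ge> 0"
    and gamma_lower: "K > 0" "t\<^sub>0 \<ge> 0" "\<And>t. t \<ge> t\<^sub>0 \<Longrightarrow> \<gamma> t \<ge> K / (1 + t) powr \<alpha>"
    and gamma_decr: "\<exists>w. weak_deriv (\<lambda>t. (1 + t) powr \<alpha> * \<gamma> t) w \<and>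
                         (AE t in lebesgue. t \<ge> t\<^sub>0 \<longrightarrow> w t \<le> 0)"
    and A_sym: "\<And>v w. A v w = A w v"
    and A_pos: "\<And>v. A v v \<ge> 0"
    and A_coercive: "lam \<ge> 0" "\<mu> > 0"
        "\<And>v. A v v + lam * (norm (j v))\<^sup>2 \<ge> \<mu> * (norm v)\<^sup>2"
    and f_cont: "continuous_on UNIV f"
    and F_convex: "convex_on UNIV F"
    and F_deriv: "\<And>v. (F has_derivative blinfun_apply (f v)) (at v)"
    and argmin_nonempty: "argmin_set (potential A F) \<noteq> {}"
    and g_L1: "L1_on {0..} g"
    and g_weighted_L1: "(\<integral>\<^sup>+t\<in>{0..}. ennreal ((1 + t) powr \<alpha> * norm (g t)) \<partial>lebesgue) < \<infinity>"
    and g_weighted_L2: "(\<integral>\<^sup>+t\<in>{0..}. ennreal ((1 + t) powr (3 * \<alpha>) * (norm (g t))\<^sup>2) \<partial>lebesgue) < \<infinity>"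
    and u_W11_V: "W11_loc u"
    and u_W21_H: "weak_deriv (\<lambda>t. j (u t)) u'" "W11_loc u'" "weak_deriv u' u''"
    and equation: "AE t in lebesgue. t \<ge> 0 \<longrightarrow>
        to_dual j (u'' t) + \<gamma> t *\<^sub>R to_dual j (u' t) + A (u t) + f (u t) = to_dual j (g t)"
  shows "Linfty_on {0..} (\<lambda>t. j (u t)) \<and>
         (\<exists>v \<in> argmin_set (potential A F). weakly_tendsto u v at_top) \<and>
         energy (potential A F) u u' \<in> o[at_top](\<lambda>t. t powr (-2 * \<alpha>))"
proof -
  let ?\<Phi> = "potential A F"
  let ?D = "\<lambda>x. A x + f x"
  let ?S = "argmin_set ?\<Phi>"
  have cu: "continuous_on {0..} u" and cu': "continuous_on {0..} u'" and c\<gamma>: "continuous_on {0..} \<gamma>"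
    using u_W11_V u_W21_H gamma_W11 by (auto simp: W11_loc_def)
  have cju: "continuous_on {0..} (\<lambda>t. j (u t))" by (intro continuous_intros cu)
  obtain w where w: "weak_deriv u w" using u_W11_V by (auto simp: W11_loc_def)
  have u_prim: "primitive_on_halfline u w" by (rule weak_deriv_imp_primitive[OF cu w])
  have ju_prim: "primitive_on_halfline (\<lambda>t. j (u t)) u'"
    by (rule weak_deriv_imp_primitive[OF cju u_W21_H(1)])
  have u'_prim: "primitive_on_halfline u' u''" by (rule weak_deriv_imp_primitive[OF cu' u_W21_H(3)])
  have jw: "AE t in lebesgue. 0 \<le> t \<longrightarrow> j (w t) = u' t"
    by (rule weak_deriv_unique[OF cju weak_deriv_bounded_linear[OF blinfun.bounded_linear_right w] u_W21_H(1)])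
  obtain c' where c': "weak_deriv (\<lambda>t. (1 + t) powr \<alpha> * \<gamma> t) c'" "AE t in lebesgue. t\<^sub>0 \<le> t \<longrightarrow> c' t \<le> 0"
    using gamma_decr by blast
  have c_prim: "primitive_on_halfline (\<lambda>t. (1 + t) powr \<alpha> * \<gamma> t) c'"
    by (rule weak_deriv_imp_primitive[OF _ c'(1)]) (intro continuous_intros c\<gamma>, auto)
  have \<Phi>_deriv: "(?\<Phi> has_derivative ?D v) (at v)" for v
    by (rule potential_has_derivative[OF A_sym F_deriv])
  have D_cont: "continuous_on UNIV ?D" by (intro continuous_intros f_cont)
  have \<Phi>_convex: "convex_on UNIV ?\<Phi>" by (rule convex_on_potential[OF A_sym A_pos F_convex])
  have eq: "AE t in lebesgue. 0 \<le> t \<longrightarrow> (\<forall>h. u'' t \<bullet> j h + \<gamma> t * (u' t \<bullet> j h) + ?D (u t) h = g t \<bullet> j h)"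
    using equation
  proof (eventually_elim, intro impI allI)
    fix t :: real and h assume E: "0 \<le> t \<longrightarrow> to_dual j (u'' t) + \<gamma> t *\<^sub>R to_dual j (u' t) + A (u t) + f (u t) = to_dual j (g t)"
      and "0 \<le> t"
    then have "blinfun_apply (to_dual j (u'' t) + \<gamma> t *\<^sub>R to_dual j (u' t) + A (u t) + f (u t)) h = to_dual j (g t) h"
      by simp
    then show "u'' t \<bullet> j h + \<gamma> t * (u' t \<bullet> j h) + ?D (u t) h = g t \<bullet> j h"
      by (simp add: to_dual_def blinfun.add_left blinfun.scaleR_left)
  qed
  define e where "e t = 1/2 * (norm (u' t))\<^sup>2 + ?\<Phi> (u t) - (INF v. ?\<Phi> v)" for t
  define e' where "e' t = 1/2 * (u'' t \<bullet> u' t + u' t \<bullet> u'' t) + ?D (u t) (w t)" for t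
  have e_prim: "primitive_on_halfline e e'"
    unfolding e_def e'_def power2_norm_eq_inner
    by (intro primitive_on_halfline_diff_const primitive_on_halfline_add primitive_on_halfline_cmult
        primitive_on_halfline_inner u'_prim primitive_on_halfline_chain[OF u_prim \<Phi>_deriv D_cont])
  have e_ineq: "AE t in lebesgue. 0 \<le> t \<longrightarrow>
      e' t \<le> - ((1 + t) powr \<alpha> * \<gamma> t / (1 + t) powr \<alpha>) * (norm (u' t))\<^sup>2 + norm (g t) * norm (u' t)"
    using eq jw
  proof (eventually_elim, intro impI)
    fix t :: real assume E: "0 \<le> t \<longrightarrow> (\<forall>h. u'' t \<bullet> j h + \<gamma> t * (u' t \<bullet> j h) + ?D (u t) h = g t \<bullet> j h)"
      and jw: "0 \<le> t \<longrightarrow> j (w t) = u' t" and "0 \<le> t"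
    \<comment> \<open>Testing the equation with \<open>w t\<close>, which \<open>j\<close> maps to
      \<open>u' t\<close>, exchanges the potential part of \<open>e'\<close> for the damping and
      source terms; the terms with \<open>u''\<close> cancel.\<close>
    from E \<open>0 \<le> t\<close> have "u'' t \<bullet> j (w t) + \<gamma> t * (u' t \<bullet> j (w t)) + ?D (u t) (w t) = g t \<bullet> j (w t)"
      by blast
    then have "e' t = - \<gamma> t * (norm (u' t))\<^sup>2 + g t \<bullet> u' t"
      using jw \<open>0 \<le> t\<close> by (simp add: e'_def inner_commute power2_norm_eq_inner)
    then show "e' t \<le> - ((1 + t) powr \<alpha> * \<gamma> t / (1 + t) powr \<alpha>) * (norm (u' t))\<^sup>2 + norm (g t) * norm (u' t)"
      using norm_cauchy_schwarz[of "g t" "u' t"] \<open>0 \<le> t\<close> by simp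
  qed
  \<comment> \<open>Kept general in the minimizer \<open>v\<close>: bounds and decay need one,
    whereas Opial's argument compares the distances to two of them. The energy \<open>e\<close> is
    the same for all.\<close>
  have ineqs: "damped_inequalities \<alpha> K t\<^sub>0 (\<lambda>t. (1 + t) powr \<alpha> * \<gamma> t) c' e e' (\<lambda>t. norm (u' t))
      (\<lambda>t. norm (j (u t) - j v)) (\<lambda>t. (j (u t) - j v) \<bullet> u' t) (\<lambda>t. u' t \<bullet> u' t + (j (u t) - j v) \<bullet> u'' t)
      (\<lambda>t. norm (g t))" if v: "v \<in> ?S" for v
  proof
    have jv: "primitive_on_halfline (\<lambda>t. j (u t) - j v) u'"
      by (rule primitive_on_halfline_diff_const[OF ju_prim])
    show "primitive_on_halfline (\<lambda>t. (j (u t) - j v) \<bullet> u' t) (\<lambda>t. u' t \<bullet> u' t + (j (u t) - j v) \<bullet> u'' t)"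
      by (rule primitive_on_halfline_inner[OF jv u'_prim])
    show "primitive_on_halfline (\<lambda>t. (norm (j (u t) - j v))\<^sup>2 / 2) (\<lambda>t. (j (u t) - j v) \<bullet> u' t)"
      using primitive_on_halfline_cmult[OF primitive_on_halfline_inner[OF jv jv], of "1/2"]
      by (simp add: power2_norm_eq_inner inner_commute)
    show "K \<le> (1 + t) powr \<alpha> * \<gamma> t" if "t\<^sub>0 \<le> t" for t
      using gamma_lower(3)[OF that] that gamma_lower(2) by (simp add: field_simps)
    show "(norm (u' t))\<^sup>2 / 2 \<le> e t" for t
      using v by (simp add: e_def INF_eq_argmin[OF v] argmin_set_iff)
    show "\<bar>(j (u t) - j v) \<bullet> u' t\<bar> \<le> norm (u' t) * norm (j (u t) - j v)" for t
      using Cauchy_Schwarz_ineq2[of "j (u t) - j v" "u' t"] by (simp add: mult.commute)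
    show "(\<lambda>t. (1 + t) powr \<alpha> * norm (g t)) absolutely_integrable_on {0..}"
      using weighted_norm_integrable[OF g_L1, of \<alpha> 1] g_weighted_L1 by simp
    show "(\<lambda>t. (1 + t) powr (3 * \<alpha>) * (norm (g t))\<^sup>2) absolutely_integrable_on {0..}"
      using weighted_norm_integrable[OF g_L1, of "3 * \<alpha>" 2] g_weighted_L2 by simp
    show "AE t in lebesgue. 0 \<le> t \<longrightarrow> u' t \<bullet> u' t + (j (u t) - j v) \<bullet> u'' t
        \<le> - ((1 + t) powr \<alpha> * \<gamma> t / (1 + t) powr \<alpha>) * ((j (u t) - j v) \<bullet> u' t) + 3 / 2 * (norm (u' t))\<^sup>2 - e t
           + norm (g t) * norm (j (u t) - j v)"
      using eq
    proof (eventually_elim, intro impI)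
      fix t :: real assume E: "0 \<le> t \<longrightarrow> (\<forall>h. u'' t \<bullet> j h + \<gamma> t * (u' t \<bullet> j h) + ?D (u t) h = g t \<bullet> j h)" and "0 \<le> t"
      \<comment> \<open>The test vector is \<open>u t - v\<close>. Convexity bounds the potential
        term below by \<open>e t - 1/2 * (norm (u' t))\<^sup>2\<close>, which together with
        \<open>u' t \<bullet> u' t\<close> explains the coefficient \<open>3 / 2\<close>.\<close>
      have "u'' t \<bullet> j (u t - v) + \<gamma> t * (u' t \<bullet> j (u t - v)) + ?D (u t) (u t - v) = g t \<bullet> j (u t - v)"
        using E \<open>0 \<le> t\<close> by blast
      moreover have "?D (u t) (v - u t) \<le> ?\<Phi> v - ?\<Phi> (u t)"
        by (rule convex_on_above_tangent[OF \<Phi>_convex \<Phi>_deriv])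
      then have "?\<Phi> (u t) - ?\<Phi> v \<le> ?D (u t) (u t - v)"
        by (simp add: blinfun.diff_right)
      moreover have "g t \<bullet> j (u t - v) \<le> norm (g t) * norm (j (u t - v))"
        by (rule norm_cauchy_schwarz)
      ultimately have "u'' t \<bullet> j (u t - v) \<le> - \<gamma> t * (u' t \<bullet> j (u t - v)) - (?\<Phi> (u t) - ?\<Phi> v) + norm (g t) * norm (j (u t - v))"
        by linarith
      moreover have "e t = 1/2 * (norm (u' t))\<^sup>2 + (?\<Phi> (u t) - ?\<Phi> v)" by (simp add: e_def INF_eq_argmin[OF v])
      moreover have "u' t \<bullet> u' t = (norm (u' t))\<^sup>2" by (simp add: power2_norm_eq_inner)
      moreover have "j (u t) - j v = j (u t - v)" by (simp add: blinfun.diff_right)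
      ultimately show "u' t \<bullet> u' t + (j (u t) - j v) \<bullet> u'' t
        \<le> - ((1 + t) powr \<alpha> * \<gamma> t / (1 + t) powr \<alpha>) * ((j (u t) - j v) \<bullet> u' t) + 3 / 2 * (norm (u' t))\<^sup>2 - e t
           + norm (g t) * norm (j (u t) - j v)"
        using \<open>0 \<le> t\<close> by (simp add: inner_commute)
    qed
  qed (use alpha gamma_lower c_prim c'(2) e_prim e_ineq in auto)
  obtain v\<^sub>0 where v0: "v\<^sub>0 \<in> ?S" using argmin_nonempty by blast
  interpret D: damped_inequalities \<alpha> K t\<^sub>0 "\<lambda>t. (1 + t) powr \<alpha> * \<gamma> t" c' e e' "\<lambda>t. norm (u' t)"
      "\<lambda>t. norm (j (u t) - j v\<^sub>0)" "\<lambda>t. (j (u t) - j v\<^sub>0) \<bullet> u' t" "\<lambda>t. u' t \<bullet> u' t + (j (u t) - j v\<^sub>0) \<bullet> u'' t"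
      "\<lambda>t. norm (g t)"
    by (rule ineqs[OF v0])
  obtain R where R: "\<And>t. 0 \<le> t \<Longrightarrow> norm (j (u t)) \<le> R"
  proof -
    obtain R where R: "\<forall>t\<ge>0. norm (j (u t) - j v\<^sub>0) \<le> R" using D.r_bounded by blast
    have "norm (j (u t)) \<le> R + norm (j v\<^sub>0)" if "0 \<le> t" for t
      using R that norm_triangle_sub[of "j (u t)" "j v\<^sub>0"] by fastforce
    then show thesis by (rule that)
  qed
  have "Linfty_on {0..} (\<lambda>t. j (u t))"
    unfolding Linfty_on_def
    using continuous_imp_strongly_measurable_on[OF cju] R by (auto intro!: exI[of _ R])
  moreover have smallo: "energy ?\<Phi> u u' \<in> o[at_top](\<lambda>t. t powr (-2 * \<alpha>))"
  proof (rule smalloI_tendsto)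
    show "((\<lambda>t. energy ?\<Phi> u u' t / t powr (-2 * \<alpha>)) \<longlongrightarrow> 0) at_top"
    proof (rule Lim_null_comparison[OF _ D.X_tendsto_0])
      show "\<forall>\<^sub>F t in at_top. norm (energy ?\<Phi> u u' t / t powr (-2 * \<alpha>)) \<le> D.X t"
      proof (rule eventually_at_top_linorderI[of 0])
        fix t :: real assume "0 \<le> t"
        have "energy ?\<Phi> u u' t / t powr (-2 * \<alpha>) = t powr (2 * \<alpha>) * e t"
          by (simp add: energy_def e_def powr_minus_divide)
        then have "norm (energy ?\<Phi> u u' t / t powr (-2 * \<alpha>)) = t powr (2 * \<alpha>) * e t"
          using D.e_nonneg[of t] by (simp only: real_norm_def abs_of_nonneg mult_nonneg_nonneg powr_ge_zero)
        also have "\<dots> \<le> D.X t"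
          unfolding D.X_def using D.e_nonneg[of t] \<open>0 \<le> t\<close> alpha by (intro mult_right_mono powr_mono2) auto
        finally show "norm (energy ?\<Phi> u u' t / t powr (-2 * \<alpha>)) \<le> D.X t" .
      qed
    qed
    show "\<forall>\<^sub>F t in at_top. (t::real) powr (-2 * \<alpha>) \<noteq> 0"
      by (rule eventually_at_top_linorderI[of 1]) auto
  qed
  moreover have "\<exists>v\<in>?S. weakly_tendsto u v at_top"
  proof -
    have e_lt: "\<forall>\<^sub>F t in at_top. ?\<Phi> (u t) < ?\<Phi> v\<^sub>0 + \<epsilon> \<and> 0 \<le> t" if "\<epsilon> > 0" for \<epsilon>
      using order_tendstoD(2)[OF D.X_tendsto_0 that] eventually_ge_at_top[of 0]
    proof eventually_elim
      case (elim t)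
      have "1 * e t \<le> D.X t"
        unfolding D.X_def using elim alpha D.e_nonneg[of t] by (intro mult_right_mono ge_one_powr_ge_zero) auto
      moreover have "?\<Phi> (u t) - ?\<Phi> v\<^sub>0 \<le> e t" by (simp add: e_def INF_eq_argmin[OF v0])
      ultimately show ?case using elim by simp
    qed
    obtain T where T: "\<And>t. T \<le> t \<Longrightarrow> ?\<Phi> (u t) < ?\<Phi> v\<^sub>0 + 1 \<and> 0 \<le> t"
      using e_lt[of 1] unfolding eventually_at_top_linorder by auto
    \<comment> \<open>\<open>F\<close> lies above its tangent at \<open>v\<^sub>0\<close>, so
      \<open>- 2 F (u t)\<close> grows at most linearly in the norm of \<open>u t\<close>, with
      slope \<open>d\<close>. The remaining contributions to \<open>A u u + lam |j u|^2\<close> are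
      collected in \<open>b\<close>, the 1 being the margin in the choice of \<open>T\<close>.
      Coercivity then bounds \<open>u\<close> in \<open>V\<close>.\<close>
    define d where "d = 2 * norm (f v\<^sub>0)"
    define b where "b = 2 * (\<bar>?\<Phi> v\<^sub>0\<bar> + 1 + \<bar>F v\<^sub>0 - f v\<^sub>0 v\<^sub>0\<bar>) + lam * R\<^sup>2"
    have u_bdd: "norm (u t) \<le> max 1 ((b + d) / \<mu>)" if "T \<le> t" for t
    proof (rule bounded_of_quadratic_le[OF A_coercive(2)])
      show "0 \<le> b" "0 \<le> d" using A_coercive(1) by (auto simp: b_def d_def)
      have "\<mu> * (norm (u t))\<^sup>2 \<le> A (u t) (u t) + lam * (norm (j (u t)))\<^sup>2" by (rule A_coercive(3))
      moreover have "lam * (norm (j (u t)))\<^sup>2 \<le> lam * R\<^sup>2"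
        using A_coercive(1) R T[OF that] by (intro mult_left_mono power_mono) auto
      moreover have "A (u t) (u t) = 2 * ?\<Phi> (u t) - 2 * F (u t)" by (simp add: potential_def)
      moreover have "?\<Phi> (u t) < ?\<Phi> v\<^sub>0 + 1" using T[OF that] by blast
      moreover have "f v\<^sub>0 (u t) - f v\<^sub>0 v\<^sub>0 \<le> F (u t) - F v\<^sub>0"
        using convex_on_above_tangent[OF F_convex F_deriv, of v\<^sub>0 "u t"] by (simp add: blinfun.diff_right)
      moreover have "\<bar>f v\<^sub>0 (u t)\<bar> \<le> norm (f v\<^sub>0) * norm (u t)" using norm_blinfun[of "f v\<^sub>0" "u t"] by simp
      ultimately show "\<mu> * (norm (u t))\<^sup>2 \<le> b + d * norm (u t)"
        unfolding b_def d_def by (simp add: algebra_simps abs_if split: if_splits)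
    qed simp
    show ?thesis
    proof (rule weakly_convergent_of_separating_limits[OF u_bdd])
      fix v assume v: "\<And>s. v \<in> closure (convex hull (u ` {s..}))"
      \<comment> \<open>Sublevel sets of the potential are closed and convex. By decay of the energy
        each one above the minimum contains a tail of the trajectory, hence its closed convex
        hull.\<close>
      have "?\<Phi> v \<le> ?\<Phi> v\<^sub>0"
      proof (rule field_le_epsilon)
        fix \<epsilon> :: real assume "\<epsilon> > 0"
        obtain s where s: "\<And>t. s \<le> t \<Longrightarrow> ?\<Phi> (u t) < ?\<Phi> v\<^sub>0 + \<epsilon>"
          using e_lt[OF \<open>\<epsilon> > 0\<close>] unfolding eventually_at_top_linorder by auto
        have "convex {x. ?\<Phi> x \<le> ?\<Phi> v\<^sub>0 + \<epsilon>}"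
        proof (rule convexI)
          fix x y s t assume *: "x \<in> {x. ?\<Phi> x \<le> ?\<Phi> v\<^sub>0 + \<epsilon>}" "y \<in> {x. ?\<Phi> x \<le> ?\<Phi> v\<^sub>0 + \<epsilon>}"
            "0 \<le> s" "0 \<le> t" "s + t = (1::real)"
          then have "?\<Phi> (s *\<^sub>R x + t *\<^sub>R y) \<le> s * ?\<Phi> x + t * ?\<Phi> y"
            using \<Phi>_convex by (auto simp: convex_on_def)
          also have "\<dots> \<le> s * (?\<Phi> v\<^sub>0 + \<epsilon>) + t * (?\<Phi> v\<^sub>0 + \<epsilon>)"
            using * by (intro add_mono mult_left_mono) auto
          also have "\<dots> = ?\<Phi> v\<^sub>0 + \<epsilon>" using * by (simp flip: distrib_right)
          finally show "s *\<^sub>R x + t *\<^sub>R y \<in> {x. ?\<Phi> x \<le> ?\<Phi> v\<^sub>0 + \<epsilon>}" by simp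
        qed
        moreover have "continuous_on UNIV ?\<Phi>"
          using \<Phi>_deriv by (meson continuous_at_imp_continuous_on has_derivative_continuous)
        then have "closed {x. ?\<Phi> x \<le> ?\<Phi> v\<^sub>0 + \<epsilon>}"
          by (intro closed_Collect_le continuous_on_const)
        ultimately have "closure (convex hull (u ` {s..})) \<subseteq> {x. ?\<Phi> x \<le> ?\<Phi> v\<^sub>0 + \<epsilon>}"
          using s by (intro closure_minimal hull_minimal) (auto intro: less_imp_le)
        with v[of s] show "?\<Phi> v \<le> ?\<Phi> v\<^sub>0 + \<epsilon>" by auto
      qed
      with v0 show "v \<in> ?S" by (auto simp: argmin_set_iff intro: order_trans)
    next
      fix x y assume xy: "x \<in> ?S" "y \<in> ?S" "x \<noteq> y"
      obtain a where a: "((\<lambda>t. norm (j (u t) - j x)) \<longlongrightarrow> a) at_top"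
        using damped_inequalities.r_convergent[OF ineqs[OF xy(1)]] by blast
      obtain b where b: "((\<lambda>t. norm (j (u t) - j y)) \<longlongrightarrow> b) at_top"
        using damped_inequalities.r_convergent[OF ineqs[OF xy(2)]] by blast
      \<comment> \<open>By polarization the difference of the squared distances to \<open>x\<close>
        and \<open>y\<close> is affine in \<open>u t\<close>, with this functional, up to a factor
        2, as its linear part; hence it has a limit along \<open>u\<close>. Injectivity of
        \<open>j\<close> makes it separate \<open>x\<close> from \<open>y\<close>.\<close>
      let ?l = "to_dual j (j x - j y)"
      have l_eq: "?l (u t) = ((norm (j (u t) - j y))\<^sup>2 - (norm (j (u t) - j x))\<^sup>2 - (norm (j y))\<^sup>2 + (norm (j x))\<^sup>2) / 2" for t
        by (simp add: to_dual_def power2_norm_eq_inner inner_diff_left inner_diff_right inner_commute)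
      have "((\<lambda>t. ?l (u t)) \<longlongrightarrow> (b\<^sup>2 - a\<^sup>2 - (norm (j y))\<^sup>2 + (norm (j x))\<^sup>2) / 2) at_top"
        unfolding l_eq by (intro tendsto_intros a b) simp
      moreover have "?l x - ?l y = (norm (j x - j y))\<^sup>2"
        by (simp add: to_dual_def power2_norm_eq_inner flip: inner_diff_right)
      then have "?l x \<noteq> ?l y" using xy(3) embedding(1) by (auto simp: inj_eq)
      ultimately show "\<exists>(l :: 'v \<Rightarrow>\<^sub>L real) c. l x \<noteq> l y \<and> ((\<lambda>t. l (u t)) \<longlongrightarrow> c) at_top"
        by blast
    qed
  qed
  ultimately show ?thesis by blast
qed

end
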